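(* Let $\mathcal{O}$ be an oriented matroid of rank $r$ with ground set $E$ and $f\ne g\in E$. Let $I=[e_1,\dots,e_k]$, $k\le r$, be an ordered set of independent elements of $E$. Let $l\le k$ be the smallest index with $f\in\mathrm{cl}(\{e_1,\dots,e_l\})$ ($l=k+1$ if none), and $m\le k$ the smallest index with $g\in\mathrm{cl}(\{e_1,\dots,e_m\})$ ($m=k+1$ if none). Assume (i) $(\mathcal{O},g,f)$ is a Euclidean oriented matroid program; (ii) $(\mathcal{O},e_1,f),\dots,(\mathcal{O},e_k,f)$ are Euclidean oriented matroid programs; (iii) $(\mathcal{O},e_1,g),\dots,(\mathcal{O},e_k,g)$ are Euclidean oriented matroid programs; (iv) if $\min(l,m)<k+1$ or if $f$ or $g$ is not in general position, then with $n=\min(\max(l,m),k-1)$ the programs $(\mathcal{O}/\{e_1,\dots,e_{i-1}\},e_i,e_j)$ are Euclidean for all $1\le i\le n$ and $i<j\le k$. Let $\mathcal{O}'=\mathcal{O}\cup p$ be the lexicographic extension $\mathcal{O}[e_1^+,\dots,e_k^+]$. Then $(\mathcal{O}',g,f)$ is a Euclidean oriented matroid program.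
   Context: Oriented matroids are given by covectors in $\{+,-,0\}^E$; cocircuits are minimal nonzero covectors; $z(X)=\{e:X_e=0\}$, $\mathrm{sep}(X,Y)=\{e:X_e=-Y_e\ne0\}$, conformal means $\mathrm{sep}=\emptyset$. Cocircuits $X\ne\pm Y$ are comodular if $z(X\circ Y)$ is a flat of rank $r-2$; elimination of $e\in\mathrm{sep}(X,Y)$ yields the unique cocircuit $Z$ with $Z_e=0$, $\mathrm{supp}(Z)\subseteq\mathrm{supp}(X\circ Y)\setminus\{e\}$. An oriented matroid program $(\mathcal{O},g,f)$: distinct $g,f$, $g$ not a loop, $f$ not a coloop. For comodular cocircuits $X,Y$ with $X_g=Y_g\ne0$ and $Z$ the elimination of $g$ between $-X$ and $Y$: $X\to Y$, $X\leftarrow Y$, undirected according as $Z_f=+,-,0$. $G_f$: vertices cocircuits with $g=+$, edges conformal comodular pairs, directed so; the program is Euclidean if $G_f$ has no directed cycle (closed sequence of distinct vertices, each edge forward or undirected, at least one forward). An element $f$ is in general position if $f\notin\mathrm{cl}(S)$ for all $S\subseteq E\setminus\{f\}$ of rank $<r$. $\mathcal{O}[e_1^+,\dots,e_k^+]=\mathcal{O}\cup p$ is the single-element extension by $p$ with localization $\sigma(Y)=Y_{e_i}$ for cocircuits $Y$, $i$ least with $Y_{e_i}\ne0$, and $\sigma(Y)=0$ if none. *)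

theory Defs
  imports Main
begin

section \<open>Sign vectors\<close>

text \<open>
  A sign vector is a function into \<open>{-1, 0, 1}\<close>, with \<open>1\<close>, \<open>-1\<close> for the signs \<open>+\<close>, \<open>-\<close>.
  Sign vectors on a ground set \<open>E\<close> are functions vanishing outside \<open>E\<close>; negation is the
  pointwise \<open>uminus\<close> on functions.
\<close>

type_synonym 'a signvec = "'a \<Rightarrow> int"

definition supp :: "'a signvec \<Rightarrow> 'a set" where
  "supp X = {e. X e \<noteq> 0}"

definition sep :: "'a signvec \<Rightarrow> 'a signvec \<Rightarrow> 'a set" where
  "sep X Y = {e. X e = - Y e \<and> X e \<noteq> 0}"

definition conformal :: "'a signvec \<Rightarrow> 'a signvec \<Rightarrow> bool" where
  "conformal X Y \<longleftrightarrow> sep X Y = {}"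

definition scomp :: "'a signvec \<Rightarrow> 'a signvec \<Rightarrow> 'a signvec"  (infixl "\<odot>" 75) where
  "X \<odot> Y = (\<lambda>e. if X e \<noteq> 0 then X e else Y e)"

section \<open>Oriented matroids\<close>

record 'a signed_system =
  ground :: "'a set"
  covectors :: "'a signvec set"

locale oriented_matroid =
  fixes M :: "'a signed_system"
  assumes finite_ground: "finite (ground M)"
    and covector_range: "X \<in> covectors M \<Longrightarrow> X e \<in> {-1, 0, 1}"
    and covector_outside: "X \<in> covectors M \<Longrightarrow> e \<notin> ground M \<Longrightarrow> X e = 0"
    and zero_covector: "(\<lambda>_. 0) \<in> covectors M"
    and uminus_covector: "X \<in> covectors M \<Longrightarrow> - X \<in> covectors M"
    and scomp_covector: "X \<in> covectors M \<Longrightarrow> Y \<in> covectors M \<Longrightarrow> X \<odot> Y \<in> covectors M"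
    and covector_elimination:
      "X \<in> covectors M \<Longrightarrow> Y \<in> covectors M \<Longrightarrow> e \<in> sep X Y \<Longrightarrow>
        \<exists>Z \<in> covectors M. Z e = 0 \<and> (\<forall>d. d \<notin> sep X Y \<longrightarrow> Z d = (X \<odot> Y) d)"

definition cocircuits :: "'a signed_system \<Rightarrow> 'a signvec set" where
  "cocircuits M = {X \<in> covectors M. supp X \<noteq> {} \<and>
     (\<forall>Y \<in> covectors M. supp Y \<noteq> {} \<longrightarrow> \<not> supp Y \<subset> supp X)}"

definition zero_set :: "'a signed_system \<Rightarrow> 'a signvec \<Rightarrow> 'a set" where
  "zero_set M X = {e \<in> ground M. X e = 0}"

text \<open>The underlying matroid: its flats are the zero sets of the covectors.\<close>

definition flats :: "'a signed_system \<Rightarrow> 'a set set" where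
  "flats M = zero_set M ` covectors M"

definition cl :: "'a signed_system \<Rightarrow> 'a set \<Rightarrow> 'a set" where
  "cl M S = \<Inter> {F \<in> flats M. S \<subseteq> F}"

definition independent :: "'a signed_system \<Rightarrow> 'a set \<Rightarrow> bool" where
  "independent M I \<longleftrightarrow> I \<subseteq> ground M \<and> (\<forall>e \<in> I. e \<notin> cl M (I - {e}))"

definition rank_of :: "'a signed_system \<Rightarrow> 'a set \<Rightarrow> nat" where
  "rank_of M S = Max {card I | I. I \<subseteq> S \<and> independent M I}"

definition om_rank :: "'a signed_system \<Rightarrow> nat" where
  "om_rank M = rank_of M (ground M)"

definition loop :: "'a signed_system \<Rightarrow> 'a \<Rightarrow> bool" where
  "loop M e \<longleftrightarrow> e \<in> cl M {}"

definition coloop :: "'a signed_system \<Rightarrow> 'a \<Rightarrow> bool" where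
  "coloop M e \<longleftrightarrow> e \<in> ground M \<and> e \<notin> cl M (ground M - {e})"

definition general_position :: "'a signed_system \<Rightarrow> 'a \<Rightarrow> bool" where
  "general_position M f \<longleftrightarrow>
     (\<forall>S. S \<subseteq> ground M - {f} \<and> rank_of M S < om_rank M \<longrightarrow> f \<notin> cl M S)"

definition contract :: "'a signed_system \<Rightarrow> 'a set \<Rightarrow> 'a signed_system" where
  "contract M A = \<lparr>ground = ground M - A,
                   covectors = {X \<in> covectors M. \<forall>a \<in> A. X a = 0}\<rparr>"

definition delete :: "'a signed_system \<Rightarrow> 'a set \<Rightarrow> 'a signed_system" where
  "delete M A = \<lparr>ground = ground M - A,
                 covectors = (\<lambda>X e. if e \<in> A then 0 else X e) ` covectors M\<rparr>"

section \<open>Oriented matroid programs\<close>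

text \<open>The rank condition is written additively to avoid truncated subtraction.\<close>

definition comodular :: "'a signed_system \<Rightarrow> 'a signvec \<Rightarrow> 'a signvec \<Rightarrow> bool" where
  "comodular M X Y \<longleftrightarrow> X \<in> cocircuits M \<and> Y \<in> cocircuits M \<and> X \<noteq> Y \<and> X \<noteq> - Y \<and>
     zero_set M (X \<odot> Y) \<in> flats M \<and> rank_of M (zero_set M (X \<odot> Y)) + 2 = om_rank M"

text \<open>
  For comodular \<open>X\<close>, \<open>Y\<close> and \<open>e \<in> sep X Y\<close>, the condition on supports determines the cocircuit
  \<open>Z\<close> only up to sign; the last conjunct, taken from the elimination axiom, fixes the sign.
\<close>

definition elimination ::
  "'a signed_system \<Rightarrow> 'a \<Rightarrow> 'a signvec \<Rightarrow> 'a signvec \<Rightarrow> 'a signvec \<Rightarrow> bool" where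
  "elimination M e X Y Z \<longleftrightarrow> Z \<in> cocircuits M \<and> Z e = 0 \<and> supp Z \<subseteq> supp (X \<odot> Y) - {e} \<and>
     (\<forall>d. d \<notin> sep X Y \<longrightarrow> Z d = (X \<odot> Y) d)"

definition om_program :: "'a signed_system \<Rightarrow> 'a \<Rightarrow> 'a \<Rightarrow> bool" where
  "om_program M g f \<longleftrightarrow> oriented_matroid M \<and> g \<in> ground M \<and> f \<in> ground M \<and> g \<noteq> f \<and>
     \<not> loop M g \<and> \<not> coloop M f"

definition forward :: "'a signed_system \<Rightarrow> 'a \<Rightarrow> 'a \<Rightarrow> 'a signvec \<Rightarrow> 'a signvec \<Rightarrow> bool" where
  "forward M g f X Y \<longleftrightarrow> comodular M X Y \<and> X g = Y g \<and> X g \<noteq> 0 \<and>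
     (\<exists>Z. elimination M g (- X) Y Z \<and> Z f = 1)"

definition undirected :: "'a signed_system \<Rightarrow> 'a \<Rightarrow> 'a \<Rightarrow> 'a signvec \<Rightarrow> 'a signvec \<Rightarrow> bool" where
  "undirected M g f X Y \<longleftrightarrow> comodular M X Y \<and> X g = Y g \<and> X g \<noteq> 0 \<and>
     (\<exists>Z. elimination M g (- X) Y Z \<and> Z f = 0)"

definition graph_vertices :: "'a signed_system \<Rightarrow> 'a \<Rightarrow> 'a signvec set" where
  "graph_vertices M g = {X \<in> cocircuits M. X g = 1}"

definition graph_edge :: "'a signed_system \<Rightarrow> 'a \<Rightarrow> 'a signvec \<Rightarrow> 'a signvec \<Rightarrow> bool" where
  "graph_edge M g X Y \<longleftrightarrow> X \<in> graph_vertices M g \<and> Y \<in> graph_vertices M g \<and>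
     conformal X Y \<and> comodular M X Y"

definition directed_cycle :: "'a signed_system \<Rightarrow> 'a \<Rightarrow> 'a \<Rightarrow> 'a signvec list \<Rightarrow> bool" where
  "directed_cycle M g f Xs \<longleftrightarrow> Xs \<noteq> [] \<and> distinct Xs \<and>
     (\<forall>i < length Xs.
        let X = Xs ! i; Y = Xs ! (Suc i mod length Xs)
        in graph_edge M g X Y \<and> (forward M g f X Y \<or> undirected M g f X Y)) \<and>
     (\<exists>i < length Xs. forward M g f (Xs ! i) (Xs ! (Suc i mod length Xs)))"

definition euclidean_program :: "'a signed_system \<Rightarrow> 'a \<Rightarrow> 'a \<Rightarrow> bool" where
  "euclidean_program M g f \<longleftrightarrow> om_program M g f \<and> (\<nexists>Xs. directed_cycle M g f Xs)"

section \<open>Lexicographic extensions\<close>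

text \<open>
  \<open>M'\<close> is the single-element extension of \<open>M\<close> by \<open>p\<close> with localization \<open>\<sigma>\<close>: every cocircuit
  \<open>Y\<close> of \<open>M\<close> extends to the cocircuit \<open>(Y, \<sigma> Y)\<close> of \<open>M'\<close>. As usual for localizations,
  extensions preserve the rank, that is, \<open>p\<close> is not a coloop; otherwise \<open>\<sigma> = 0\<close> would describe
  both a loop and a coloop \<open>p\<close>.
\<close>

definition extension_with_localization ::
  "'a signed_system \<Rightarrow> 'a \<Rightarrow> ('a signvec \<Rightarrow> int) \<Rightarrow> 'a signed_system \<Rightarrow> bool" where
  "extension_with_localization M p \<sigma> M' \<longleftrightarrow>
     oriented_matroid M' \<and> p \<notin> ground M \<and> ground M' = insert p (ground M) \<and>
     delete M' {p} = M \<and> \<not> coloop M' p \<and>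
     (\<forall>Y \<in> cocircuits M. Y(p := \<sigma> Y) \<in> cocircuits M')"

definition lex_localization :: "(nat \<Rightarrow> 'a) \<Rightarrow> nat \<Rightarrow> 'a signvec \<Rightarrow> int" where
  "lex_localization e k Y =
     (if \<exists>i \<in> {1..k}. Y (e i) \<noteq> 0 then Y (e (LEAST i. i \<in> {1..k} \<and> Y (e i) \<noteq> 0)) else 0)"

definition lex_extension ::
  "'a signed_system \<Rightarrow> (nat \<Rightarrow> 'a) \<Rightarrow> nat \<Rightarrow> 'a \<Rightarrow> 'a signed_system \<Rightarrow> bool" where
  "lex_extension M e k p M' \<longleftrightarrow> extension_with_localization M p (lex_localization e k) M'"

definition span_index :: "'a signed_system \<Rightarrow> (nat \<Rightarrow> 'a) \<Rightarrow> nat \<Rightarrow> 'a \<Rightarrow> nat" where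
  "span_index M e k x =
     (if \<exists>i \<in> {1..k}. x \<in> cl M (e ` {1..i})
      then LEAST i. i \<in> {1..k} \<and> x \<in> cl M (e ` {1..i}) else k + 1)"

end

theory Submission
  imports Defs
begin

text \<open>
  Think of \<open>p\<close> as \<open>e 1 + \<epsilon> e 2 + \<epsilon>\<^sup>2 e 3 + \<dots>\<close> with infinitesimal \<open>\<epsilon>\<close>. A cocircuit \<open>X\<close> of the
  extension that is not one of the original oriented matroid lies on \<open>p\<close>, infinitesimally close to an
  original cocircuit \<open>V\<close> on its line, say \<open>X = V + V1\<close> with \<open>V1\<close> on \<open>g\<close>. Edges are directed by increasing
  \<open>f/g\<close>, and \<open>f/g\<close> at \<open>X\<close> equals \<open>f/g\<close> at \<open>V\<close> plus the product of \<open>f/p\<close> at \<open>V1\<close> and \<open>-p/g\<close> at \<open>V\<close>.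
  Acyclicity of \<open>(g, f)\<close> makes \<open>f/g\<close> at \<open>V\<close> constant along a directed cycle, then the sign of \<open>f\<close> at
  \<open>V1\<close> is constant, and if it is zero nothing is directed. Otherwise the whole cycle lies on \<open>p\<close> and
  the values of \<open>p/g\<close> at \<open>V\<close> and, after that, of \<open>f/p\<close> at \<open>V1\<close> are monotone, hence constant. The last
  two steps need that \<open>(p, g)\<close> and \<open>(p, f)\<close> are acyclic on original cocircuits; expanding \<open>p\<close>, this follows
  from the programs \<open>(e i, g)\<close>, \<open>(e i, f)\<close> and, for ties, from those on the contractions.
\<close>

section \<open>Rank and closure from covectors\<close>

text \<open>Signs carry no magnitudes, so ratios are compared through integer potentials: acyclicity
  of a program becomes a \<open>height\<close>, and what is monotone along a closed walk is
  constant. Acyclicity concerns conformal edges, but limits of consecutive vertices need not be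
  conformal; hence heights are first extended to all comodular pairs. The obstacle is that
  \<open>f/g\<close> may be zero, infinite or undetermined at a limit. Whether the limit lies on
  \<open>f\<close> but not on \<open>g\<close> is invariant along a cycle, and so is the same
  condition with \<open>f\<close> and \<open>g\<close> exchanged; exchanging them reverses all
  directions, so infinite values can be excluded. If the limit lies on both, \<open>f\<close> and
  \<open>g\<close> are parallel on the line of the vertex, and any old cocircuit of that line with
  the right sign at \<open>g\<close> can replace the limit. Condition (iv) serves ties between an
  element \<open>x\<close> and the leading term of \<open>p\<close>. Up to leading index
  \<open>max l m\<close> the contractions break them; beyond it \<open>x\<close> is in the closure
  of the earlier elements and vanishes with them; for \<open>x\<close> in general position no tie
  occurs.\<close>

definition van :: "'a signed_system \<Rightarrow> 'a set \<Rightarrow> 'a signvec set" where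
  "van M S = {T \<in> covectors M. \<forall>s \<in> S. T s = 0}"

lemma van_insert: "T \<in> van M (insert x S) \<longleftrightarrow> T x = 0 \<and> T \<in> van M S"
  by (auto simp: van_def)

lemma van_empty: "T \<in> van M {} \<longleftrightarrow> T \<in> covectors M"
  by (auto simp: van_def)

lemma van_mono: "S \<subseteq> S' \<Longrightarrow> van M S' \<subseteq> van M S"
  by (auto simp: van_def)

lemma van_cov: "T \<in> van M S \<Longrightarrow> T \<in> covectors M"
  by (auto simp: van_def)

lemma van_zero: "T \<in> van M S \<Longrightarrow> s \<in> S \<Longrightarrow> T s = 0"
  by (auto simp: van_def)

lemma cl_iff:
  assumes "S \<subseteq> ground M"
  shows "x \<in> cl M S \<longleftrightarrow> (\<forall>T \<in> van M S. x \<in> ground M \<and> T x = 0)"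
proof -
  have S: "S \<subseteq> zero_set M T \<longleftrightarrow> (\<forall>s\<in>S. T s = 0)" for T
    using assms by (auto simp: zero_set_def)
  have "x \<in> cl M S \<longleftrightarrow> (\<forall>T \<in> covectors M. S \<subseteq> zero_set M T \<longrightarrow> x \<in> zero_set M T)"
    by (auto simp: cl_def flats_def)
  then show ?thesis
    unfolding S by (auto simp: van_def zero_set_def)
qed

text \<open>To be thought of as \<open>Z = Y - X\<close>, where \<open>X\<close> and \<open>Y\<close> are scaled to agree at \<open>g\<close>.\<close>

definition diff :: "'a signed_system \<Rightarrow> 'a \<Rightarrow> 'a signvec \<Rightarrow> 'a signvec \<Rightarrow> 'a signvec \<Rightarrow> bool" where
  "diff M g X Y Z \<longleftrightarrow> Z \<in> covectors M \<and> Z g = 0 \<and> (\<forall>d. X d = 0 \<longrightarrow> Z d = Y d) \<and>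
     (\<forall>d. Y d = 0 \<longrightarrow> Z d = - X d) \<and> (\<forall>d. X d = - Y d \<longrightarrow> Z d = Y d)"

lemma diff_g: "diff M g X Y Z \<Longrightarrow> Z g = 0"
  and diff_left: "diff M g X Y Z \<Longrightarrow> X d = 0 \<Longrightarrow> Z d = Y d"
  and diff_right: "diff M g X Y Z \<Longrightarrow> Y d = 0 \<Longrightarrow> Z d = - X d"
  and diff_opp: "diff M g X Y Z \<Longrightarrow> X d = - Y d \<Longrightarrow> Z d = Y d"
  and diff_cov: "diff M g X Y Z \<Longrightarrow> Z \<in> covectors M"
  by (auto simp: diff_def)

lemma diff_van:
  assumes "diff M g X Y Z" "X \<in> van M S" "Y \<in> van M S"
  shows "Z \<in> van M S"
  using assms by (auto simp: diff_def van_def)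

context oriented_matroid
begin

lemma sign_cases:
  assumes "X \<in> covectors M"
  obtains "X x = 0" | "X x = 1" | "X x = -1"
  using covector_range[OF assms, of x] by auto

lemma cov_ground: "X \<in> covectors M \<Longrightarrow> X x \<noteq> 0 \<Longrightarrow> x \<in> ground M"
  using covector_outside by blast

lemma van_uminus: "T \<in> van M S \<Longrightarrow> - T \<in> van M S"
  using uminus_covector by (auto simp: van_def)

lemma zero_in_van: "(\<lambda>_. 0) \<in> van M S"
  using zero_covector by (auto simp: van_def)

lemma diff_antisym:
  assumes "diff M g X Y Z"
  shows "diff M g Y X (- Z)"
  using assms uminus_covector by (auto simp: diff_def)

lemma diff_uminus:
  assumes "diff M g X Y Z"
  shows "diff M g (- X) (- Y) (- Z)"
  using assms uminus_covector
  by (auto simp: diff_def)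

lemma diff_exists:
  assumes "X \<in> covectors M" "Y \<in> covectors M" "X g = Y g" "X g \<noteq> 0"
  obtains Z where "diff M g X Y Z"
proof -
  have "g \<in> sep (- X) Y" using assms by (auto simp: sep_def)
  then obtain Z where Z: "Z \<in> covectors M" "Z g = 0" "\<And>d. d \<notin> sep (- X) Y \<Longrightarrow> Z d = (- X \<odot> Y) d"
    using covector_elimination[OF uminus_covector[OF assms(1)] assms(2)] by blast
  have "diff M g X Y Z"
    unfolding diff_def
  proof (intro conjI allI impI)
    fix d
    show "Z d = Y d" if "X d = 0"
      using Z(3)[of d] that by (auto simp: sep_def scomp_def)
    show "Z d = - X d" if "Y d = 0"
      using Z(3)[of d] that by (auto simp: sep_def scomp_def)
    show "Z d = Y d" if "X d = - Y d"
      using Z(3)[of d] that by (auto simp: sep_def scomp_def)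
  qed (use Z in auto)
  then show ?thesis by (rule that)
qed

section \<open>Closure, independent sets and rank of the underlying matroid\<close>

lemma cl_extensive: "S \<subseteq> ground M \<Longrightarrow> S \<subseteq> cl M S"
  by (auto simp: cl_iff van_def)

lemma cl_ground: "S \<subseteq> ground M \<Longrightarrow> cl M S \<subseteq> ground M"
  using zero_in_van[of S] by (auto simp: cl_iff)

lemma van_cl: "S \<subseteq> ground M \<Longrightarrow> T \<in> van M S \<Longrightarrow> x \<in> cl M S \<Longrightarrow> T x = 0"
  by (auto simp: cl_iff)

lemma not_clI: "S \<subseteq> ground M \<Longrightarrow> T \<in> van M S \<Longrightarrow> T x \<noteq> 0 \<Longrightarrow> x \<notin> cl M S"
  by (auto simp: cl_iff)

lemma not_clE:
  assumes "S \<subseteq> ground M" "x \<in> ground M" "x \<notin> cl M S"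
  obtains T where "T \<in> van M S" "T x \<noteq> 0"
  using assms by (auto simp: cl_iff)

lemma van_of_cl: "S \<subseteq> ground M \<Longrightarrow> S' \<subseteq> cl M S \<Longrightarrow> van M S \<subseteq> van M S'"
  by (auto simp: van_def cl_iff)

lemma cl_subset_cl: "S \<subseteq> ground M \<Longrightarrow> S' \<subseteq> cl M S \<Longrightarrow> cl M S' \<subseteq> cl M S"
  using van_of_cl[of S S'] cl_ground[of S] by (auto simp: cl_iff subset_iff)

text \<open>Elimination yields exchange: a covector off \<open>x\<close> that vanishes on
  \<open>y\<close> and \<open>S\<close>, with its sign at \<open>x\<close> adjusted, is subtracted
  from one off \<open>y\<close> that vanishes on \<open>S\<close>. The difference vanishes on
  \<open>x\<close> but not on \<open>y\<close>.\<close>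

lemma cl_exchange:
  assumes S: "S \<subseteq> ground M" and x: "x \<in> ground M" and y: "y \<in> cl M (insert x S)" "y \<notin> cl M S"
  shows "x \<in> cl M (insert y S)"
proof (rule ccontr)
  assume nx: "x \<notin> cl M (insert y S)"
  have yg: "y \<in> ground M" using y cl_ground[of "insert x S"] S x by auto
  obtain T where T: "T \<in> van M (insert y S)" "T x \<noteq> 0"
    using not_clE[OF _ x nx] S yg by auto
  obtain U where U: "U \<in> van M S" "U y \<noteq> 0" using not_clE[OF S yg y(2)] by auto
  have Ux: "U x \<noteq> 0"
    using U y(1) S x by (auto simp: cl_iff van_insert)
  obtain T' where T': "T' \<in> van M S" "T' y = 0" "T' x = U x"
  proof (cases "T x = U x")
    case True then show ?thesis using T that by (auto simp: van_insert)
  next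
    case False
    then have "T x = - U x"
      using Ux T covector_range[of T x] covector_range[of U x] U by (auto simp: van_def)
    then show ?thesis using that[of "-T"] T van_uminus[of T S] by (auto simp: van_insert)
  qed
  obtain Z where Z: "diff M x T' U Z"
    using diff_exists[of T' U x] T' U Ux by (auto simp: van_def)
  have "Z \<in> van M (insert x S)" "Z y = U y"
    using diff_van[OF Z T'(1) U(1)] diff_g[OF Z] diff_left[OF Z T'(2)] by (auto simp: van_insert)
  then show False using U(2) y(1) S x by (auto simp: cl_iff)
qed

lemma independent_insert:
  assumes I: "independent M I" and x: "x \<in> ground M" "x \<notin> cl M I"
  shows "independent M (insert x I)"
proof -
  have Ig: "I \<subseteq> ground M" using I by (auto simp: independent_def)
  have xI: "x \<notin> I" using x cl_extensive[OF Ig] by auto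
  have "y \<notin> cl M (insert x I - {y})" if "y \<in> insert x I" for y
  proof (cases "y = x")
    case True then show ?thesis using xI x by simp
  next
    case False
    then have yI: "y \<in> I" using that by auto
    show ?thesis
    proof
      assume "y \<in> cl M (insert x I - {y})"
      then have "y \<in> cl M (insert x (I - {y}))" using False by (simp add: insert_Diff_if)
      moreover have "y \<notin> cl M (I - {y})" using I yI by (auto simp: independent_def)
      ultimately have "x \<in> cl M (insert y (I - {y}))"
        using cl_exchange[of "I - {y}" x y] Ig x by auto
      then show False using x yI by (simp add: insert_absorb)
    qed
  qed
  then show ?thesis using Ig x by (auto simp: independent_def)
qed

lemma independent_subset: 
  assumes "independent M I" "J \<subseteq> I" shows "independent M J"
proof -
  have "y \<notin> cl M (J - {y})" if "y \<in> J" for y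
  proof
    assume y: "y \<in> cl M (J - {y})"
    have "cl M (J - {y}) \<subseteq> cl M (I - {y})"
      using cl_subset_cl[of "I - {y}" "J - {y}"] cl_extensive[of "I - {y}"] assms
      by (auto simp: independent_def)
    then show False using y assms that by (auto simp: independent_def)
  qed
  then show ?thesis using assms by (auto simp: independent_def)
qed

lemma independent_finite: "independent M I \<Longrightarrow> finite I"
  using finite_ground finite_subset by (auto simp: independent_def)

text \<open>Steinitz exchange, by induction on \<open>card (J - I)\<close>: an element of
  \<open>J\<close> outside \<open>I\<close> is replaced by an element of \<open>I\<close>, which
  keeps the size of \<open>J\<close>.\<close>

lemma independent_card_le:
  assumes I: "I \<subseteq> ground M" and "independent M J" "J \<subseteq> cl M I"
  shows "card J \<le> card I"
  using assms(2,3)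
proof (induction "card (J - I)" arbitrary: J)
  case 0
  then have "J \<subseteq> I" using independent_finite by auto
  then show ?case using I finite_ground finite_subset card_mono by metis
next
  case (Suc n)
  then obtain x where x: "x \<in> J" "x \<notin> I" by (metis card.empty Diff_eq_empty_iff nat.distinct(1) subsetI)
  let ?K = "J - {x}"
  have K: "independent M ?K" using Suc independent_subset by blast
  have Kg: "?K \<subseteq> ground M" using K by (auto simp: independent_def)
  have "\<exists>y\<in>I. y \<notin> cl M ?K"
  proof (rule ccontr)
    assume "\<not> ?thesis"
    then have "cl M I \<subseteq> cl M ?K" using cl_subset_cl[OF Kg] by blast
    then show False using x Suc.prems by (auto simp: independent_def)
  qed
  then obtain y where y: "y \<in> I" "y \<notin> cl M ?K" by auto
  have yK: "y \<notin> ?K" using y cl_extensive[OF Kg] by auto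
  have ind: "independent M (insert y ?K)" using independent_insert[OF K] y I by auto
  have "insert y ?K - I = (J - I) - {x}" using y by auto
  then have "card (insert y ?K - I) = n" using Suc(2) x by simp
  then have "card (insert y ?K) \<le> card I"
    using Suc(1)[OF _ ind] Suc.prems y cl_extensive[OF I] by auto
  moreover have "card (insert y ?K) = card J"
    using yK x independent_finite[OF Suc.prems(1)] by (metis card.remove card_insert_disjoint finite_Diff)
  ultimately show ?case by simp
qed

lemma rank_eq_card:
  assumes S: "S \<subseteq> ground M" and I: "independent M I" "I \<subseteq> S" "S \<subseteq> cl M I"
  shows "rank_of M S = card I"
proof -
  have fin: "finite {card J | J. J \<subseteq> S \<and> independent M J}"
  proof -
    have "finite S" using S finite_ground finite_subset by blast
    then have "finite (card ` Pow S)" by blast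
    then show ?thesis by (rule finite_subset[rotated]) blast
  qed
  have Ig: "I \<subseteq> ground M" using I S by auto
  show ?thesis unfolding rank_of_def
  proof (rule Max_eqI[OF fin])
    fix y assume "y \<in> {card J | J. J \<subseteq> S \<and> independent M J}"
    then obtain J where J: "y = card J" "J \<subseteq> S" "independent M J" by blast
    then show "y \<le> card I" using independent_card_le[OF Ig J(3)] I by blast
  qed (use I in blast)
qed

lemma independent_empty: "independent M {}"
  by (auto simp: independent_def)

lemma basis_exists:
  assumes S: "S \<subseteq> ground M"
  obtains I where "independent M I" "I \<subseteq> S" "S \<subseteq> cl M I"
proof -
  let ?A = "{I. I \<subseteq> S \<and> independent M I}"
  have "finite S" using S finite_ground finite_subset by blast
  then have "finite ?A" by simp
  moreover have "{} \<in> ?A" using independent_empty by simp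
  ultimately obtain I where I: "I \<in> ?A" "\<forall>J\<in>?A. I \<subseteq> J \<longrightarrow> I = J"
    using finite_has_maximal[of ?A] by auto
  have "S \<subseteq> cl M I"
  proof
    fix x assume x: "x \<in> S"
    show "x \<in> cl M I"
    proof (rule ccontr)
      assume nx: "x \<notin> cl M I"
      then have "insert x I \<in> ?A" using I x S independent_insert[of I x] by auto
      then have "x \<in> I" using I by blast
      then show False using nx cl_extensive[of I] I S by auto
    qed
  qed
  then show ?thesis using that I by auto
qed

lemma rank_insert:
  assumes S: "S \<subseteq> ground M" and x: "x \<in> ground M"
  shows "rank_of M (insert x S) = rank_of M S + (if x \<in> cl M S then 0 else 1)"
proof -
  obtain I where I: "independent M I" "I \<subseteq> S" "S \<subseteq> cl M I" using basis_exists[OF S] .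
  have Ig: "I \<subseteq> ground M" using I S by auto
  have r: "rank_of M S = card I" using rank_eq_card[OF S I] .
  have cleq: "cl M S = cl M I"
    using cl_subset_cl[OF Ig I(3)] cl_subset_cl[OF S] I(2) cl_extensive[OF S] by blast
  show ?thesis
  proof (cases "x \<in> cl M S")
    case True
    then show ?thesis using rank_eq_card[of "insert x S" I] S x I r cleq by auto
  next
    case False
    have ind: "independent M (insert x I)" using independent_insert[OF I(1) x] False cleq by auto
    have "insert x S \<subseteq> cl M (insert x I)"
      using I(3) cl_extensive[of "insert x I"] Ig x cl_subset_cl[of "insert x I" I] by auto
    then have "rank_of M (insert x S) = card (insert x I)"
      using rank_eq_card[of "insert x S" "insert x I"] ind I S x by auto
    moreover have "x \<notin> I" using False cl_extensive[OF Ig] cleq by auto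
    ultimately show ?thesis using r False independent_finite[OF I(1)] by simp
  qed
qed

lemma rank_mono:
  assumes "S \<subseteq> S'" "S' \<subseteq> ground M"
  shows "rank_of M S \<le> rank_of M S'"
proof -
  have S: "S \<subseteq> ground M" using assms by auto
  obtain I where I: "independent M I" "I \<subseteq> S" "S \<subseteq> cl M I" using basis_exists[OF S] .
  obtain J where J: "independent M J" "J \<subseteq> S'" "S' \<subseteq> cl M J" using basis_exists[OF assms(2)] .
  have "card I \<le> card J" using independent_card_le[of J I] I J assms by auto
  then show ?thesis using rank_eq_card[OF S I] rank_eq_card[OF assms(2) J] by simp
qed

lemma rank_le: "S \<subseteq> ground M \<Longrightarrow> rank_of M S \<le> om_rank M"
  using rank_mono[of S "ground M"] by (simp add: om_rank_def)

lemma rank_cong_cl: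
  assumes "S \<subseteq> S'" "S' \<subseteq> cl M S" "S \<subseteq> ground M"
  shows "rank_of M S' = rank_of M S"
proof -
  obtain I where I: "independent M I" "I \<subseteq> S" "S \<subseteq> cl M I" using basis_exists[OF assms(3)] .
  have Ig: "I \<subseteq> ground M" using I assms by auto
  have "S' \<subseteq> cl M I" using cl_subset_cl[OF Ig I(3)] assms by auto
  then show ?thesis
    using rank_eq_card[of S' I] rank_eq_card[OF assms(3) I] I assms cl_ground[OF assms(3)] by auto
qed

lemma rank_cert:
  assumes "S \<subseteq> ground M" "T \<in> van M S" "T x \<noteq> 0"
  shows "rank_of M (insert x S) = rank_of M S + 1"
  using rank_insert[OF assms(1), of x] not_clI[OF assms] cov_ground[of T x] assms by (auto simp: van_def)

lemma full_rank_van: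
  assumes "S \<subseteq> ground M" "rank_of M S = om_rank M" "T \<in> van M S"
  shows "T = (\<lambda>_. 0)"
proof
  fix x show "T x = 0"
  proof (rule ccontr)
    assume "T x \<noteq> 0"
    moreover have "x \<in> ground M" using cov_ground[of T x] assms calculation by (auto simp: van_def)
    ultimately show False
      using rank_cert[OF assms(1,3), of x] rank_le[of "insert x S"] assms by auto
  qed
qed

lemma full_rank_iff:
  assumes "S \<subseteq> ground M" "\<And>T. T \<in> van M S \<Longrightarrow> T = (\<lambda>_. 0)"
  shows "rank_of M S = om_rank M"
proof -
  have "ground M \<subseteq> cl M S" by (auto simp: cl_iff[OF assms(1)] dest: assms(2))
  then show ?thesis using rank_cong_cl[of S "ground M"] assms by (simp add: om_rank_def)
qed

end

section \<open>Cocircuits on lines\<close>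

text \<open>Geometrically, \<open>van M S\<close> is a point, a line or a plane for \<open>c\<close>
  = 1, 2, 3. Each element is a hyperplane of this picture, and "on \<open>x\<close>" means vanishing
  at \<open>x\<close>.\<close>

definition corank :: "'a signed_system \<Rightarrow> nat \<Rightarrow> 'a set \<Rightarrow> bool" where
  "corank M c S \<longleftrightarrow> S \<subseteq> ground M \<and> rank_of M S + c = om_rank M"

abbreviation nz :: "'a signvec \<Rightarrow> bool" where
  "nz X \<equiv> \<exists>x. X x \<noteq> 0"

lemma signvec_minus_minus [simp]: "- (- X) = (X :: 'a signvec)"
  by (simp add: fun_eq_iff)

lemma signvec_minus_swap: "X = - Y \<longleftrightarrow> Y = - (X :: 'a signvec)"
  by (metis signvec_minus_minus)

context oriented_matroid
begin

lemma corank_insert: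
  assumes "corank M (Suc c) S" "T \<in> van M S" "T x \<noteq> 0"
  shows "corank M c (insert x S)"
  using assms rank_cert[of S T x] cov_ground[of T x] by (auto simp: corank_def van_def)

lemma corank_insert2: "corank M 2 S \<Longrightarrow> T \<in> van M S \<Longrightarrow> T x \<noteq> 0 \<Longrightarrow> corank M 1 (insert x S)"
  using corank_insert[of 1 S T x] by (simp add: numeral_2_eq_2)

lemma corank_insert3: "corank M 3 S \<Longrightarrow> T \<in> van M S \<Longrightarrow> T x \<noteq> 0 \<Longrightarrow> corank M 2 (insert x S)"
  using corank_insert[of 2 S T x] by (simp add: numeral_3_eq_3 numeral_2_eq_2)

lemma corank_ground: "corank M c S \<Longrightarrow> S \<subseteq> ground M"
  by (simp add: corank_def)

lemma point_full:
  assumes "corank M 1 S" "T \<in> van M S" "T x \<noteq> 0" "U \<in> van M S" "U x = 0"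
  shows "U = (\<lambda>_. 0)"
proof -
  have "corank M 0 (insert x S)" using corank_insert[of 0 S T x] assms by simp
  then show ?thesis using full_rank_van[of "insert x S" U] assms by (auto simp: corank_def van_insert)
qed

text \<open>The difference normalised at \<open>x\<close> vanishes at \<open>x\<close> and belongs
  to the same point, so it is zero; the clauses of \<open>diff\<close> then leave no coordinate at
  which \<open>T\<close> and \<open>U\<close> could disagree.\<close>

lemma point_eq:
  assumes S: "corank M 1 S" and T: "T \<in> van M S" and U: "U \<in> van M S" and x: "T x = U x" "T x \<noteq> 0"
  shows "T = U"
proof -
  obtain Z where Z: "diff M x T U Z"
    using diff_exists[of T U x] T U x by (auto simp: van_def)
  have Z0: "Z = (\<lambda>_. 0)"
    using point_full[OF S T x(2) diff_van[OF Z T U]] diff_g[OF Z] by simp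
  show ?thesis
  proof
    fix d
    have "T d = 0 \<Longrightarrow> U d = 0" "U d = 0 \<Longrightarrow> T d = 0" "T d = - U d \<Longrightarrow> U d = 0"
      using diff_left[OF Z, of d] diff_right[OF Z, of d] diff_opp[OF Z, of d] Z0 by simp_all
    then show "T d = U d"
      by (cases rule: sign_cases[OF van_cov[OF T], of d]; cases rule: sign_cases[OF van_cov[OF U], of d]) simp_all
  qed
qed

lemma point_unique:
  assumes S: "corank M 1 S" and T: "T \<in> van M S" "nz T" and U: "U \<in> van M S" "nz U"
  shows "T = U \<or> T = - U"
proof -
  obtain x where x: "T x \<noteq> 0" using T by blast
  have "U x \<noteq> 0" using point_full[OF S T(1) x U(1)] U by auto
  then have "T x = U x \<or> T x = (- U) x"
    using x covector_range[OF van_cov[OF T(1)], of x] covector_range[OF van_cov[OF U(1)], of x] by auto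
  then show ?thesis using point_eq[OF S T(1) U(1)] point_eq[OF S T(1) van_uminus[OF U(1)]] x by blast
qed

lemma point_nz:
  assumes "corank M 1 S" "T \<in> van M S" "nz T" "U \<in> van M S" "nz U" 
  shows "T x = 0 \<longleftrightarrow> U x = 0"
  using point_unique[OF assms] by auto

lemma point_exists:
  assumes S: "corank M 1 S"
  obtains T where "T \<in> van M S" "nz T"
proof -
  have "\<not> (\<forall>T \<in> van M S. T = (\<lambda>_. 0))"
    using full_rank_iff[of S] S by (auto simp: corank_def)
  then show ?thesis using that by fastforce
qed

section \<open>Cocircuits as points, and pairs of them on a line\<close>

lemma cocircuitI:
  assumes S: "corank M 1 S" and T: "T \<in> van M S" "nz T"
  shows "T \<in> cocircuits M"
proof -
  have "\<not> supp Y \<subset> supp T" if Y: "Y \<in> covectors M" "supp Y \<noteq> {}" for Y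
  proof
    assume sub: "supp Y \<subset> supp T"
    have "Y \<in> van M S" using Y sub T by (auto simp: van_def supp_def)
    moreover have "nz Y" using Y by (auto simp: supp_def)
    ultimately have "T = Y \<or> T = - Y" using point_unique[OF S T] by blast
    then show False using sub by (auto simp: supp_def)
  qed
  then show ?thesis using T by (auto simp: cocircuits_def van_def supp_def)
qed

lemma van_zero_set: "X \<in> covectors M \<Longrightarrow> X \<in> van M (zero_set M X)"
  by (auto simp: van_def zero_set_def)

lemma cocircuit_cov: "X \<in> cocircuits M \<Longrightarrow> X \<in> covectors M"
  by (simp add: cocircuits_def)

lemma cocircuit_nz: "X \<in> cocircuits M \<Longrightarrow> nz X"
  by (auto simp: cocircuits_def supp_def)

lemma cocircuit_corank:
  assumes X: "X \<in> cocircuits M"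
  shows "corank M 1 (zero_set M X)"
proof -
  have Xc: "X \<in> covectors M" and Xn: "nz X" using X cocircuit_cov cocircuit_nz by auto
  then obtain x where x: "X x \<noteq> 0" by blast
  have sub: "zero_set M X \<subseteq> ground M" by (auto simp: zero_set_def)
  have "rank_of M (insert x (zero_set M X)) = om_rank M"
  proof (rule full_rank_iff)
    show "insert x (zero_set M X) \<subseteq> ground M" using sub x cov_ground[OF Xc] by auto
    fix T assume T: "T \<in> van M (insert x (zero_set M X))"
    have sub: "supp T \<subseteq> supp X" "x \<notin> supp T"
      using T cov_ground[of T] by (auto simp: supp_def van_def zero_set_def)
    then have "supp T \<subset> supp X" using x by (auto simp: supp_def)
    then have "supp T = {}" using X T by (auto simp: cocircuits_def van_def)
    then show "T = (\<lambda>_. 0)" by (auto simp: supp_def)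
  qed
  then show ?thesis
    using rank_cert[OF sub van_zero_set[OF Xc] x] sub by (simp add: corank_def)
qed

lemma cocircuit_sep:
  assumes "X \<in> cocircuits M" "Y \<in> cocircuits M" "X \<noteq> Y" "X \<noteq> - Y"
  obtains x where "X x = 0" "Y x \<noteq> 0" "x \<in> ground M"
proof -
  have "\<not> (\<forall>x \<in> zero_set M X. Y x = 0)"
    using point_unique[OF cocircuit_corank[OF assms(1)] van_zero_set[OF cocircuit_cov[OF assms(1)]] cocircuit_nz[OF assms(1)], of Y]
      assms cocircuit_cov[OF assms(2)] cocircuit_nz[OF assms(2)] by (auto simp: van_def)
  then show ?thesis using that by (auto simp: zero_set_def)
qed

lemma line_common_zero:
  assumes S: "corank M 2 S" and X: "X \<in> van M S" "nz X" and V: "V \<in> van M S" "nz V"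
    and ne: "X \<noteq> V" "X \<noteq> - V" and x: "X x = 0" "V x = 0" and T: "T \<in> van M S"
  shows "T x = 0"
proof (rule ccontr)
  assume "T x \<noteq> 0"
  then have "corank M 1 (insert x S)" using corank_insert2[OF S T] by simp
  then show False using point_unique[of "insert x S" X V] X V x ne by (simp add: van_insert)
qed

lemma line_cocircuit:
  assumes S: "corank M 2 S" and "X \<in> van M S" "nz X" "X x = 0" "T \<in> van M S" "T x \<noteq> 0"
  shows "X \<in> cocircuits M"
  using cocircuitI[OF corank_insert2[OF S assms(5,6)], of X] assms by (simp add: van_insert)

text \<open>Substitute for the fact that two linear functionals on a line with a common zero are
  proportional. It is the main tool for carrying a sign from one element to another.\<close>

lemma line_parallel:
  assumes S: "corank M 2 S" and V: "V \<in> van M S" "nz V" "V x = 0" "V y = 0"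
    and T0: "T0 \<in> van M S" "T0 x \<noteq> 0"
  obtains k where "\<And>T. T \<in> van M S \<Longrightarrow> T y = k * T x" "k \<in> {-1, 0, 1}"
proof (cases "\<forall>T \<in> van M S. T y = 0")
  case True
  then show ?thesis using that[of 0] by simp
next
  case False
  then obtain T1 where T1: "T1 \<in> van M S" "T1 y \<noteq> 0" by blast
  have eqv: "T x = 0 \<longleftrightarrow> T y = 0" if T: "T \<in> van M S" for T
  proof
    assume "T x = 0"
    then have "nz T \<Longrightarrow> T = V \<or> T = - V"
      using point_unique[OF corank_insert2[OF S T0], of T V] T V by (simp add: van_insert)
    then show "T y = 0" using V by force
  next
    assume "T y = 0"
    then have "nz T \<Longrightarrow> T = V \<or> T = - V"
      using point_unique[OF corank_insert2[OF S T1], of T V] T V by (simp add: van_insert)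
    then show "T x = 0" using V by force
  qed
  have same: "T y = T0 y" if T: "T \<in> van M S" "T x = T0 x" for T
  proof (rule ccontr)
    assume ne: "T y \<noteq> T0 y"
    have nzs: "T y \<noteq> 0" "T0 y \<noteq> 0" using eqv[OF T(1)] eqv[OF T0(1)] T T0 by auto
    then have opp: "(- T) y = T0 y"
      using ne covector_range[OF van_cov[OF T(1)], of y] covector_range[OF van_cov[OF T0(1)], of y] by auto
    \<comment> \<open>\<open>Z\<close> plays the role of \<open>T + T0\<close> with \<open>y\<close>
      eliminated; as \<open>T\<close> and \<open>T0\<close> agree at \<open>x\<close>, it stays
      nonzero there, against \<open>eqv\<close>.\<close>
    then obtain Z where Z: "diff M y (- T) T0 Z"
      using diff_exists[of "- T" T0 y] van_cov[OF van_uminus[OF T(1)]] van_cov[OF T0(1)] nzs by auto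
    have "Z \<in> van M S" using diff_van[OF Z van_uminus[OF T(1)] T0(1)] .
    moreover have "Z y = 0" using diff_g[OF Z] .
    moreover have "Z x = T0 x" using diff_opp[OF Z, of x] T by simp
    ultimately show False using eqv[of Z] T0 by simp
  qed
  let ?k = "T0 y * T0 x"
  have T0s: "T0 x \<in> {-1,0,1}" "T0 y \<in> {-1,0,1}" using covector_range[OF van_cov[OF T0(1)]] by auto
  have "T y = ?k * T x" if T: "T \<in> van M S" for T
  proof (cases "T x = 0")
    case True then show ?thesis using eqv T by simp
  next
    case False
    then have "T x = T0 x \<or> (- T) x = T0 x" using T0 T0s covector_range[OF van_cov[OF T], of x] by auto
    then show ?thesis using same[OF T] same[OF van_uminus[OF T]] T0s T0 by auto
  qed
  moreover have "?k \<in> {-1,0,1}" using T0s by auto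
  ultimately show ?thesis using that by blast
qed

lemma diff_nz:
  assumes "X \<in> cocircuits M" "Y \<in> cocircuits M" "X \<noteq> Y" "X \<noteq> - Y" "diff M g X Y Z"
  shows "nz Z"
  using cocircuit_sep[OF assms(1-4)] diff_left[OF assms(5)] by metis

text \<open>The ratios \<open>f/g\<close> and \<open>g/f\<close> vary in opposite directions while
  both signs are fixed. Eliminating \<open>x\<close> from \<open>Z\<close> and \<open>Z'\<close>
  gives a covector in the point of \<open>X\<close>, that is zero or \<open>X\<close> up to sign;
  its values at \<open>f\<close> and \<open>g\<close> are \<open>- Z f\<close> and
  \<open>Z' g\<close>.\<close>

lemma diff_swap:
  assumes S: "corank M 2 S" and X: "X \<in> cocircuits M" "X \<in> van M S" and Y: "Y \<in> cocircuits M" "Y \<in> van M S"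
    and ne: "X \<noteq> Y" and g: "X g = Y g" "X g \<noteq> 0" and f: "X f = Y f" "X f \<noteq> 0"
    and Z: "diff M g X Y Z" and Z': "diff M f X Y Z'"
  shows "Z f * X f = - (Z' g * X g)"
proof -
  have "X \<noteq> - Y" using g by auto
  then obtain x where x: "X x = 0" "Y x \<noteq> 0" using cocircuit_sep[OF X(1) Y(1) ne] by blast
  have ZS: "Z \<in> van M S" and ZS': "Z' \<in> van M S" using diff_van[OF Z X(2) Y(2)] diff_van[OF Z' X(2) Y(2)] .
  have Zx: "Z x = Y x" "Z' x = Y x" using diff_left[OF Z x(1)] diff_left[OF Z' x(1)] .
  obtain T where T: "diff M x Z Z' T"
    using diff_exists[of Z Z' x] Zx x van_cov[OF ZS] van_cov[OF ZS'] by auto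
  have TS: "T \<in> van M (insert x S)" using diff_van[OF T ZS ZS'] diff_g[OF T] by (simp add: van_insert)
  have Tf: "T f = - Z f" "T g = Z' g" using diff_left[OF T, of g] diff_right[OF T, of f] diff_g[OF Z] diff_g[OF Z'] by auto
  have "nz T \<Longrightarrow> T = X \<or> T = - X"
    using point_unique[OF corank_insert2[OF S Y(2) x(2)] TS, of X] X x cocircuit_nz[OF X(1)] by (simp add: van_insert)
  moreover have sq: "X f * X f = 1" "X g * X g = 1"
    using f g covector_range[OF van_cov[OF X(2)], of f] covector_range[OF van_cov[OF X(2)], of g] by auto
  ultimately consider "\<forall>y. T y = 0" | "T = X" | "T = - X" by blast
  then show ?thesis
  proof cases
    case 1 then show ?thesis using Tf by simp
  next
    case 2
    then have "Z f = - X f" "Z' g = X g" using Tf by auto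
    then show ?thesis
      using sq by simp
  next
    case 3
    then have "Z f = X f" "Z' g = - X g" using Tf by auto
    then show ?thesis
      using sq by simp
  qed
qed

section \<open>Comodularity as lying on a common line, and elimination as
  \<open>diff\<close>\<close>

lemma comodularI:
  assumes S: "corank M 2 S" and X: "X \<in> cocircuits M" "X \<in> van M S" and Y: "Y \<in> cocircuits M" "Y \<in> van M S"
    and ne: "X \<noteq> Y" "X \<noteq> - Y"
  shows "comodular M X Y"
proof -
  have Xc: "X \<in> covectors M" "Y \<in> covectors M" using X Y cocircuit_cov by auto
  have Sg: "S \<subseteq> ground M" using S corank_ground by blast
  have z: "zero_set M (X \<odot> Y) = zero_set M X \<inter> zero_set M Y" by (auto simp: zero_set_def scomp_def)
  have sub: "S \<subseteq> zero_set M X \<inter> zero_set M Y" using X Y Sg by (auto simp: van_def zero_set_def)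
  have "zero_set M X \<inter> zero_set M Y \<subseteq> cl M S"
  proof
    fix x assume "x \<in> zero_set M X \<inter> zero_set M Y"
    then have "x \<in> ground M" "X x = 0" "Y x = 0" by (auto simp: zero_set_def)
    then show "x \<in> cl M S"
      using line_common_zero[OF S X(2) cocircuit_nz[OF X(1)] Y(2) cocircuit_nz[OF Y(1)] ne]
      unfolding cl_iff[OF Sg] by blast
  qed
  then have "rank_of M (zero_set M X \<inter> zero_set M Y) = rank_of M S"
    using rank_cong_cl[OF sub _ Sg] by simp
  then show ?thesis
    using X Y ne S z scomp_covector[OF Xc] by (auto simp: comodular_def flats_def corank_def)
qed

lemma comodularD:
  assumes "comodular M X Y"
  shows "X \<in> cocircuits M" "Y \<in> cocircuits M" "X \<noteq> Y" "X \<noteq> - Y" "corank M 2 (zero_set M X \<inter> zero_set M Y)"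
    "X \<in> van M (zero_set M X \<inter> zero_set M Y)" "Y \<in> van M (zero_set M X \<inter> zero_set M Y)"
proof -
  have z: "zero_set M (X \<odot> Y) = zero_set M X \<inter> zero_set M Y" by (auto simp: zero_set_def scomp_def)
  have "zero_set M X \<inter> zero_set M Y \<subseteq> ground M" by (auto simp: zero_set_def)
  then show "X \<in> cocircuits M" "Y \<in> cocircuits M" "X \<noteq> Y" "X \<noteq> - Y" "corank M 2 (zero_set M X \<inter> zero_set M Y)"
    using assms z by (auto simp: comodular_def corank_def)
  then show "X \<in> van M (zero_set M X \<inter> zero_set M Y)" "Y \<in> van M (zero_set M X \<inter> zero_set M Y)"
    using cocircuit_cov by (auto simp: van_def zero_set_def)
qed

lemma comodular_sym: 
  assumes "comodular M X Y" shows "comodular M Y X"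
  using comodularI[OF comodularD(5)[OF assms] comodularD(2)[OF assms] comodularD(7)[OF assms] comodularD(1)[OF assms] comodularD(6)[OF assms]]
    comodularD(3,4)[OF assms] signvec_minus_swap[of X Y] by auto

lemma comodular_uminus:
  assumes "comodular M X Y" shows "comodular M (- X) (- Y)"
proof -
  have "- X \<in> cocircuits M" if "X \<in> cocircuits M" for X
    using that uminus_covector by (auto simp: cocircuits_def supp_def)
  then show ?thesis
    using comodularI[OF comodularD(5)[OF assms], of "- X" "- Y"] comodularD[OF assms] van_uminus
      signvec_minus_swap[of X Y] signvec_minus_swap[of "- X" Y] by auto
qed

lemma diff_unique:
  assumes XY: "comodular M X Y" and g: "X g = Y g" "X g \<noteq> 0" and Z: "diff M g X Y Z" "diff M g X Y Z'"
  shows "Z = Z'"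
proof -
  note C = comodularD[OF XY]
  obtain x where x: "X x = 0" "Y x \<noteq> 0" using cocircuit_sep[OF C(1-4)] .
  show ?thesis
    using point_eq[OF corank_insert2[OF C(5,6) g(2)], of Z Z' x] diff_van[OF Z(1) C(6,7)] diff_van[OF Z(2) C(6,7)]
      diff_g[OF Z(1)] diff_g[OF Z(2)] diff_left[OF Z(1) x(1)] diff_left[OF Z(2) x(1)] x
    by (simp add: van_insert)
qed

text \<open>The coordinates that \<open>diff\<close> leaves open are those with
  \<open>X d = Y d \<noteq> 0\<close>, which is just \<open>sep (- X) Y\<close>; minimality of the
  support follows because \<open>Z\<close> is a point of the common line.\<close>

lemma elimination_iff_diff:
  assumes XY: "comodular M X Y" and g: "X g = Y g" "X g \<noteq> 0"
  shows "elimination M g (- X) Y Z \<longleftrightarrow> diff M g X Y Z"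
proof
  assume E: "elimination M g (- X) Y Z"
  then have Z: "Z \<in> covectors M" "Z g = 0" "\<And>d. d \<notin> sep (- X) Y \<Longrightarrow> Z d = (- X \<odot> Y) d"
    using cocircuit_cov by (auto simp: elimination_def)
  show "diff M g X Y Z"
    unfolding diff_def
  proof (intro conjI allI impI)
    fix d
    show "Z d = Y d" if "X d = 0"
      using Z(3)[of d] that by (auto simp: sep_def scomp_def)
    show "Z d = - X d" if "Y d = 0"
      using Z(3)[of d] that by (auto simp: sep_def scomp_def)
    show "Z d = Y d" if "X d = - Y d"
      using Z(3)[of d] that by (auto simp: sep_def scomp_def)
  qed (use Z in auto)
next
  assume Z: "diff M g X Y Z"
  note C = comodularD[OF XY]
  have "Z \<in> cocircuits M"
    using cocircuitI[OF corank_insert2[OF C(5,6) g(2)], of Z] diff_van[OF Z C(6,7)] diff_g[OF Z] diff_nz[OF C(1-4) Z]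
    by (simp add: van_insert)
  moreover have "supp Z \<subseteq> supp (- X \<odot> Y) - {g}"
    using diff_g[OF Z] diff_left[OF Z] by (auto simp: supp_def scomp_def)
  moreover have "Z d = (- X \<odot> Y) d" if "d \<notin> sep (- X) Y" for d
    using that diff_left[OF Z, of d] diff_right[OF Z, of d] diff_opp[OF Z, of d]
      covector_range[OF cocircuit_cov[OF C(1)], of d] covector_range[OF cocircuit_cov[OF C(2)], of d]
    by (auto simp: sep_def scomp_def)
  ultimately show "elimination M g (- X) Y Z"
    using diff_g[OF Z] by (simp add: elimination_def)
qed

end

section \<open>Height functions of Euclidean programs\<close>

text \<open>Directed cycles need distinct vertices, so closed walks have to be shortened: a step
  back to a visited vertex truncates the list there.\<close>

lemma rtranclp_simple_path:
  assumes "R\<^sup>*\<^sup>* x y"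
  shows "\<exists>xs. xs \<noteq> [] \<and> hd xs = x \<and> last xs = y \<and> distinct xs \<and> successively R xs"
  using assms
proof (induction rule: rtranclp_induct)
  case base
  show ?case by (rule exI[of _ "[x]"]) simp
next
  case (step y z)
  then obtain xs where xs: "xs \<noteq> []" "hd xs = x" "last xs = y" "distinct xs" "successively R xs" by blast
  show ?case
  proof (cases "z \<in> set xs")
    case True
    then obtain us vs where "xs = us @ z # vs" by (metis split_list)
    then show ?thesis
      using xs by (intro exI[of _ "us @ [z]"]) (auto simp: successively_append_iff hd_append split: if_splits)
  next
    case False
    then show ?thesis
      using xs step by (intro exI[of _ "xs @ [z]"]) (auto simp: successively_append_iff)
  qed
qed

text \<open>A potential whose increase has the sign of the increase of \<open>f/g\<close>. The
  factor \<open>X g\<close> lets it apply to pairs with \<open>g\<close> negative as well, and no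
  conformality is asked for.\<close>

definition height :: "'a signed_system \<Rightarrow> 'a \<Rightarrow> 'a \<Rightarrow> ('a signvec \<Rightarrow> int) \<Rightarrow> bool" where
  "height M g f \<rho> \<longleftrightarrow> (\<forall>X Y Z. comodular M X Y \<longrightarrow> X g = Y g \<longrightarrow> X g \<noteq> 0 \<longrightarrow> diff M g X Y Z \<longrightarrow>
     sgn (\<rho> Y - \<rho> X) = Z f * X g)"

context oriented_matroid
begin

definition weak_edge :: "'a \<Rightarrow> 'a signvec \<Rightarrow> 'a signvec \<Rightarrow> 'a signvec \<Rightarrow> bool" where
  "weak_edge g Z X Y \<longleftrightarrow> comodular M X Y \<and> X g = 1 \<and> Y g = 1 \<and> diff M g X Y Z"

text \<open>Conformality of edges is immaterial: eliminating a separating element subdivides a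
  comodular pair, and the point at infinity stays the same.\<close>

lemma weak_edge_conformal_path:
  assumes "weak_edge g Z X Y"
  shows "(\<lambda>X Y. weak_edge g Z X Y \<and> conformal X Y)\<^sup>+\<^sup>+ X Y"
  using assms
proof (induction "card (sep X Y)" arbitrary: X Y rule: less_induct)
  case less
  note E = less.prems
  have XY: "comodular M X Y" and g: "X g = 1" "Y g = 1" and Z: "diff M g X Y Z" using E by (auto simp: weak_edge_def)
  show ?case
  proof (cases "conformal X Y")
    case True then show ?thesis using E by auto
  next
    case False
    then obtain e where e: "X e = - Y e" "X e \<noteq> 0" by (auto simp: conformal_def sep_def)
    let ?S = "zero_set M X \<inter> zero_set M Y"
    note C = comodularD[OF XY]
    have cov: "X \<in> covectors M" "Y \<in> covectors M" using C cocircuit_cov by auto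
    \<comment> \<open>\<open>Q\<close> is \<open>X + Y\<close> normalised at \<open>e\<close>: the
      point where \<open>e\<close> cuts the segment from \<open>X\<close> to \<open>Y\<close>, on
      which \<open>g\<close> stays positive.\<close>
    obtain Q where Q: "diff M e (- X) Y Q"
      using diff_exists[of "- X" Y e] uminus_covector[OF cov(1)] cov(2) e by auto
    have Qv: "Q \<in> van M ?S" using diff_van[OF Q van_uminus[OF C(6)] C(7)] .
    have Qg: "Q g = 1" using diff_opp[OF Q, of g] g by simp
    have Qe: "Q e = 0" using diff_g[OF Q] .
    have Qc: "Q \<in> cocircuits M" using line_cocircuit[OF C(5) Qv _ Qe C(6) e(2)] Qg by (metis one_neq_zero)
    obtain x where x: "X x = 0" "Y x \<noteq> 0" using cocircuit_sep[OF C(1-4)] .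
    obtain y where y: "Y y = 0" "X y \<noteq> 0"
      using cocircuit_sep[OF C(2) C(1)] C(3,4) signvec_minus_swap[of X Y] by metis
    have Qx: "Q x = Y x" "Q y = X y" using diff_left[OF Q, of x] diff_right[OF Q, of y] x y by auto
    have neq: "X \<noteq> Q" "X \<noteq> - Q" "Q \<noteq> Y" "Q \<noteq> - Y" using Qe e g Qg by auto
    have XQ: "comodular M X Q" using comodularI[OF C(5) C(1,6) Qc Qv] neq by blast
    have QY: "comodular M Q Y" using comodularI[OF C(5) Qc Qv C(2,7)] neq by blast
    note pt = corank_insert2[OF C(5) C(6), of g]
    have gn: "X g \<noteq> 0" using g by simp
    obtain Z1 where Z1: "diff M g X Q Z1" using diff_exists[of X Q g] cov g Qg cocircuit_cov[OF Qc] by auto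
    obtain Z2 where Z2: "diff M g Q Y Z2" using diff_exists[of Q Y g] cov g Qg cocircuit_cov[OF Qc] by auto
    have "Z1 = Z"
      by (rule point_eq[OF pt[OF gn], of _ _ x])
        (use diff_van[OF Z1 C(6) Qv] diff_van[OF Z C(6,7)] diff_g[OF Z1] diff_g[OF Z] diff_left[OF Z1 x(1)] diff_left[OF Z x(1)] Qx x
          in \<open>simp_all add: van_insert\<close>)
    moreover have "Z2 = Z"
      by (rule point_eq[OF pt[OF gn], of _ _ y])
        (use diff_van[OF Z2 Qv C(7)] diff_van[OF Z C(6,7)] diff_g[OF Z2] diff_g[OF Z] diff_right[OF Z2 y(1)] diff_right[OF Z y(1)] Qx y
          in \<open>simp_all add: van_insert\<close>)
    ultimately have E1: "weak_edge g Z X Q" and E2: "weak_edge g Z Q Y"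
      using XQ QY g Qg Z1 Z2 by (auto simp: weak_edge_def)
    have fin: "finite (sep X Y)"
      by (rule finite_subset[OF _ finite_ground]) (use cov_ground[OF cov(1)] in \<open>auto simp: sep_def\<close>)
    have "sep X Q \<subseteq> sep X Y"
    proof
      fix d assume "d \<in> sep X Q"
      then have d: "X d = - Q d" "X d \<noteq> 0" by (auto simp: sep_def)
      have "Y d \<noteq> 0" "X d \<noteq> Y d" using d diff_right[OF Q, of d] diff_opp[OF Q, of d] by auto
      then show "d \<in> sep X Y" using d covector_range[OF cov(1), of d] covector_range[OF cov(2), of d] by (auto simp: sep_def)
    qed
    moreover have "sep Q Y \<subseteq> sep X Y"
    proof
      fix d assume "d \<in> sep Q Y"
      then have d: "Q d = - Y d" "Q d \<noteq> 0" by (auto simp: sep_def)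
      have "X d \<noteq> 0" "X d \<noteq> Y d" using d diff_left[OF Q, of d] diff_opp[OF Q, of d] by auto
      then show "d \<in> sep X Y" using d covector_range[OF cov(1), of d] covector_range[OF cov(2), of d] by (auto simp: sep_def)
    qed
    moreover have "e \<in> sep X Y" "e \<notin> sep X Q" "e \<notin> sep Q Y" using e Qe by (auto simp: sep_def)
    ultimately have "card (sep X Q) < card (sep X Y)" "card (sep Q Y) < card (sep X Y)"
      using psubset_card_mono[OF fin] by blast+
    then show ?thesis using less.hyps[of X Q] less.hyps[of Q Y] E1 E2 by (meson tranclp_trans)
  qed
qed

definition weak_step :: "'a \<Rightarrow> 'a \<Rightarrow> 'a signvec \<Rightarrow> 'a signvec \<Rightarrow> bool" where
  "weak_step g f X Y \<longleftrightarrow> (\<exists>Z. weak_edge g Z X Y \<and> (Z f = 0 \<or> Z f = 1))"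

text \<open>Subdivision into conformal edges turns a closed weak walk into a walk in the graph of
  the program. The first piece of the forward edge is still forward because subdivision keeps
  \<open>Z\<close>; the remaining walk is cut down to a simple path that this piece closes.\<close>

lemma euclidean_no_cycle:
  assumes eu: "euclidean_program M g f" and E: "weak_edge g Z X Y" "Z f = 1"
  shows "\<not> (weak_step g f)\<^sup>*\<^sup>* Y X"
proof
  define C where "C = (\<lambda>X Y. weak_step g f X Y \<and> conformal X Y)"
  assume "(weak_step g f)\<^sup>*\<^sup>* Y X"
  moreover have "C\<^sup>*\<^sup>* A B" if AB: "weak_step g f A B" for A B
  proof -
    obtain Z' where Z': "weak_edge g Z' A B" "Z' f = 0 \<or> Z' f = 1" using AB by (auto simp: weak_step_def)
    have "(\<lambda>X Y. weak_edge g Z' X Y \<and> conformal X Y)\<^sup>*\<^sup>* A B"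
      using weak_edge_conformal_path[OF Z'(1)] by (rule tranclp_into_rtranclp)
    moreover have "(\<lambda>X Y. weak_edge g Z' X Y \<and> conformal X Y) \<le> C"
      using Z' by (auto simp: C_def weak_step_def)
    ultimately show ?thesis using rtranclp_mono by blast
  qed
  ultimately have ret: "C\<^sup>*\<^sup>* Y X"
    by (induction rule: rtranclp_induct) (auto intro: rtranclp_trans)
  obtain B where B: "weak_edge g Z X B \<and> conformal X B" "(\<lambda>X Y. weak_edge g Z X Y \<and> conformal X Y)\<^sup>*\<^sup>* B Y"
    using tranclpD[OF weak_edge_conformal_path[OF E(1)]] by blast
  have "(\<lambda>X Y. weak_edge g Z X Y \<and> conformal X Y) \<le> C" using E by (auto simp: C_def weak_step_def)
  then have "C\<^sup>*\<^sup>* B Y" using B rtranclp_mono by blast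
  then have "C\<^sup>*\<^sup>* B X" using ret by simp
  then obtain xs where xs: "xs \<noteq> []" "hd xs = B" "last xs = X" "distinct xs" "successively C xs"
    using rtranclp_simple_path by meson
  have edge: "graph_edge M g X Y" if "weak_edge g Z X Y" "conformal X Y" for X Y Z
    using that comodularD[of X Y] by (auto simp: graph_edge_def graph_vertices_def weak_edge_def)
  have forw: "forward M g f X Y" if "weak_edge g Z X Y" "Z f = 1" for X Y Z
    using that elimination_iff_diff[of X Y g Z] by (auto simp: forward_def weak_edge_def)
  have undir: "undirected M g f X Y" if "weak_edge g Z X Y" "Z f = 0" for X Y Z
    using that elimination_iff_diff[of X Y g Z] by (auto simp: undirected_def weak_edge_def)
  let ?n = "length xs"
  have n: "?n > 0" using xs by simp
  have last: "xs ! (?n - 1) = X" "xs ! 0 = B" using xs by (simp_all add: last_conv_nth hd_conv_nth)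
  have step: "graph_edge M g (xs ! i) (xs ! (Suc i mod ?n)) \<and>
     (forward M g f (xs ! i) (xs ! (Suc i mod ?n)) \<or> undirected M g f (xs ! i) (xs ! (Suc i mod ?n)))" if i: "i < ?n" for i
  proof (cases "Suc i < ?n")
    case True
    then have "C (xs ! i) (xs ! Suc i)" using xs(5) by (simp add: successively_conv_nth)
    then show ?thesis using True edge forw undir by (fastforce simp: C_def weak_step_def)
  next
    case False
    then have "i = ?n - 1" "Suc i = ?n" using i by auto
    then show ?thesis using last B edge forw E by auto
  qed
  have "forward M g f (xs ! (?n - 1)) (xs ! (Suc (?n - 1) mod ?n))"
    using last n B forw E by auto
  then have "directed_cycle M g f xs"
    using step xs n unfolding directed_cycle_def Let_def by (meson diff_less zero_less_one)
  then show False using eu by (auto simp: euclidean_program_def)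
qed

lemma finite_covectors: "finite (covectors M)"
proof (rule finite_subset)
  show "covectors M \<subseteq> {f. \<forall>x. (x \<in> ground M \<longrightarrow> f x \<in> {-1, 0, 1}) \<and> (x \<notin> ground M \<longrightarrow> f x = 0)}"
    using covector_range covector_outside by blast
  show "finite {f. \<forall>x. (x \<in> ground M \<longrightarrow> f x \<in> {-1, 0, 1 :: int}) \<and> (x \<notin> ground M \<longrightarrow> f x = 0)}"
    using finite_ground by (intro finite_set_of_finite_funs) auto
qed

text \<open>The number of predecessors is a potential: undirected edges can be walked both ways and
  preserve the set of predecessors, while a forward edge from \<open>X\<close> to \<open>Y\<close>
  adds \<open>Y\<close>, which acyclicity keeps out of \<open>D X\<close>.\<close>

lemma euclidean_height:
  assumes eu: "euclidean_program M g f"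
  obtains \<rho> where "height M g f \<rho>"
proof -
  define D where "D X = {T \<in> covectors M. (weak_step g f)\<^sup>*\<^sup>* T X}" for X
  define \<rho>0 where "\<rho>0 X = int (card (D X))" for X
  have fin: "finite (D X)" for X using finite_covectors by (auto simp: D_def)
  have mono: "D X \<subseteq> D Y" if "weak_step g f X Y" for X Y
    using that by (auto simp: D_def intro: rtranclp.rtrancl_into_rtrancl)
  have strict: "\<rho>0 X < \<rho>0 Y" if E: "weak_edge g Z X Y" "Z f = 1" for X Y Z
  proof -
    have "weak_step g f X Y" using E by (auto simp: weak_step_def)
    moreover have "Y \<in> D Y" using E comodularD[of X Y] cocircuit_cov[of Y] by (auto simp: D_def weak_edge_def)
    moreover have "Y \<notin> D X" using euclidean_no_cycle[OF eu E] by (auto simp: D_def)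
    ultimately have "D X \<subset> D Y" using mono by blast
    then show ?thesis using psubset_card_mono[OF fin] by (simp add: \<rho>0_def)
  qed
  have swap: "weak_edge g (- Z) Y X" if "weak_edge g Z X Y" for X Y Z
    using that comodular_sym diff_antisym by (auto simp: weak_edge_def)
  have eq: "\<rho>0 X = \<rho>0 Y" if E: "weak_edge g Z X Y" "Z f = 0" for X Y Z
  proof -
    have "weak_step g f X Y" using E by (auto simp: weak_step_def)
    moreover have "weak_step g f Y X" using swap[OF E(1)] E(2) unfolding weak_step_def by (intro exI[of _ "- Z"]) simp
    ultimately show ?thesis using mono by (metis \<rho>0_def subset_antisym)
  qed
  have main: "sgn (\<rho>0 Y - \<rho>0 X) = Z f" if E: "weak_edge g Z X Y" for X Y Z
  proof -
    have "Z \<in> covectors M" using E diff_cov by (auto simp: weak_edge_def)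
    then show ?thesis
    proof (cases rule: sign_cases[of Z f])
      case 1 then show ?thesis using eq[OF E] by simp
    next
      case 2 then show ?thesis using strict[OF E] by simp
    next
      case 3
      then have "\<rho>0 Y < \<rho>0 X" using strict[OF swap[OF E]] by simp
      then show ?thesis using 3 by simp
    qed
  qed
  \<comment> \<open>Pairs with \<open>g\<close> negative are compared through their negatives; this
    replaces \<open>Z f\<close> by \<open>- Z f\<close>, which is \<open>Z f * X g\<close>.\<close>
  define \<rho> where "\<rho> X = (if X g = 1 then \<rho>0 X else \<rho>0 (- X))" for X
  have "height M g f \<rho>"
    unfolding height_def
  proof (intro allI impI)
    fix X Y Z assume XY: "comodular M X Y" and g: "X g = Y g" "X g \<noteq> 0" and Z: "diff M g X Y Z"
    have "X \<in> covectors M" using comodularD[OF XY] cocircuit_cov by blast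
    then consider "X g = 1" | "X g = -1" using g sign_cases[of X g] by metis
    then show "sgn (\<rho> Y - \<rho> X) = Z f * X g"
    proof cases
      case 1
      then show ?thesis using main[of Z X Y] XY g Z by (simp add: weak_edge_def \<rho>_def)
    next
      case 2
      then have "weak_edge g (- Z) (- X) (- Y)"
        using comodular_uminus[OF XY] diff_uminus[OF Z] g by (simp add: weak_edge_def)
      then show ?thesis using main 2 g by (fastforce simp: \<rho>_def)
    qed
  qed
  then show ?thesis by (rule that)
qed

end

section \<open>Extensions with lexicographic localization\<close>

lemma periodic_mono_const:
  fixes u :: "nat \<Rightarrow> int"
  assumes mono: "\<And>i. u i \<le> u (Suc i)" and N: "N > 0" and per: "\<And>i. u (i + N) = u i"
  shows "u i = u j"
proof -
  have per': "u (i + m * N) = u i" for i m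
  proof (induction m)
    case (Suc m)
    have "u (i + Suc m * N) = u ((i + m * N) + N)" by (simp add: ac_simps)
    then show ?case using per Suc by simp
  qed simp
  have le: "u i \<le> u j" if "i \<le> j" for i j
    using lift_Suc_mono_le[of u i j] mono that by blast
  have "u j \<le> u i" for i j
    using le[of j "i + j * N"] per'[of i j] N by (simp add: trans_le_add2)
  then show ?thesis by (meson order_antisym)
qed

text \<open>Here \<open>M\<close> is the extension; the original oriented matroid is present only as
  \<open>M\<close> without \<open>p\<close>. That the zeros of \<open>X\<close> other than
  \<open>p\<close> have corank 1 says, in terms of \<open>M\<close> alone, that \<open>X\<close>
  restricts to an original cocircuit; only for these is the sign at \<open>p\<close>
  prescribed.\<close>

locale lex_extended = oriented_matroid M for M :: "'a signed_system" +
  fixes p :: 'a and e :: "nat \<Rightarrow> 'a" and k :: nat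
  assumes p_ground: "p \<in> ground M"
    and e_ground: "i \<in> {1..k} \<Longrightarrow> e i \<in> ground M - {p}"
    and not_coloop: "T \<in> covectors M \<Longrightarrow> (\<And>x. x \<noteq> p \<Longrightarrow> T x = 0) \<Longrightarrow> T p = 0"
    and lex: "X \<in> cocircuits M \<Longrightarrow> corank M 1 (zero_set M X - {p}) \<Longrightarrow> X p = lex_localization e k X"
begin

text \<open>The cocircuits of the extension that restrict to cocircuits of the original oriented matroid.\<close>

definition old :: "'a signvec \<Rightarrow> bool" where
  "old X \<longleftrightarrow> X \<in> cocircuits M \<and> corank M 1 (zero_set M X - {p})"

lemma old_cocircuit: "old X \<Longrightarrow> X \<in> cocircuits M"
  and old_corank: "old X \<Longrightarrow> corank M 1 (zero_set M X - {p})"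
  by (simp_all add: old_def)

lemma old_cov: "old X \<Longrightarrow> X \<in> covectors M"
  using old_cocircuit cocircuit_cov by blast

lemma old_nz: "old X \<Longrightarrow> nz X"
  using old_cocircuit cocircuit_nz by blast

section \<open>Recognising old cocircuits and reading their sign at \<open>p\<close>\<close>

lemma oldI:
  assumes S: "corank M 1 S" "p \<notin> S" and X: "X \<in> van M S" "nz X"
  shows "old X"
proof -
  have Xc: "X \<in> cocircuits M" using cocircuitI[OF S(1) X] .
  have "S \<subseteq> zero_set M X - {p}" using X S corank_ground[OF S(1)] by (auto simp: van_def zero_set_def)
  moreover have "zero_set M X - {p} \<subseteq> zero_set M X" "zero_set M X \<subseteq> ground M" by (auto simp: zero_set_def)
  ultimately have "rank_of M S \<le> rank_of M (zero_set M X - {p})"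
    "rank_of M (zero_set M X - {p}) \<le> rank_of M (zero_set M X)" "zero_set M X - {p} \<subseteq> ground M"
    using rank_mono by blast+
  then show ?thesis using Xc S cocircuit_corank[OF Xc] by (auto simp: old_def corank_def)
qed

lemma old_uminus:
  assumes "old X" shows "old (- X)"
proof (rule oldI[OF old_corank[OF assms]])
  have "X \<in> van M (zero_set M X - {p})" using old_cov[OF assms] by (auto simp: van_def zero_set_def)
  then show "- X \<in> van M (zero_set M X - {p})" by (rule van_uminus)
  show "nz (- X)" using old_nz[OF assms] by simp
qed simp

lemma old_p0:
  assumes "X \<in> cocircuits M" "X p \<noteq> 0"
  shows "old X"
proof -
  have "zero_set M X - {p} = zero_set M X" using assms by (auto simp: zero_set_def)
  then show ?thesis using assms cocircuit_corank[of X] by (simp add: old_def)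
qed

lemma line_old:
  assumes S: "corank M 2 S" "p \<notin> S" and X: "X \<in> van M S" "nz X" "X x = 0" and T: "T \<in> van M S" "T x \<noteq> 0" and xp: "x \<noteq> p"
  shows "old X"
  using oldI[OF corank_insert2[OF S(1) T], of X] S X xp by (simp add: van_insert)

lemma old_lex:
  assumes X: "old X" and j: "j \<in> {1..k}" "X (e j) \<noteq> 0" "\<And>i. i \<in> {1..k} \<Longrightarrow> i < j \<Longrightarrow> X (e i) = 0"
  shows "X p = X (e j)"
proof -
  have "(LEAST i. i \<in> {1..k} \<and> X (e i) \<noteq> 0) = j"
    by (rule Least_equality) (use j in \<open>auto simp: not_less[symmetric]\<close>)
  then have "lex_localization e k X = X (e j)"
    using j unfolding lex_localization_def by auto
  then show ?thesis using lex[of X] X by (simp add: old_def)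
qed

lemma old_lex_zero:
  assumes X: "old X" and "\<And>i. i \<in> {1..k} \<Longrightarrow> X (e i) = 0"
  shows "X p = 0"
  using lex[of X] X assms(2) by (auto simp: old_def lex_localization_def)

lemma old_index:
  assumes X: "old X" and "\<exists>i \<in> {1..k}. X (e i) \<noteq> 0"
  obtains j where "j \<in> {1..k}" "X (e j) \<noteq> 0" "X p = X (e j)" "\<And>i. i \<in> {1..k} \<Longrightarrow> i < j \<Longrightarrow> X (e i) = 0"
proof -
  let ?j = "LEAST i. i \<in> {1..k} \<and> X (e i) \<noteq> 0"
  have "?j \<in> {1..k} \<and> X (e ?j) \<noteq> 0" using assms(2) LeastI_ex[of "\<lambda>i. i \<in> {1..k} \<and> X (e i) \<noteq> 0"] by blast
  moreover have "X (e i) = 0" if "i \<in> {1..k}" "i < ?j" for i using not_less_Least[OF that(2)] that by blast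
  ultimately show ?thesis using that[of ?j] old_lex[OF X, of ?j] by blast
qed

lemma old_p_zero:
  assumes X: "old X" "X p = 0" and i: "i \<in> {1..k}"
  shows "X (e i) = 0"
  using old_index[OF X(1)] X(2) i by metis

text \<open>Among the covectors vanishing on \<open>S\<close> but not at \<open>p\<close>, one of
  minimal support is a cocircuit: a smaller covector would vanish at \<open>p\<close> and could be
  subtracted to shrink the support. Being off \<open>p\<close> it is old, so its sign at
  \<open>p\<close> comes from some \<open>e i\<close>.\<close>

lemma p_not_spanned:
  assumes T: "T \<in> van M S" "T p \<noteq> 0"
  obtains U i where "U \<in> van M S" "i \<in> {1..k}" "U (e i) \<noteq> 0"
proof -
  let ?Q = "\<lambda>T. T \<in> van M S \<and> T p \<noteq> 0"
  obtain U where U: "?Q U" "\<And>V. ?Q V \<Longrightarrow> card (supp U) \<le> card (supp V)"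
    using ex_has_least_nat[of ?Q T "\<lambda>T. card (supp T)"] T by blast
  have Uc: "U \<in> covectors M" using U van_cov by blast
  have fin: "finite (supp U)"
    by (rule finite_subset[OF _ finite_ground]) (use cov_ground[OF Uc] in \<open>auto simp: supp_def\<close>)
  have "\<not> supp Y \<subset> supp U" if Y: "Y \<in> covectors M" "supp Y \<noteq> {}" for Y
  proof
    assume sub: "supp Y \<subset> supp U"
    have YS: "Y \<in> van M S" using Y sub U by (auto simp: van_def supp_def)
    obtain x where x: "Y x \<noteq> 0" using Y by (auto simp: supp_def)
    have "Y p = 0"
    proof (rule ccontr)
      assume "Y p \<noteq> 0"
      then have "card (supp U) \<le> card (supp Y)" using U(2) YS by blast
      then show False using psubset_card_mono[OF fin sub] by simp
    qed
    have "U x \<noteq> 0" using x sub by (auto simp: supp_def)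
    have Y_cases: "Y x = U x \<or> (- Y) x = U x"
      using x \<open>U x \<noteq> 0\<close> covector_range[OF Uc, of x] covector_range[OF Y(1), of x] by auto
    obtain Y' where Y': "Y' \<in> van M S" "Y' x = U x" "supp Y' = supp Y" "Y' p = 0"
    proof (cases "Y x = U x")
      case True
      then show ?thesis using that[of Y] YS \<open>Y p = 0\<close> by simp
    next
      case False
      then show ?thesis using that[of "- Y"] Y_cases van_uminus[OF YS] \<open>Y p = 0\<close> by (simp add: supp_def)
    qed
    obtain Z where Z: "diff M x U Y' Z" using diff_exists[of U Y' x] Uc van_cov[OF Y'(1)] Y' \<open>U x \<noteq> 0\<close> by auto
    have "Z \<in> van M S" using diff_van[OF Z] U Y' by blast
    moreover have "Z p = - U p" using diff_right[OF Z Y'(4)] .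
    ultimately have "card (supp U) \<le> card (supp Z)" using U by auto
    moreover have "supp Z \<subset> supp U"
      using diff_left[OF Z] diff_g[OF Z] \<open>U x \<noteq> 0\<close> Y'(3) sub by (auto simp: supp_def)
    ultimately show False using psubset_card_mono[OF fin] by (meson not_less)
  qed
  then have "U \<in> cocircuits M" using U Uc by (auto simp: cocircuits_def supp_def)
  then have "old U" using old_p0 U by blast
  then show ?thesis using old_lex_zero[of U] U that by blast
qed

text \<open>A cocircuit \<open>X\<close> on the new element lies infinitesimally close to an old cocircuit \<open>V\<close>: on a
  line spanned by \<open>S\<close>, it is the intersection with the first of the \<open>e i\<close> not containing the line.\<close>

lemma limit_exists:
  assumes S: "corank M 2 S" "p \<notin> S" and j: "j \<in> {1..k}" "\<forall>i \<in> {1..k}. i < j \<longrightarrow> (\<forall>T \<in> van M S. T (e i) = 0)"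
    and T0: "T0 \<in> van M S" "T0 (e j) \<noteq> 0" and X: "X \<in> van M S" "X p = 0" "nz X"
  obtains V where "V \<in> van M S" "nz V" "V (e j) = 0" "V p = - X (e j)" "\<And>x. x \<noteq> p \<Longrightarrow> V x \<noteq> 0 \<Longrightarrow> X x = V x"
proof (cases "X (e j) = 0")
  case True
  then show ?thesis using that[of X] X by simp
next
  case False
  let ?a = "e j"
  have ap: "?a \<noteq> p" using e_ground[OF j(1)] by auto
  note pa = corank_insert2[OF S(1) T0]
  obtain V0 where V0: "V0 \<in> van M (insert ?a S)" "nz V0" using point_exists[OF pa] .
  have V0S: "V0 \<in> van M S" "V0 ?a = 0" using V0 by (auto simp: van_insert)
  \<comment> \<open>The point of the line on \<open>x\<close> is old, and \<open>e j\<close> is its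
    leading term, so it has equal signs at \<open>p\<close> and \<open>e j\<close>.\<close>
  have through: "\<exists>Q. Q \<in> van M S \<and> old Q \<and> Q x = 0 \<and> Q ?a = X ?a \<and> Q p = X ?a" if x: "x \<noteq> p" "V0 x \<noteq> 0" for x
  proof -
    obtain Q0 where Q0: "Q0 \<in> van M (insert x S)" "nz Q0" using point_exists[OF corank_insert2[OF S(1) V0S(1) x(2)]] .
    have Q0a: "Q0 ?a \<noteq> 0"
      using point_nz[OF pa, of Q0 V0 x] Q0 V0 x by (auto simp: van_insert)
    have "old Q0" using oldI[OF corank_insert2[OF S(1) V0S(1) x(2)] _ Q0] S x by auto
    moreover have "Q0 p = Q0 ?a" using old_lex[OF \<open>old Q0\<close> j(1) Q0a] j(2) Q0 by (auto simp: van_insert)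
    moreover have "Q0 ?a = X ?a \<or> (- Q0) ?a = X ?a"
      using Q0a False covector_range[OF van_cov[OF Q0(1)], of ?a] covector_range[OF van_cov[OF X(1)], of ?a] by auto
    ultimately show ?thesis using Q0 old_uminus[OF \<open>old Q0\<close>] van_uminus[OF Q0(1)] by (fastforce simp: van_insert)
  qed
  have "\<exists>y. y \<noteq> p \<and> V0 y \<noteq> 0" using not_coloop[OF van_cov[OF V0S(1)]] V0(2) by metis
  then obtain y Q where y: "y \<noteq> p" "V0 y \<noteq> 0" and Q: "Q \<in> van M S" "Q p = X ?a" using through by blast
  have V0p: "V0 p \<noteq> 0"
  proof
    assume "V0 p = 0"
    then show False
      using point_nz[OF corank_insert2[OF S(1) Q(1)], of p X V0 ?a] Q X False V0S V0(2) by (auto simp: van_insert)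
  qed
  have "V0 p = - X ?a \<or> (- V0) p = - X ?a"
    using V0p False covector_range[OF van_cov[OF V0S(1)], of p] covector_range[OF van_cov[OF X(1)], of ?a] by auto
  then obtain V where V: "V \<in> van M S" "nz V" "V ?a = 0" "V p = - X ?a"
    using V0S V0(2) van_uminus[OF V0S(1)] that
    by (metis (no_types, opaque_lifting) add.inverse_neutral neg_equal_0_iff_equal uminus_apply)
  have Vv: "V = V0 \<or> V = - V0" using point_unique[OF pa, of V V0] V V0 by (simp add: van_insert)
  \<comment> \<open>Otherwise the point \<open>Q\<close> of the line on \<open>x\<close> would be
    \<open>X\<close> up to sign, against \<open>X p = 0\<close>, or else, when \<open>x\<close>
    separates \<open>X\<close> from \<open>V\<close>, the combination \<open>T\<close> of
    \<open>X\<close> and \<open>V\<close>; but \<open>T p = V p = - X (e j)\<close>, whereas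
    \<open>Q p = X (e j)\<close>.\<close>
  have "X x = V x" if x: "x \<noteq> p" "V x \<noteq> 0" for x
  proof (rule ccontr)
    assume ne: "X x \<noteq> V x"
    have "V0 x \<noteq> 0" using x Vv by auto
    then obtain Q where Q: "Q \<in> van M S" "old Q" "Q x = 0" "Q ?a = X ?a" "Q p = X ?a" using through x by blast
    note px = corank_insert2[OF S(1) V0S(1) \<open>V0 x \<noteq> 0\<close>]
    show False
    proof (cases "X x = 0")
      case True
      then show False using point_nz[OF px, of Q X p] Q X False old_nz[OF Q(2)] by (auto simp: van_insert)
    next
      case nzx: False
      then have "(- X) x = V x"
        using ne x covector_range[OF van_cov[OF X(1)], of x] covector_range[OF van_cov[OF V(1)], of x] by auto
      then obtain T where T: "diff M x (- X) V T"
        using diff_exists[of "- X" V x] van_cov[OF van_uminus[OF X(1)]] van_cov[OF V(1)] nzx by auto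
      have "T \<in> van M (insert x S)" using diff_van[OF T van_uminus[OF X(1)] V(1)] diff_g[OF T] by (simp add: van_insert)
      moreover have "T ?a = X ?a" using diff_right[OF T V(3)] by simp
      ultimately have "T = Q" using point_eq[OF px, of T Q ?a] Q False by (simp add: van_insert)
      moreover have "T p = V p" using diff_left[OF T, of p] X by simp
      ultimately show False using Q V False by simp
    qed
  qed
  then show ?thesis using that V by blast
qed


text \<open>A height function of the program \<open>(g, f)\<close> on the contraction of the
  original oriented matroid by \<open>A\<close>, read on old cocircuits. The line has to be spanned
  without \<open>p\<close>, since otherwise the pair need not be comodular in the original.\<close>

definition old_height :: "'a set \<Rightarrow> 'a \<Rightarrow> 'a \<Rightarrow> ('a signvec \<Rightarrow> int) \<Rightarrow> bool" where
  "old_height A g f \<rho> \<longleftrightarrow> (\<forall>S X Y Z. p \<notin> S \<longrightarrow> corank M 2 S \<longrightarrow> old X \<longrightarrow> old Y \<longrightarrow> X \<in> van M S \<longrightarrow> Y \<in> van M S \<longrightarrow>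
     (\<forall>a \<in> A. X a = 0 \<and> Y a = 0) \<longrightarrow> X \<noteq> Y \<longrightarrow> X g = Y g \<longrightarrow> X g \<noteq> 0 \<longrightarrow> diff M g X Y Z \<longrightarrow>
     sgn (\<rho> Y - \<rho> X) = Z f * X g)"

lemma old_heightD:
  assumes "old_height A g f \<rho>" "p \<notin> S" "corank M 2 S" "old X" "old Y" "X \<in> van M S" "Y \<in> van M S"
    "\<And>a. a \<in> A \<Longrightarrow> X a = 0 \<and> Y a = 0" "X \<noteq> Y" "X g = Y g" "X g \<noteq> 0" "diff M g X Y Z"
  shows "sgn (\<rho> Y - \<rho> X) = Z f * X g"
  using assms unfolding old_height_def by blast

text \<open>The sign \<open>d\<close> of the change of \<open>x/p\<close> from \<open>U\<close> to
  \<open>U'\<close>. Repetition is allowed with \<open>d = 0\<close> because different vertices of a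
  cycle may share a limit or a direction.\<close>

definition oriented_step :: "'a \<Rightarrow> 'a signvec \<Rightarrow> 'a signvec \<Rightarrow> int \<Rightarrow> bool" where
  "oriented_step x U U' d \<longleftrightarrow> U p = U' p \<and> U x = U' x \<and> (if U = U' then d = 0 else
     \<exists>S Z. p \<notin> S \<and> corank M 2 S \<and> U \<in> van M S \<and> U' \<in> van M S \<and> diff M p U U' Z \<and> d = Z x)"

text \<open>With leading index \<open>i\<close>, distinct collinear old cocircuits never have the
  same ratio of \<open>x\<close> to \<open>e i\<close>. This is vacuous if \<open>x\<close> lies in
  the closure of the earlier elements, and it also follows from general position.\<close>

definition untied :: "'a \<Rightarrow> nat \<Rightarrow> bool" where
  "untied x i \<longleftrightarrow>
     (\<forall>S U U' Z. p \<notin> S \<longrightarrow> corank M 2 S \<longrightarrow> old U \<longrightarrow> old U' \<longrightarrow> U \<in> van M S \<longrightarrow> U' \<in> van M S \<longrightarrow> U \<noteq> U' \<longrightarrow>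
       (\<forall>a \<in> e ` {1..<i}. U a = 0 \<and> U' a = 0) \<longrightarrow> U (e i) = U' (e i) \<longrightarrow> U (e i) \<noteq> 0 \<longrightarrow> U x = U' x \<longrightarrow> U x \<noteq> 0 \<longrightarrow>
       diff M (e i) U U' Z \<longrightarrow> Z x \<noteq> 0)"

definition tie_break :: "'a \<Rightarrow> nat \<Rightarrow> nat \<Rightarrow> bool" where
  "tie_break x i t \<longleftrightarrow> (\<exists>\<rho>. old_height (e ` {1..<i}) (e i) (e t) \<rho>) \<or> untied x i"

text \<open>\<open>Z\<close> lies on \<open>p\<close>, and the nearby point \<open>W\<close> from
  \<open>limit_exists\<close> lies on \<open>e j\<close>, so \<open>W\<close> is \<open>U'\<close>
  if \<open>U'\<close> lies on \<open>e j\<close> and \<open>E\<close> otherwise; wherever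
  \<open>W\<close> is nonzero, except at \<open>p\<close>, \<open>Z\<close> has its sign. In a tie
  \<open>E x = 0\<close>, \<open>x\<close> is parallel to \<open>e j\<close> on the line, and
  \<open>W p = - Z (e j)\<close> brings in the lower order terms of \<open>p\<close>.\<close>

lemma line_step:
  assumes S: "corank M 2 S" "p \<notin> S" and U: "old U" "U \<in> van M S" and U': "old U'" "U' \<in> van M S" and ne: "U \<noteq> U'"
    and p: "U p = U' p" "U p \<noteq> 0" and x: "U x = U' x" "U x \<noteq> 0" and xp: "x \<noteq> p" and Z: "diff M p U U' Z"
    and j: "j \<in> {1..k}" "U (e j) \<noteq> 0" "\<And>i. i \<in> {1..k} \<Longrightarrow> i < j \<Longrightarrow> U (e i) = 0 \<and> U' (e i) = 0"
  shows "U' (e j) = 0 \<Longrightarrow> Z x = U x"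
    and "diff M (e j) U U' E \<Longrightarrow> U' (e j) \<noteq> 0 \<Longrightarrow> E x \<noteq> 0 \<Longrightarrow> Z x = E x"
    and "diff M (e j) U U' E \<Longrightarrow> U' (e j) \<noteq> 0 \<Longrightarrow> E x = 0 \<Longrightarrow> Z x * U x = - (E p * U (e j))"
proof -
  let ?a = "e j"
  have ne': "U \<noteq> - U'" using p by auto
  have ap: "?a \<noteq> p" using e_ground[OF j(1)] by auto
  have Up: "U p = U ?a" using old_lex[OF U(1) j(1,2)] j(3) by blast
  have zero: "\<forall>i \<in> {1..k}. i < j \<longrightarrow> (\<forall>T \<in> van M S. T (e i) = 0)"
    using line_common_zero[OF S(1) U(2) old_nz[OF U(1)] U'(2) old_nz[OF U'(1)] ne ne'] j(3) by blast
  have ZS: "Z \<in> van M S" "Z p = 0" using diff_van[OF Z U(2) U'(2)] diff_g[OF Z] .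
  have Zn: "nz Z" using diff_nz[OF old_cocircuit[OF U(1)] old_cocircuit[OF U'(1)] ne ne' Z] .
  obtain W where W: "W \<in> van M S" "nz W" "W ?a = 0" "W p = - Z ?a" "\<And>y. y \<noteq> p \<Longrightarrow> W y \<noteq> 0 \<Longrightarrow> Z y = W y"
    using limit_exists[OF S j(1) zero U(2) j(2) ZS Zn] by metis
  note pa = corank_insert2[OF S(1) U(2) j(2)]
  have WS: "W \<in> van M (insert ?a S)" using W by (simp add: van_insert)
  show "Z x = U x" if a0: "U' ?a = 0"
  proof -
    have "Z ?a = - U ?a" using diff_right[OF Z a0] .
    then have "W p = U' p" using W Up p by simp
    then have "W = U'" using point_eq[OF pa WS, of U' p] U' a0 p by (simp add: van_insert)
    then show ?thesis using W(5)[OF xp] x by simp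
  qed
  assume E: "diff M ?a U U' E" and a1: "U' ?a \<noteq> 0"
  have Up': "U' p = U' ?a" using old_lex[OF U'(1) j(1) a1] j(3) by blast
  have ES: "E \<in> van M (insert ?a S)" using diff_van[OF E U(2) U'(2)] diff_g[OF E] by (simp add: van_insert)
  have En: "nz E" using diff_nz[OF old_cocircuit[OF U(1)] old_cocircuit[OF U'(1)] ne ne' E] .
  \<comment> \<open>At such \<open>v\<close> both differences \<open>Z\<close> and \<open>E\<close>
    have the sign of \<open>U'\<close>, which decides between \<open>W = E\<close> and
    \<open>W = - E\<close>.\<close>
  obtain v where v: "v \<in> zero_set M U - {p}" "U' v \<noteq> 0"
  proof -
    have "U \<in> van M (zero_set M U - {p})" using old_cov[OF U(1)] by (auto simp: van_def zero_set_def)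
    moreover have "U' \<in> van M (zero_set M U - {p})" if "\<forall>v \<in> zero_set M U - {p}. U' v = 0"
      using that old_cov[OF U'(1)] by (auto simp: van_def)
    ultimately show ?thesis
      using point_unique[OF old_corank[OF U(1)]] old_nz U U' ne ne' that by blast
  qed
  have v0: "U v = 0" "v \<noteq> p" using v by (auto simp: zero_set_def)
  have Ev: "E v = U' v" "Z v = U' v" using diff_left[OF E v0(1)] diff_left[OF Z v0(1)] .
  have "W v \<noteq> 0" using point_nz[OF pa WS W(2) ES En, of v] Ev v by simp
  then have "W v = E v" using W(5)[OF v0(2)] Ev by simp
  then have WE: "W = E" using point_eq[OF pa WS ES, of v] \<open>W v \<noteq> 0\<close> by blast
  show "Z x = E x" if "E x \<noteq> 0" using W(5)[OF xp] that WE by simp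
  show "Z x * U x = - (E p * U ?a)" if Ex: "E x = 0"
  proof -
    have "E \<in> van M S" "E ?a = 0" using ES by (simp_all add: van_insert)
    then obtain c where c: "\<And>T. T \<in> van M S \<Longrightarrow> T x = c * T ?a" "c \<in> {-1,0,1}"
      using line_parallel[OF S(1) _ En _ Ex U(2) j(2)] by blast
    have "c * c = 1" using c(1)[OF U(2)] c(2) x by auto
    have "Z x * U x = (c * c) * (Z ?a * U ?a)" using c(1)[OF ZS(1)] c(1)[OF U(2)] by (simp add: algebra_simps)
    then show ?thesis using \<open>c * c = 1\<close> W(4) WE by simp
  qed
qed


text \<open>The order of the potentials is dictated by writing the new element as \<open>e 1 + \<epsilon> e 2 + \<epsilon>\<^sup>2 e 3 + \<dots>\<close>
  with infinitesimal \<open>\<epsilon>\<close>: first the index of the leading term of \<open>p\<close>, then the ratio of \<open>x\<close> to this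
  leading term, then the lower order terms.\<close>

lemma no_oriented_cycle:
  assumes N: "N > 0" and per: "\<And>i. U (i + N) = U i"
    and U: "\<And>i. old (U i)" "\<And>i. U i p \<noteq> 0" "\<And>i. U i x \<noteq> 0"
    and xp: "x \<noteq> p"
    and step: "\<And>i. oriented_step x (U i) (U (Suc i)) (D i)" and mono: "\<And>i. s * D i \<ge> 0" and s: "s \<noteq> 0"
    and H: "\<And>i. i \<in> {1..k} \<Longrightarrow> \<exists>\<rho>. old_height {} (e i) x \<rho>"
    and tb: "\<And>i t. 1 \<le> i \<Longrightarrow> i < t \<Longrightarrow> t \<le> k \<Longrightarrow> tie_break x i t"
  shows "D i = 0"
proof -
  have cov: "U i \<in> covectors M" for i using old_cov U by blast
  have const: "U i y = U 0 y" if "\<And>i. U (Suc i) y = U i y" for i y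
    by (induction i) (use that in auto)
  have eqs: "U (Suc i) p = U i p" "U (Suc i) x = U i x" for i
    using step[of i] unfolding oriented_step_def by metis+
  have Up: "U i p = U 0 p" and Ux: "U i x = U 0 x" for i
    using const[of p] const[of x] eqs by blast+
  have neq: "U i \<noteq> - U (Suc i)" for i
  proof
    assume "U i = - U (Suc i)"
    then have "U i p = - U (Suc i) p" by (metis uminus_apply)
    then show False using eqs(1)[of i] U(2)[of i] by simp
  qed
  have com: "comodular M (U i) (U (Suc i))"
    if "p \<notin> S" "corank M 2 S" "U i \<in> van M S" "U (Suc i) \<in> van M S" "U i \<noteq> U (Suc i)" for S i
    using comodularI[OF that(2) old_cocircuit[OF U(1)] that(3) old_cocircuit[OF U(1)] that(4,5) neq] .
  have same: "D i = 0" if "U i = U (Suc i)" for i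
    using step[of i] that by (simp add: oriented_step_def)
  have diff: "\<exists>S Z. p \<notin> S \<and> corank M 2 S \<and> U i \<in> van M S \<and> U (Suc i) \<in> van M S \<and> diff M p (U i) (U (Suc i)) Z \<and> D i = Z x"
    if "U i \<noteq> U (Suc i)" for i
    using step[of i] that by (simp add: oriented_step_def)
  define lead where "lead i = (LEAST j. j \<in> {1..k} \<and> U i (e j) \<noteq> 0)" for i
  have lead: "lead i \<in> {1..k}" "U i (e (lead i)) \<noteq> 0" for i
    using old_lex_zero[OF U(1)[of i]] U(2)[of i] LeastI_ex[of "\<lambda>j. j \<in> {1..k} \<and> U i (e j) \<noteq> 0"]
    unfolding lead_def by blast+
  have lead_less: "U i (e j) = 0" if "j \<in> {1..k}" "j < lead i" for i j
    using not_less_Least[of j "\<lambda>j. j \<in> {1..k} \<and> U i (e j) \<noteq> 0"] that unfolding lead_def by blast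
  have drop: "D i = U 0 x" if lt: "lead i < lead (Suc i)" for i
  proof -
    have ne: "U i \<noteq> U (Suc i)" using lt by (auto simp: lead_def)
    obtain S Z where S: "p \<notin> S" "corank M 2 S" "U i \<in> van M S" "U (Suc i) \<in> van M S" "diff M p (U i) (U (Suc i)) Z" "D i = Z x"
      using diff[OF ne] by blast
    have "Z x = U i x"
      by (rule line_step(1)[OF S(2,1) U(1) S(3) U(1) S(4) ne _ U(2) _ U(3) xp S(5) lead])
        (use lead_less[of _ i] lead_less[of _ "Suc i"] lt lead[of i] in \<open>auto simp: Up[of i] Up[of "Suc i"] Ux[of i] Ux[of "Suc i"]\<close>)
    then show ?thesis using S Ux by simp
  qed
  have rise: "D i = - U 0 x" if lt: "lead (Suc i) < lead i" for i
  proof -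
    have ne: "U (Suc i) \<noteq> U i" using lt by (auto simp: lead_def)
    obtain S Z where S: "p \<notin> S" "corank M 2 S" "U i \<in> van M S" "U (Suc i) \<in> van M S" "diff M p (U i) (U (Suc i)) Z" "D i = Z x"
      using diff[of i] ne by metis
    have "(- Z) x = U (Suc i) x"
      by (rule line_step(1)[OF S(2,1) U(1) S(4) U(1) S(3) ne _ U(2) _ U(3) xp diff_antisym[OF S(5)] lead])
        (use lead_less[of _ i] lead_less[of _ "Suc i"] lt lead[of "Suc i"] in \<open>auto simp: Up[of i] Up[of "Suc i"] Ux[of i] Ux[of "Suc i"]\<close>)
    then show ?thesis using S Ux[of "Suc i"] by simp
  qed
  \<comment> \<open>A rise of the leading index forces \<open>D i = U 0 x\<close>, a fall
    \<open>D i = - U 0 x\<close>; as \<open>s * D i\<close> is never negative, the sign of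
    \<open>?c\<close> allows only one of the two.\<close>
  let ?c = "s * U 0 x"
  have "?c * int (lead i) = ?c * int (lead j)" for i j
  proof (rule periodic_mono_const[of "\<lambda>i. ?c * int (lead i)", OF _ N])
    show "?c * int (lead i) \<le> ?c * int (lead (Suc i))" for i
    proof (cases "lead i" "lead (Suc i)" rule: linorder_cases)
      case less
      then have "?c \<ge> 0" using drop[of i] mono[of i] by simp
      then show ?thesis using less by (simp add: mult_left_mono)
    next
      case greater
      then have "?c \<le> 0" using rise[of i] mono[of i] by simp
      then show ?thesis using greater by (simp add: mult_left_mono_neg)
    qed simp
    show "?c * int (lead (i + N)) = ?c * int (lead i)" for i by (simp add: lead_def per)
  qed
  then have lead_const: "lead i = lead 0" for i using s U(3)[of 0] by simp
  define J where "J = lead 0"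
  define a where "a = e J"
  have J: "J \<in> {1..k}" "U i a \<noteq> 0" for i using lead[of 0] lead[of i] lead_const[of i] by (auto simp: J_def a_def)
  have Jless: "U i (e j) = 0" if "j \<in> {1..k}" "j < J" for i j
    using lead_less[OF that(1), of i] lead_const[of i] that(2) by (simp add: J_def)
  have Ua: "U i a = U 0 p" for i
    using old_lex[OF U(1) J(1), of i] J(2)[of i] Jless Up[of i] by (simp add: a_def)
  have Ua2: "U i a = U (Suc i) a" for i using Ua by metis
  have ex: "\<exists>S E. p \<notin> S \<and> corank M 2 S \<and> U i \<in> van M S \<and> U (Suc i) \<in> van M S \<and> old E \<and> E \<in> van M S \<and>
      diff M a (U i) (U (Suc i)) E \<and> (E x \<noteq> 0 \<longrightarrow> D i = E x) \<and> (E x = 0 \<longrightarrow> D i * U 0 x = - (E p * U 0 p))"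
    if ne: "U i \<noteq> U (Suc i)" for i
  proof -
    obtain S Z where S: "p \<notin> S" "corank M 2 S" "U i \<in> van M S" "U (Suc i) \<in> van M S" "diff M p (U i) (U (Suc i)) Z" "D i = Z x"
      using diff[OF ne] by blast
    obtain E where E: "diff M a (U i) (U (Suc i)) E"
      using diff_exists[OF cov cov, of i a "Suc i"] Ua J(2)[of i] by auto
    have ES: "E \<in> van M S" using diff_van[OF E S(3,4)] .
    have En: "nz E" using diff_nz[OF old_cocircuit[OF U(1)] old_cocircuit[OF U(1)] ne neq E] .
    have "a \<noteq> p" using e_ground[OF J(1)] by (auto simp: a_def)
    then have oE: "old E" using line_old[OF S(2,1) ES En diff_g[OF E] S(3) J(2)] by blast
    note ls = line_step[OF S(2,1) U(1) S(3) U(1) S(4) ne _ U(2) _ U(3) xp S(5) J(1), folded a_def]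
    have p2: "U i p = U (Suc i) p" "U i x = U (Suc i) x" using Up Ux by metis+
    have z: "\<And>j. j \<in> {1..k} \<Longrightarrow> j < J \<Longrightarrow> U i (e j) = 0 \<and> U (Suc i) (e j) = 0" using Jless by blast
    have "E x \<noteq> 0 \<longrightarrow> D i = E x" using ls(2)[OF p2 J(2) z E J(2)] S(6) by auto
    moreover have "E x = 0 \<longrightarrow> D i * U 0 x = - (E p * U 0 p)"
      using ls(3)[OF p2 J(2) z E J(2)] S(6) Ux[of i] Ua[of i] by auto
    ultimately show ?thesis using S ES oE E by blast
  qed
  \<comment> \<open>One argument for the leading term (\<open>y = x\<close>, with signs 1 and 1) and
    for each lower term (\<open>y = e t\<close>, with signs \<open>U 0 x\<close> and
    \<open>- U 0 p\<close>): if \<open>\<rho>\<close> records \<open>E y\<close>, and a nonzero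
    \<open>E y\<close> determines \<open>D i\<close> up to the fixed signs \<open>\<epsilon>\<close>
    and \<open>c\<close>, then \<open>\<rho>\<close> is monotone along the cycle.\<close>
  have height_zero: "E y = 0"
    if \<rho>: "\<And>i S E. p \<notin> S \<Longrightarrow> corank M 2 S \<Longrightarrow> U i \<in> van M S \<Longrightarrow> U (Suc i) \<in> van M S \<Longrightarrow> U i \<noteq> U (Suc i) \<Longrightarrow>
          diff M a (U i) (U (Suc i)) E \<Longrightarrow> sgn (\<rho> (U (Suc i)) - \<rho> (U i)) = E y * U i a"
      and D: "\<And>i S E. p \<notin> S \<Longrightarrow> corank M 2 S \<Longrightarrow> U i \<in> van M S \<Longrightarrow> U (Suc i) \<in> van M S \<Longrightarrow> U i \<noteq> U (Suc i) \<Longrightarrow>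
          diff M a (U i) (U (Suc i)) E \<Longrightarrow> E y \<noteq> 0 \<Longrightarrow> \<epsilon> * D i = c * E y"
      and c: "c \<noteq> 0" and \<epsilon>: "\<epsilon> * \<epsilon> = 1"
      and i: "p \<notin> S" "corank M 2 S" "U i \<in> van M S" "U (Suc i) \<in> van M S" "U i \<noteq> U (Suc i)" "diff M a (U i) (U (Suc i)) E"
    for \<rho> y S E \<epsilon> c i
  proof -
    let ?d = "s * \<epsilon> * c * U 0 p"
    have "?d * \<rho> (U i) = ?d * \<rho> (U j)" for i j
    proof (rule periodic_mono_const[of "\<lambda>i. ?d * \<rho> (U i)", OF _ N])
      show "?d * \<rho> (U (i + N)) = ?d * \<rho> (U i)" for i by (simp add: per)
      show "?d * \<rho> (U i) \<le> ?d * \<rho> (U (Suc i))" for i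
      proof (cases "U i = U (Suc i)")
        case False
        then obtain S E where S: "p \<notin> S" "corank M 2 S" "U i \<in> van M S" "U (Suc i) \<in> van M S" "diff M a (U i) (U (Suc i)) E"
          using ex by metis
        let ?r = "\<rho> (U (Suc i)) - \<rho> (U i)"
        have sg: "sgn ?r = E y * U 0 p" using \<rho>[OF S(1-4) False S(5)] Ua by simp
        have "?d * ?r \<ge> 0"
        proof (cases "E y = 0")
          case True then show ?thesis using sg by (simp add: sgn_0_0)
        next
          case Ey: False
          have "s * D i = s * (\<epsilon> * \<epsilon>) * D i" using \<epsilon> by simp
          also have "\<dots> = s * \<epsilon> * (c * E y)" using D[OF S(1-4) False S(5) Ey] by (simp add: algebra_simps)
          finally have "s * D i = s * \<epsilon> * c * E y" by (simp only: mult.assoc)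
          then have "0 \<le> s * \<epsilon> * c * E y" using mono[of i] by metis
          then have "0 \<le> s * \<epsilon> * c * E y * (U 0 p * U 0 p) * \<bar>?r\<bar>" by (simp add: mult_nonneg_nonneg)
          also have "\<dots> = ?d * (sgn ?r * \<bar>?r\<bar>)" using sg by (simp add: algebra_simps)
          finally show ?thesis by (simp add: sgn_mult_abs)
        qed
        then show ?thesis by (simp add: algebra_simps)
      qed simp
    qed
    moreover have "?d \<noteq> 0" using s c \<epsilon> U(2)[of 0] by auto
    ultimately have "\<rho> (U (Suc i)) = \<rho> (U i)" by simp
    then show "E y = 0" using \<rho>[OF i] J(2)[of i] by simp
  qed
  have Ex: "E x = 0"
    if i: "p \<notin> S" "corank M 2 S" "U i \<in> van M S" "U (Suc i) \<in> van M S" "U i \<noteq> U (Suc i)" "diff M a (U i) (U (Suc i)) E" for S E i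
  proof -
    obtain \<rho> where \<rho>: "old_height {} a x \<rho>" using H[OF J(1)] unfolding a_def by blast
    show ?thesis
    proof (rule height_zero[of \<rho> x 1 1, OF _ _ _ _ i])
      show "sgn (\<rho> (U (Suc i)) - \<rho> (U i)) = E x * U i a"
        if "p \<notin> S" "corank M 2 S" "U i \<in> van M S" "U (Suc i) \<in> van M S" "U i \<noteq> U (Suc i)" "diff M a (U i) (U (Suc i)) E" for i S E
        using old_heightD[OF \<rho> that(1,2) U(1) U(1) that(3,4) _ that(5) Ua2 J(2) that(6)] by blast
      show "1 * D i = 1 * E x"
        if i: "p \<notin> S" "corank M 2 S" "U i \<in> van M S" "U (Suc i) \<in> van M S" "U i \<noteq> U (Suc i)" "diff M a (U i) (U (Suc i)) E" "E x \<noteq> 0" for i S E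
      proof -
        obtain E' where E': "diff M a (U i) (U (Suc i)) E'" "E' x \<noteq> 0 \<longrightarrow> D i = E' x" using ex[OF i(5)] by - (erule exE, erule exE, (erule conjE)+, rule that, assumption+)
        have "E' = E" using diff_unique[OF com[OF i(1-5)] Ua2 J(2) E'(1) i(6)] .
        then show ?thesis using E'(2) i(7) by simp
      qed
    qed simp_all
  qed
  have Et: "E (e t) = 0"
    if "t \<in> {1..k}" and i: "p \<notin> S" "corank M 2 S" "U i \<in> van M S" "U (Suc i) \<in> van M S" "U i \<noteq> U (Suc i)" "diff M a (U i) (U (Suc i)) E" for t S E i
    using that
  proof (induction t arbitrary: S E i rule: less_induct)
    case (less t)
    note i = less.prems(2-7)
    have z: "\<forall>b \<in> e ` {1..<J}. U i b = 0" for i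
      using Jless J(1) by auto
    consider "t < J" | "t = J" | "J < t" by linarith
    then show ?case
    proof cases
      case 1
      then show ?thesis using diff_left[OF i(6) Jless[OF less.prems(1)]] Jless[OF less.prems(1)] by simp
    next
      case 2
      then show ?thesis using diff_g[OF i(6)] by (simp add: a_def)
    next
      case 3
      then have "tie_break x J t" using tb J(1) less.prems(1) by auto
      \<comment> \<open>The leading terms are already known to tie by \<open>Ex\<close>, so only the
        potential on the contraction remains.\<close>
      moreover have "\<not> untied x J"
      proof
        assume A: "untied x J"
        have "U i x = U (Suc i) x" using Ux by metis
        then have "E x \<noteq> 0"
          using A[unfolded untied_def, rule_format, OF i(1,2) U(1) U(1) i(3,4,5) _ _ _ _ U(3), folded a_def, OF _ Ua2 J(2) _ i(6)] z by blast
        then show False using Ex[OF i] by blast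
      qed
      ultimately obtain \<rho> where \<rho>: "old_height (e ` {1..<J}) a (e t) \<rho>"
        unfolding tie_break_def a_def by blast
      show ?thesis
      proof (rule height_zero[of \<rho> "e t" "U 0 x" "- U 0 p", OF _ _ _ _ i])
        show "sgn (\<rho> (U (Suc i)) - \<rho> (U i)) = E (e t) * U i a"
          if "p \<notin> S" "corank M 2 S" "U i \<in> van M S" "U (Suc i) \<in> van M S" "U i \<noteq> U (Suc i)" "diff M a (U i) (U (Suc i)) E" for i S E
          using old_heightD[OF \<rho> that(1,2) U(1) U(1) that(3,4) _ that(5) Ua2 J(2) that(6)] z by blast
        show "U 0 x * D i = - U 0 p * E (e t)"
          if i: "p \<notin> S" "corank M 2 S" "U i \<in> van M S" "U (Suc i) \<in> van M S" "U i \<noteq> U (Suc i)" "diff M a (U i) (U (Suc i)) E" "E (e t) \<noteq> 0" for i S E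
        proof -
          obtain E' where E': "old E'" "diff M a (U i) (U (Suc i)) E'" "E' x = 0 \<longrightarrow> D i * U 0 x = - (E' p * U 0 p)" using ex[OF i(5)] by - (erule exE, erule exE, (erule conjE)+, rule that, assumption+)
          have EE: "E' = E" using diff_unique[OF com[OF i(1-5)] Ua2 J(2) E'(2) i(6)] .
          have "old E" using E'(1) EE by simp
          \<comment> \<open>By induction \<open>E\<close> vanishes at all \<open>e i\<close> with
            \<open>i < t\<close>, so \<open>e t\<close> is the leading term of the old cocircuit
            \<open>E\<close>.\<close>
          then have "E p = E (e t)"
            by (rule old_lex[OF _ less.prems(1), of E]) (use i(7) less.IH[OF _ _ i(1-6)] in blast)+
          then show ?thesis using E'(3) Ex[OF i(1-6)] unfolding EE by (simp add: mult.commute)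
        qed
        show "- U 0 p \<noteq> 0" using U(2) by simp
        show "U 0 x * U 0 x = 1" using U(3)[of 0] covector_range[OF cov, of 0 x] by auto
      qed
    qed
  qed
  show "D i = 0"
  proof (cases "U i = U (Suc i)")
    case False
    then obtain S E where S: "p \<notin> S" "corank M 2 S" "U i \<in> van M S" "U (Suc i) \<in> van M S" "old E" "diff M a (U i) (U (Suc i)) E"
      "E x = 0 \<longrightarrow> D i * U 0 x = - (E p * U 0 p)" using ex by metis
    have "E p = 0" using old_lex_zero[OF S(5)] Et[OF _ S(1-4) False S(6)] by blast
    then show ?thesis using S(7) Ex[OF S(1-4) False S(6)] U(3)[of 0] by simp
  qed (rule same)
qed

end

section \<open>Limits of new cocircuits\<close>

context oriented_matroid
begin

lemma van_align:
  assumes "T \<in> van M S" "T g \<noteq> 0" "X \<in> van M S'" "X g \<noteq> 0"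
  obtains T' where "T' \<in> van M S" "T' g = X g" "T' = T \<or> T' = - T"
proof (cases "T g = X g")
  case True
  then show ?thesis using that assms by blast
next
  case False
  then have "(- T) g = X g"
    using assms covector_range[OF van_cov[OF assms(1)], of g] covector_range[OF van_cov[OF assms(3)], of g] by auto
  then show ?thesis using that van_uminus[OF assms(1)] by blast
qed

lemma van_exchange:
  assumes V: "V \<in> van M S" "V a = 0" "V b \<noteq> 0" and U: "U \<in> van M S" "U a \<noteq> 0"
  obtains T where "T \<in> van M S" "T b = 0" "T a \<noteq> 0"
proof (cases "U b = 0")
  case True
  then show ?thesis using that U by blast
next
  case False
  then obtain V' where V': "V' \<in> van M S" "V' b = U b" "V' = V \<or> V' = - V" using van_align[OF V(1,3) U(1)] by metis
  then have V'a: "V' a = 0" "U b = V' b" using V(2) by auto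
  obtain T where T: "diff M b U V' T" using diff_exists[OF van_cov[OF U(1)] van_cov[OF V'(1)] V'a(2) False] .
  show ?thesis
    using that[of T] diff_van[OF T U(1) V'(1)] diff_g[OF T] diff_right[OF T V'a(1)] U(2) by simp
qed

lemma sgn_diff:
  assumes Z: "diff M g X Y Z" and X: "X \<in> covectors M" and Y: "Y \<in> covectors M" and ne: "X d \<noteq> Y d"
  shows "Z d = sgn (Y d - X d)"
  using ne diff_left[OF Z, of d] diff_right[OF Z, of d] diff_opp[OF Z, of d]
  by (cases rule: sign_cases[OF X, of d]; cases rule: sign_cases[OF Y, of d]) simp_all

end

context lex_extended
begin

definition is_limit :: "'a signvec \<Rightarrow> 'a signvec \<Rightarrow> nat \<Rightarrow> bool" where
  "is_limit X V j \<longleftrightarrow> j \<in> {1..k} \<and> (\<forall>i \<in> {1..k}. i < j \<longrightarrow> (\<forall>T \<in> van M (zero_set M X - {p}). T (e i) = 0)) \<and>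
     (\<exists>T \<in> van M (zero_set M X - {p}). T (e j) \<noteq> 0) \<and> V \<in> van M (zero_set M X - {p}) \<and> nz V \<and>
     V (e j) = 0 \<and> V p = - X (e j) \<and> (\<forall>x. x \<noteq> p \<longrightarrow> V x \<noteq> 0 \<longrightarrow> X x = V x)"

text \<open>Old cocircuits are their own limits, so that all vertices of a cycle can be treated
  alike.\<close>

definition limit :: "'a signvec \<Rightarrow> 'a signvec" where
  "limit X = (if old X then X else (SOME V. \<exists>j. is_limit X V j))"

text \<open>Dropping \<open>p\<close> lowers the rank of the zero set, for otherwise
  \<open>X\<close> would be old. Hence the other zeros span a line not contained in
  \<open>p\<close>, and \<open>X\<close> is the point where \<open>p\<close> meets it.\<close>

lemma new_line:
  assumes X: "X \<in> cocircuits M" "\<not> old X"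
  shows "X p = 0" "corank M 2 (zero_set M X - {p})" "corank M 1 (insert p (zero_set M X - {p}))"
    "X \<in> van M (zero_set M X - {p})" "\<exists>T \<in> van M (zero_set M X - {p}). T p \<noteq> 0"
proof -
  show p0: "X p = 0" using old_p0 X by blast
  let ?L = "zero_set M X - {p}"
  have L: "?L \<subseteq> ground M" by (auto simp: zero_set_def)
  have z: "zero_set M X = insert p ?L" using p0 p_ground by (auto simp: zero_set_def)
  then show c1: "corank M 1 (insert p ?L)" using cocircuit_corank[OF X(1)] by simp
  have nc: "\<not> corank M 1 ?L" using X by (simp add: old_def)
  then have "p \<notin> cl M ?L" "rank_of M ?L + 2 = om_rank M"
    using rank_insert[OF L p_ground] c1 L by (auto simp: corank_def split: if_splits)
  then show "corank M 2 ?L" "\<exists>T \<in> van M ?L. T p \<noteq> 0"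
    using L not_clE[OF L p_ground] by (auto simp: corank_def)
  show "X \<in> van M ?L" using cocircuit_cov[OF X(1)] by (auto simp: van_def zero_set_def)
qed

lemma limit_new:
  assumes X: "X \<in> cocircuits M" "\<not> old X"
  obtains j where "is_limit X (limit X) j"
proof -
  let ?L = "zero_set M X - {p}"
  note N = new_line[OF X]
  obtain T where T: "T \<in> van M ?L" "T p \<noteq> 0" using N(5) by blast
  let ?P = "\<lambda>j. j \<in> {1..k} \<and> (\<exists>T \<in> van M ?L. T (e j) \<noteq> 0)"
  have ex: "\<exists>j. ?P j" using p_not_spanned[OF T] by metis
  define j where "j = (LEAST j. ?P j)"
  have j: "?P j" unfolding j_def by (rule LeastI_ex[OF ex])
  have less: "\<forall>i \<in> {1..k}. i < j \<longrightarrow> (\<forall>T \<in> van M ?L. T (e i) = 0)"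
    using not_less_Least[of _ ?P] unfolding j_def by blast
  obtain T0 where T0: "T0 \<in> van M ?L" "T0 (e j) \<noteq> 0" using j by blast
  have "p \<notin> ?L" by simp
  then obtain V where V: "V \<in> van M ?L" "nz V" "V (e j) = 0" "V p = - X (e j)" "\<And>x. x \<noteq> p \<Longrightarrow> V x \<noteq> 0 \<Longrightarrow> X x = V x"
    using limit_exists[OF N(2) _ conjunct1[OF j] less T0 N(4,1) cocircuit_nz[OF X(1)]] by metis
  then have "is_limit X V j" using j less unfolding is_limit_def by blast
  then have "\<exists>j. is_limit X (limit X) j"
    using X(2) someI_ex[of "\<lambda>V. \<exists>j. is_limit X V j"] unfolding limit_def by auto
  then show ?thesis using that by blast
qed

lemma limit_old: "old X \<Longrightarrow> limit X = X"
  by (simp add: limit_def)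

lemma limit_new_props:
  assumes X: "X \<in> cocircuits M" "\<not> old X"
  shows "limit X \<in> van M (zero_set M X - {p})" "nz (limit X)" "old (limit X)" "limit X p \<noteq> 0"
    "X \<noteq> limit X" "X \<noteq> - limit X"
proof -
  obtain j where j: "is_limit X (limit X) j" using limit_new[OF X] .
  note N = new_line[OF X]
  show V: "limit X \<in> van M (zero_set M X - {p})" "nz (limit X)" using j by (auto simp: is_limit_def)
  obtain T where T: "T \<in> van M (zero_set M X - {p})" "T (e j) \<noteq> 0" using j by (auto simp: is_limit_def)
  have ep: "e j \<noteq> p" "limit X (e j) = 0" using j e_ground by (auto simp: is_limit_def)
  show o: "old (limit X)" by (rule line_old[OF N(2) _ V ep(2) T ep(1)]) simp
  show "X \<noteq> limit X" using o X by auto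
  show "X \<noteq> - limit X" using old_uminus[OF o] X by auto
  show "limit X p \<noteq> 0"
  proof
    assume "limit X p = 0"
    then have "X \<in> van M (insert p (zero_set M X - {p}))" "limit X \<in> van M (insert p (zero_set M X - {p}))"
      using N(1,4) V(1) unfolding van_insert by blast+
    then show False
      using point_unique[OF N(3) _ cocircuit_nz[OF X(1)] _ V(2)] \<open>X \<noteq> limit X\<close> \<open>X \<noteq> - limit X\<close> by blast
  qed
qed

lemma limit_props:
  assumes X: "X \<in> cocircuits M"
  shows "limit X \<in> van M (zero_set M X - {p})" "nz (limit X)" "old (limit X)"
    "x \<noteq> p \<Longrightarrow> limit X x \<noteq> 0 \<Longrightarrow> X x = limit X x"
proof -
  have "X \<in> van M (zero_set M X - {p})" using cocircuit_cov[OF X] by (auto simp: van_def zero_set_def)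
  then show "limit X \<in> van M (zero_set M X - {p})" "nz (limit X)" "old (limit X)"
    using limit_new_props[OF X] limit_old[of X] cocircuit_nz[OF X] by metis+
  show "X x = limit X x" if "x \<noteq> p" "limit X x \<noteq> 0"
  proof (cases "old X")
    case False
    then show ?thesis using limit_new[OF X False] that by (metis is_limit_def)
  qed (simp add: limit_old)
qed

text \<open>The infinitesimal part \<open>V1\<close> of \<open>X\<close>: the difference from the
  limit to \<open>X\<close>, normalised at \<open>g\<close>.\<close>

definition direction :: "'a \<Rightarrow> 'a signvec \<Rightarrow> 'a signvec" where
  "direction g X = (SOME T. diff M g (limit X) X T)"

lemma direction_props:
  assumes X: "X \<in> cocircuits M" "\<not> old X" and g: "g \<noteq> p" "limit X g \<noteq> 0"
  shows "diff M g (limit X) X (direction g X)" "direction g X \<in> van M (zero_set M X - {p})" "direction g X g = 0"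
    "nz (direction g X)" "direction g X p = - limit X p" "old (direction g X)"
proof -
  note N = new_line[OF X] and V = limit_new_props[OF X]
  have Xg: "limit X g = X g" using limit_props(4)[OF X(1) g] by simp
  obtain T where "diff M g (limit X) X T"
    using diff_exists[OF van_cov[OF V(1)] van_cov[OF N(4)] Xg g(2)] .
  then show D: "diff M g (limit X) X (direction g X)"
    unfolding direction_def by (rule someI[of "diff M g (limit X) X" T])
  show S: "direction g X \<in> van M (zero_set M X - {p})" using diff_van[OF D V(1) N(4)] .
  show "direction g X g = 0" using diff_g[OF D] .
  show n: "nz (direction g X)" 
    using diff_nz[OF old_cocircuit[OF V(3)] X(1) _ _ D] V(5,6) signvec_minus_swap[of X "limit X"] by auto
  show "direction g X p = - limit X p" using diff_right[OF D N(1)] .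
  show "old (direction g X)" by (rule line_old[OF N(2) _ S n diff_g[OF D] V(1) g(2) g(1)]) simp
qed

text \<open>Fixing the sign of \<open>f\<close> as well makes the notion symmetric in
  \<open>f\<close> and \<open>g\<close>, so that the two may be exchanged; on a directed cycle with
  a forward edge this sign is automatically constant and nonzero.\<close>

definition edge :: "'a \<Rightarrow> 'a \<Rightarrow> 'a signvec \<Rightarrow> 'a signvec \<Rightarrow> 'a signvec \<Rightarrow> bool" where
  "edge g f X Y Z \<longleftrightarrow> comodular M X Y \<and> X g = Y g \<and> X g \<noteq> 0 \<and> X f = Y f \<and> X f \<noteq> 0 \<and> diff M g X Y Z"

lemma edge_sym: "edge g f X Y Z \<Longrightarrow> edge g f Y X (- Z)"
  using comodular_sym diff_antisym by (auto simp: edge_def)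

lemma edge_swap:
  assumes E: "edge g f X Y Z"
  obtains Z' where "edge f g X Y Z'" "Z f * X f = - (Z' g * X g)"
proof -
  have E': "comodular M X Y" "X g = Y g" "X g \<noteq> 0" "X f = Y f" "X f \<noteq> 0" "diff M g X Y Z" using E by (auto simp: edge_def)
  note C = comodularD[OF E'(1)]
  obtain Z' where Z': "diff M f X Y Z'" using diff_exists[of X Y f] E'(4,5) C cocircuit_cov by blast
  have "Z f * X f = - (Z' g * X g)"
    using diff_swap[OF C(5) C(1,6) C(2,7) C(3) E'(2-6) Z'] .
  then show ?thesis using that[of Z'] E' Z' by (simp add: edge_def)
qed

text \<open>For a new cocircuit whose limit lies on both \<open>f\<close> and \<open>g\<close>, all old cocircuits on its line
  have the same height, so the choice of \<open>T\<close> is immaterial.\<close>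

definition potential :: "'a \<Rightarrow> 'a \<Rightarrow> ('a signvec \<Rightarrow> int) \<Rightarrow> 'a signvec \<Rightarrow> int" where
  "potential g f \<rho> X = (if limit X g \<noteq> 0 then if limit X f = 0 then 0 else \<rho> (limit X)
     else \<rho> (SOME T. T \<in> van M (zero_set M X - {p}) \<and> old T \<and> T g = X g))"

text \<open>The difference of two candidates, normalised at \<open>g\<close>, is the point of the
  line on \<open>g\<close>. That point is the limit of \<open>X\<close>, which also lies on
  \<open>f\<close>, so the height does not change.\<close>

lemma potential_line:
  assumes X: "X \<in> cocircuits M" "\<not> old X" "limit X g = 0" "limit X f = 0" "X g \<noteq> 0" and gp: "g \<noteq> p"
    and \<rho>: "old_height {} g f \<rho>" and T: "T \<in> van M (zero_set M X - {p})" "old T" "T g = X g"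
  shows "potential g f \<rho> X = \<rho> T"
proof -
  let ?L = "zero_set M X - {p}"
  define T' where "T' = (SOME T. T \<in> van M ?L \<and> old T \<and> T g = X g)"
  have T': "T' \<in> van M ?L \<and> old T' \<and> T' g = X g"
    unfolding T'_def by (rule someI[of _ T]) (use T in blast)
  have "\<rho> T' = \<rho> T"
  proof (cases "T' = T")
    case False
    have g: "T' g = T g" "T' g \<noteq> 0" using T T' X by auto
    obtain Z where Z: "diff M g T' T Z" using diff_exists[of T' T g] old_cov g T T' by blast
    note N = new_line[OF X(1,2)] and V = limit_new_props[OF X(1,2)]
    have ZL: "Z \<in> van M ?L" using diff_van[OF Z] T T' by blast
    have "T' \<noteq> - T" using g by auto
    then have Zn: "nz Z" using diff_nz[OF old_cocircuit old_cocircuit False _ Z] T T' by blast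
    have "Z f = 0"
      using point_nz[OF corank_insert2[OF N(2,4) X(5)], of Z "limit X" f] ZL Zn diff_g[OF Z] V X by (simp add: van_insert)
    then show ?thesis
      using old_heightD[OF \<rho> _ N(2) _ T(2) _ T(1) _ False g Z] T' by (simp add: sgn_0_0)
  qed simp
  then show ?thesis using X by (simp add: potential_def T'_def)
qed

text \<open>The sign of the infinitesimal part of \<open>f/g\<close>, consulted when potentials
  agree. Zero is the right value for old cocircuits, and also for limits on \<open>f\<close> and
  \<open>g\<close>, where \<open>f/g\<close> is constant on the whole line.\<close>

definition slope :: "'a \<Rightarrow> 'a \<Rightarrow> 'a signvec \<Rightarrow> int" where
  "slope g f X = (if old X \<or> limit X g = 0 then 0 else direction g X f * X g)"

text \<open>No infinite value of \<open>f/g\<close> at the limits, and the value zero at both or at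
  neither. The default 0 of \<open>potential\<close> is thus never compared with a value of
  \<open>\<rho>\<close>.\<close>

definition admissible :: "'a \<Rightarrow> 'a \<Rightarrow> 'a signvec \<Rightarrow> 'a signvec \<Rightarrow> bool" where
  "admissible g f X Y \<longleftrightarrow> (limit X g = 0 \<longrightarrow> limit X f = 0) \<and> (limit Y g = 0 \<longrightarrow> limit Y f = 0) \<and>
     ((limit X f = 0 \<and> limit X g \<noteq> 0) \<longleftrightarrow> (limit Y f = 0 \<and> limit Y g \<noteq> 0))"

lemma old_sep:
  assumes X: "old X" and Y: "Y \<in> covectors M" "nz Y" "X \<noteq> Y" "X \<noteq> - Y"
  obtains x where "x \<noteq> p" "X x = 0" "Y x \<noteq> 0"
proof -
  have XS: "X \<in> van M (zero_set M X - {p})" using old_cov[OF X] by (auto simp: van_def zero_set_def)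
  have "\<not> (\<forall>x \<in> zero_set M X - {p}. Y x = 0)"
    using point_unique[OF old_corank[OF X] XS old_nz[OF X], of Y] Y by (auto simp: van_def)
  then show ?thesis using that by (auto simp: zero_set_def)
qed

end

text \<open>An edge both of whose vertices lie on the new element \<open>p\<close>; \<open>F\<close> has corank 3 and the limits of
  both vertices lie on the line spanned by \<open>F\<close> and \<open>a\<close>.\<close>

locale plane_edge = lex_extended M p e k for M :: "'a signed_system" and p e k +
  fixes F :: "'a set" and j :: nat and a g f :: 'a and X Y Z :: "'a signvec"
  assumes F: "corank M 3 F" "p \<notin> F" and j: "j \<in> {1..k}" "\<forall>i \<in> {1..k}. i < j \<longrightarrow> (\<forall>T \<in> van M F. T (e i) = 0)"
    and a: "a = e j" and gp: "g \<noteq> p" and fp: "f \<noteq> p" and edge: "edge g f X Y Z"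
    and XF: "X \<in> van M F" and YF: "Y \<in> van M F" and Xp: "X p = 0" and Yp: "Y p = 0"
    and a0: "X a \<noteq> 0 \<or> Y a \<noteq> 0"
begin

lemma com: "comodular M X Y" and Xg: "X g = Y g" "X g \<noteq> 0" and Xf: "X f = Y f" "X f \<noteq> 0" and Z: "diff M g X Y Z"
  using edge by (auto simp: edge_def)

lemma Xc: "X \<in> cocircuits M" and Yc: "Y \<in> cocircuits M" and XY: "X \<noteq> Y" "X \<noteq> - Y"
  using comodularD[OF com] by auto

lemma ap: "a \<noteq> p" using e_ground[OF j(1)] a by auto

lemma ZF: "Z \<in> van M F" and Zg: "Z g = 0" and Zp: "Z p = 0"
  using diff_van[OF Z XF YF] diff_g[OF Z] diff_left[OF Z Xp] Yp by auto

lemma Zn: "nz Z" using diff_nz[OF Xc Yc XY Z] .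

lemma corank_a: "corank M 2 (insert a F)"
  using a0 corank_insert3[OF F(1) XF] corank_insert3[OF F(1) YF] by blast

lemma corank_g: "corank M 2 (insert g F)"
  using corank_insert3[OF F(1) XF Xg(2)] .

text \<open>The elements before \<open>e j\<close> contain the plane, hence the line of
  \<open>T\<close>. If \<open>T\<close> is off \<open>a\<close>, then so is its line, and
  \<open>e j\<close> is the element that defines the limit; if \<open>T\<close> is on
  \<open>a\<close>, its whole line is.\<close>

lemma limit_plane:
  assumes T: "T \<in> cocircuits M" "T \<in> van M F" "T p = 0"
  shows "limit T \<in> van M F" "limit T a = 0" "T a \<noteq> 0 \<Longrightarrow> limit T p = - T a"
proof -
  have FL: "F \<subseteq> zero_set M T - {p}" using T F corank_ground[OF F(1)] by (auto simp: van_def zero_set_def)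
  then have LF: "van M (zero_set M T - {p}) \<subseteq> van M F" by (rule van_mono)
  show VF: "limit T \<in> van M F" using limit_props(1)[OF T(1)] LF by blast
  have oa: "T a = 0" if "old T" using old_p_zero[OF that T(3) j(1)] a by simp
  have new: "limit T a = 0 \<and> limit T p = - T a" if Ta: "T a \<noteq> 0"
  proof -
    have no: "\<not> old T" using oa Ta by blast
    obtain i where i: "is_limit T (limit T) i" using limit_new[OF T(1) no] .
    have "\<not> i < j"
    proof
      assume "i < j"
      then have "\<forall>U \<in> van M F. U (e i) = 0" using j(2) i by (auto simp: is_limit_def)
      then show False using i LF unfolding is_limit_def by blast
    qed
    moreover have "\<not> j < i"
    proof
      assume "j < i"
      then have "T (e j) = 0" using i j(1) new_line(4)[OF T(1) no] by (auto simp: is_limit_def)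
      then show False using Ta a by simp
    qed
    ultimately have "i = j" by simp
    then show ?thesis using i a by (simp add: is_limit_def)
  qed
  then show "T a \<noteq> 0 \<Longrightarrow> limit T p = - T a" by blast
  show "limit T a = 0"
  proof (cases "T a = 0")
    case True
    then have "a \<in> zero_set M T - {p}" using ap e_ground[OF j(1)] a by (auto simp: zero_set_def)
    then show ?thesis using limit_props(1)[OF T(1)] by (auto simp: van_def)
  qed (use new in blast)
qed

abbreviation V :: "'a signvec" where "V \<equiv> limit X"
abbreviation V' :: "'a signvec" where "V' \<equiv> limit Y"

lemmas VX = limit_plane[OF Xc XF Xp] and VY = limit_plane[OF Yc YF Yp]
lemmas LX = limit_props[OF Xc] and LY = limit_props[OF Yc]

lemma VA: "V \<in> van M (insert a F)" and VA': "V' \<in> van M (insert a F)"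
  using VX VY by (auto simp: van_insert)

lemma new_X: "X a \<noteq> 0 \<Longrightarrow> \<not> old X" and new_Y: "Y a \<noteq> 0 \<Longrightarrow> \<not> old Y"
  using old_p_zero[of X j] old_p_zero[of Y j] Xp Yp j(1) a by auto

text \<open>Such \<open>l\<close> cuts out the line of \<open>X\<close> in the plane; it passes
  through the limit \<open>V\<close>. It misses \<open>Y\<close> because \<open>p\<close> meets that
  line in \<open>X\<close> only.\<close>

lemma sep_X:
  assumes "\<not> old X"
  obtains l where "l \<noteq> p" "X l = 0" "V l = 0" "Y l \<noteq> 0"
proof -
  note N = new_line[OF Xc assms]
  have "\<not> (\<forall>x \<in> zero_set M X - {p}. Y x = 0)"
    using point_unique[OF N(3), of X Y] N(4) Xp Yp cocircuit_nz[OF Xc] cocircuit_nz[OF Yc] cocircuit_cov[OF Yc] XY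
    by (auto simp: van_insert van_def)
  then show ?thesis using that van_zero[OF LX(1)] by (auto simp: zero_set_def)
qed

lemma corank_la:
  assumes "X a \<noteq> 0" "X l = 0" "Y l \<noteq> 0"
  shows "corank M 1 (insert l (insert a F))"
proof -
  obtain T where "T \<in> van M F" "T a = 0" "T l \<noteq> 0" using van_exchange[OF XF assms(2,1) YF assms(3)] .
  then show ?thesis using corank_insert2[OF corank_a, of T l] by (simp add: van_insert)
qed

lemma V'_l:
  assumes l: "X a \<noteq> 0" "X l = 0" "V l = 0" "Y l \<noteq> 0" and ne: "V \<noteq> V'" "V \<noteq> - V'"
  shows "V' l \<noteq> 0"
  using point_unique[OF corank_la[OF l(1,2,4)], of V V'] l VA VA' LX(2) LY(2) ne by (auto simp: van_insert)

lemma sym: "plane_edge M p e k F j a g f Y X (- Z)"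
  using F j a gp fp edge_sym[OF edge] XF YF Xp Yp a0
  by unfold_locales auto

lemma infinity:
  assumes U: "U \<in> van M F" "U a = 0" "U g \<noteq> 0"
  obtains W where "W \<in> van M (insert g (insert a F))" "nz W" "W p = - Z a" "\<And>x. x \<noteq> p \<Longrightarrow> W x \<noteq> 0 \<Longrightarrow> Z x = W x"
proof -
  obtain T where T: "T \<in> van M F" "T g = 0" "T a \<noteq> 0"
    using a0 van_exchange[OF U XF] van_exchange[OF U YF] by metis
  have pS: "p \<notin> insert g F" using F gp by auto
  have less: "\<forall>i \<in> {1..k}. i < j \<longrightarrow> (\<forall>T \<in> van M (insert g F). T (e i) = 0)" using j(2) by (auto simp: van_insert)
  have "T \<in> van M (insert g F)" "T (e j) \<noteq> 0" "Z \<in> van M (insert g F)" using T ZF Zg a by (auto simp: van_insert)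
  then obtain W where W: "W \<in> van M (insert g F)" "nz W" "W (e j) = 0" "W p = - Z (e j)" "\<And>x. x \<noteq> p \<Longrightarrow> W x \<noteq> 0 \<Longrightarrow> Z x = W x"
    using limit_exists[OF corank_g pS j(1) less _ _ _ Zp Zn] by metis
  show ?thesis
  proof (rule that[of W])
    show "W \<in> van M (insert g (insert a F))" using W a by (simp add: van_insert)
  qed (use W a in auto)
qed

lemma Vg: "V g \<noteq> 0 \<Longrightarrow> V g = X g" and Vg': "V' g \<noteq> 0 \<Longrightarrow> V' g = X g"
  using LX(4)[OF gp] LY(4)[OF gp] Xg by auto

text \<open>In the plane, \<open>p\<close> is infinitesimally close to \<open>a\<close>, so the
  point \<open>Z\<close> of \<open>p\<close> on \<open>g\<close> is close to the point of
  \<open>a\<close> on \<open>g\<close>, the difference of the limits. Signs are matched at an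
  element cutting out the line of \<open>X\<close> or of \<open>Y\<close>, where one vertex and its
  limit both vanish.\<close>

lemma limit_edge:
  assumes g: "V g \<noteq> 0" "V' g \<noteq> 0" and ne: "V \<noteq> V'"
  obtains W where "diff M g V V' W" "W \<in> van M (insert g (insert a F))" "nz W" "W p = - Z a" "\<And>x. x \<noteq> p \<Longrightarrow> W x \<noteq> 0 \<Longrightarrow> Z x = W x"
proof -
  obtain W where W: "W \<in> van M (insert g (insert a F))" "nz W" "W p = - Z a" "\<And>x. x \<noteq> p \<Longrightarrow> W x \<noteq> 0 \<Longrightarrow> Z x = W x"
    using infinity[OF VX(1,2) g(1)] by metis
  have gg: "V g = V' g" using Vg Vg' g by simp
  have ne': "V \<noteq> - V'" using gg g by auto
  obtain E where E: "diff M g V V' E" using diff_exists[OF van_cov[OF VX(1)] van_cov[OF VY(1)] gg g(1)] .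
  note pt = corank_insert2[OF corank_a VA g(1)]
  have EA: "E \<in> van M (insert g (insert a F))" using diff_van[OF E VA VA'] diff_g[OF E] by (simp add: van_insert)
  have "W = E"
  proof (cases "X a = 0")
    case False
    then obtain l where l: "l \<noteq> p" "X l = 0" "V l = 0" "Y l \<noteq> 0" using sep_X new_X by metis
    have "V' l \<noteq> 0" using V'_l[OF False l(2-4) ne ne'] .
    moreover have "E l = V' l" "Z l = Y l" using diff_left[OF E l(3)] diff_left[OF Z l(2)] .
    moreover have "W l \<noteq> 0"
      using point_nz[OF corank_la[OF False l(2,4)], of W V g] W(1,2) VA l LX(2) g by (auto simp: van_insert)
    ultimately show ?thesis
      using point_eq[OF pt W(1) EA, of l] W(4)[OF l(1)] LY(4)[OF l(1)] by simp
  next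
    case True
    interpret s: plane_edge M p e k F j a g f Y X "- Z" by (rule sym)
    have Ya: "Y a \<noteq> 0" using a0 True by simp
    then obtain l where l: "l \<noteq> p" "Y l = 0" "V' l = 0" "X l \<noteq> 0" using s.sep_X s.new_X by metis
    have "V l \<noteq> 0" using s.V'_l[OF Ya l(2-4)] ne ne' signvec_minus_swap[of V V'] by metis
    moreover have "E l = - V l" "Z l = - X l" using diff_right[OF E l(3)] diff_right[OF Z l(2)] .
    moreover have "W l \<noteq> 0"
      using point_nz[OF s.corank_la[OF Ya l(2,4)], of W V' g] W(1,2) VA' l LY(2) g by (auto simp: van_insert)
    ultimately show ?thesis
      using point_eq[OF pt W(1) EA, of l] W(4)[OF l(1)] LX(4)[OF l(1)] by simp
  qed
  then show ?thesis using that W E by blast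
qed

end

section \<open>Edges on the new element\<close>

context plane_edge
begin

lemma common_zero_line:
  assumes "V x = 0" "V' x = 0" "V \<noteq> V'" "V \<noteq> - V'" "T \<in> van M (insert a F)"
  shows "T x = 0"
  using line_common_zero[OF corank_a VA LX(2) VA' LY(2) assms(3,4,1,2,5)] .

text \<open>An \<open>f\<close> through two different limits contains the line spanned by
  \<open>F\<close> and \<open>a\<close>; on that line \<open>X\<close> would lie on
  \<open>f\<close>.\<close>

lemma X_off_a:
  assumes "V f = 0" "V' f = 0" "V \<noteq> V'" "V \<noteq> - V'"
  shows "X a \<noteq> 0"
  using common_zero_line[OF assms, of X] XF Xf by (auto simp: van_insert)

lemma V_swap:
  assumes "V \<noteq> V'" "V \<noteq> - V'" shows "V' \<noteq> V" "V' \<noteq> - V"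
  using assms signvec_minus_swap by metis+

lemma mem_line_X:
  assumes new: "\<not> old X" and S: "corank M 2 S" "X \<in> van M S" "V \<in> van M S" and T: "T \<in> van M S"
  shows "T \<in> van M (zero_set M X - {p})"
proof -
  have "T x = 0" if "x \<in> zero_set M X - {p}" for x
    using line_common_zero[OF S(1,2) cocircuit_nz[OF Xc] S(3) LX(2) limit_new_props(5,6)[OF Xc new] _ _ T, of x]
      that van_zero[OF LX(1)] by (auto simp: zero_set_def)
  then show ?thesis using van_cov[OF T] by (auto simp: van_def)
qed

text \<open>If \<open>f\<close> and \<open>g\<close> meet the line of \<open>X\<close> in its limit only, then \<open>X\<close> may be compared with \<open>V'\<close> via an old
  cocircuit \<open>T\<close> on the line of \<open>X\<close>, chosen collinear with \<open>V'\<close>.\<close>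

lemma detour:
  assumes V0: "V g = 0" "V f = 0" and V'g: "V' g \<noteq> 0" and Xa: "X a \<noteq> 0"
  obtains T S U c l where "T \<in> van M (zero_set M X - {p})" "old T" "T g = X g" "T f = X f" "T \<noteq> V'"
    "p \<notin> S" "corank M 2 S" "T \<in> van M S" "V' \<in> van M S" "diff M g T V' U" "U f = Z f"
    "\<And>Q. Q \<in> van M (insert g F) \<Longrightarrow> Q f = c * Q l" "Z l \<noteq> 0"
proof -
  have ne: "V \<noteq> V'" "V \<noteq> - V'" using V0 V'g by auto
  have new: "\<not> old X" using new_X[OF Xa] .
  obtain l where l: "l \<noteq> p" "X l = 0" "V l = 0" "Y l \<noteq> 0" using sep_X[OF new] .
  have V'l: "V' l \<noteq> 0" using V'_l[OF Xa l(2-4) ne] .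
  \<comment> \<open>\<open>T\<close> will be the meeting point of the line of \<open>X\<close>, cut
    out by \<open>l\<close>, and a line through \<open>V'\<close> avoiding \<open>V\<close>, cut out
    by \<open>l'\<close>.\<close>
  obtain l' where l': "l' \<noteq> p" "V' l' = 0" "V l' \<noteq> 0"
    using old_sep[OF LY(3) van_cov[OF LX(1)] LX(2) V_swap[OF ne]] .
  have cl: "corank M 2 (insert l F)" using corank_insert3[OF F(1) YF l(4)] .
  have Xl: "X \<in> van M (insert l F)" and Vl: "V \<in> van M (insert l F)" using XF VX l by (auto simp: van_insert)
  have cll: "corank M 1 (insert l' (insert l F))" using corank_insert2[OF cl Vl l'(3)] .
  obtain T0 where T0: "T0 \<in> van M (insert l' (insert l F))" "nz T0" using point_exists[OF cll] .
  have T0g: "T0 g \<noteq> 0"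
    using point_nz[OF corank_insert2[OF cl Xl Xg(2)], of T0 V l'] T0 Vl V0 l' LX(2) by (auto simp: van_insert)
  obtain T where T: "T \<in> van M (insert l' (insert l F))" "T g = X g"
    using van_align[OF T0(1) T0g XF Xg(2)] by metis
  have Tl: "T \<in> van M (insert l F)" "T l = 0" "T l' = 0" "T \<in> van M F" using T by (auto simp: van_insert)
  have Tg: "T g \<noteq> 0" using T Xg by simp
  \<comment> \<open>Both \<open>f\<close> and \<open>g\<close> vanish at \<open>V\<close>, so they
    are parallel on the line of \<open>X\<close>; agreeing with \<open>X\<close> at
    \<open>g\<close>, \<open>T\<close> agrees with it at \<open>f\<close>.\<close>
  obtain c0 where c0: "\<And>Q. Q \<in> van M (insert l F) \<Longrightarrow> Q f = c0 * Q g"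
    using line_parallel[OF cl Vl LX(2) V0 Xl Xg(2)] by blast
  have Tf: "T f = X f" using c0[OF Tl(1)] c0[OF Xl] T(2) by simp
  have oT: "old T" by (rule oldI[OF cll _ T(1)]) (use F l l' Tg in auto)
  have TL: "T \<in> van M (zero_set M X - {p})" using mem_line_X[OF new cl Xl Vl Tl(1)] .
  have TV': "T \<noteq> V'" using Tl V'l by auto
  have cl': "corank M 2 (insert l' F)" using corank_insert3[OF F(1) VX(1) l'(3)] .
  have T': "T \<in> van M (insert l' F)" "V' \<in> van M (insert l' F)" using Tl l' VY by (auto simp: van_insert)
  have TgV: "T g = V' g" using T Vg' V'g by simp
  obtain U where U: "diff M g T V' U" using diff_exists[OF van_cov[OF T'(1)] van_cov[OF T'(2)] TgV Tg] .
  have UF: "U \<in> van M (insert g F)" "Z \<in> van M (insert g F)"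
    using diff_van[OF U Tl(4) VY(1)] diff_g[OF U] ZF Zg by (auto simp: van_insert)
  have Ul: "U l = V' l" "Z l = Y l" "Y l = V' l"
    using diff_left[OF U Tl(2)] diff_left[OF Z l(2)] LY(4)[OF l(1) V'l] by auto
  \<comment> \<open>On the line spanned by \<open>F\<close> and \<open>g\<close>, \<open>f\<close>
    is a multiple of \<open>l\<close> because both vanish at \<open>V\<close>; so \<open>U\<close>
    and \<open>Z\<close> can be compared at \<open>l\<close>.\<close>
  have "V \<in> van M (insert g F)" using VX V0 by (simp add: van_insert)
  moreover have Zl: "Z l \<noteq> 0" using Ul l by simp
  ultimately obtain c where c: "\<And>Q. Q \<in> van M (insert g F) \<Longrightarrow> Q f = c * Q l"
    using line_parallel[OF corank_g _ LX(2) l(3) V0(2) UF(2)] by blast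
  have "U f = Z f" using c[OF UF(1)] c[OF UF(2)] Ul by simp
  then show ?thesis using that[OF TL oT T(2) Tf TV' _ cl' T' U _ c Zl] F l' by blast
qed

text \<open>At \<open>Y\<close> the ratio \<open>f/g\<close> is infinitesimal and at
  \<open>X\<close> it is not, so its absolute value decreases along the edge. If \<open>V\<close> is
  off \<open>f\<close>, this is seen after exchanging \<open>f\<close> and \<open>g\<close>: the
  point at infinity is then close to \<open>V'\<close>.\<close>

lemma into_zero:
  assumes V': "V' f = 0" "V' g \<noteq> 0" and V: "\<not> (V f = 0 \<and> V g \<noteq> 0)"
  shows "Z f = - X f"
proof (cases "V f = 0")
  case True
  then have V0: "V f = 0" "V g = 0" using V by auto
  have ne: "V \<noteq> V'" "V \<noteq> - V'" using V' V0 by auto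
  have "X a \<noteq> 0" using X_off_a[OF V0(1) V'(1) ne] .
  then obtain T U where "T f = X f" "diff M g T V' U" "U f = Z f" using detour[OF V0(2,1) V'(2)] by metis
  then show ?thesis using diff_right[of M g T V' U f] V' by simp
next
  case False
  have ne: "V \<noteq> V'" "V \<noteq> - V'" using False V' by auto
  obtain Z' where E': "edge f g X Y Z'" and sw: "Z f * X f = - (Z' g * X g)" using edge_swap[OF edge] .
  interpret s: plane_edge M p e k F j a f g X Y Z'
    using F j a gp fp E' XF YF Xp Yp a0 by unfold_locales auto
  obtain W where W: "W \<in> van M (insert f (insert a F))" "nz W" "W p = - Z' a" "\<And>x. x \<noteq> p \<Longrightarrow> W x \<noteq> 0 \<Longrightarrow> Z' x = W x"
    using s.infinity[OF VX(1,2) False] by metis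
  note pt = corank_insert2[OF corank_a VA False]
  have V'A: "V' \<in> van M (insert f (insert a F))" using VA' V' by (simp add: van_insert)
  have "W = V'"
  proof (cases "X a = 0")
    case True
    then have "Z' a = Y a" "Y a \<noteq> 0" using diff_left[OF s.Z True] a0 by auto
    then show ?thesis using point_eq[OF pt W(1) V'A, of p] W(3) VY(3) by simp
  next
    case Xa: False
    obtain l where l: "l \<noteq> p" "X l = 0" "V l = 0" "Y l \<noteq> 0" using sep_X[OF new_X[OF Xa]] .
    have V'l: "V' l \<noteq> 0" using V'_l[OF Xa l(2-4) ne] .
    have "W l \<noteq> 0" using point_nz[OF pt W(1,2) V'A LY(2), of l] V'l by simp
    then have "W l = V' l" using W(4)[OF l(1)] diff_left[OF s.Z l(2)] LY(4)[OF l(1) V'l] by simp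
    then show ?thesis using point_eq[OF pt W(1) V'A, of l] V'l by simp
  qed
  then have "Z' g = X g" using W(4)[OF gp] V' Vg' by simp
  moreover have "X g * X g = 1" "X f * X f = 1"
    using Xg Xf covector_range[OF van_cov[OF XF], of g] covector_range[OF van_cov[OF XF], of f] by auto
  ultimately have "Z f * X f = - 1" using sw by simp
  then show ?thesis
    by (cases rule: sign_cases[OF van_cov[OF XF], of f]; cases rule: sign_cases[OF van_cov[OF ZF], of f]) simp_all
qed

text \<open>\<open>T\<close> of \<open>detour\<close> represents the potential of \<open>X\<close>
  and is old, so \<open>\<rho>\<close> compares it with \<open>V'\<close>. For the second claim,
  \<open>f\<close> is a multiple of \<open>l\<close> on the line spanned by \<open>F\<close> and
  \<open>g\<close>, and \<open>Z\<close> is off \<open>l\<close>.\<close>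

lemma potential_off:
  assumes \<rho>: "old_height {} g f \<rho>" and V0: "V g = 0" "V f = 0" and V': "V' g \<noteq> 0" "V' f \<noteq> 0" and Xa: "X a \<noteq> 0"
  shows "sgn (potential g f \<rho> Y - potential g f \<rho> X) = Z f * X g"
    and "Z f = 0 \<Longrightarrow> Q \<in> van M (insert g F) \<Longrightarrow> Q f = 0"
proof -
  obtain T S U c l where D: "T \<in> van M (zero_set M X - {p})" "old T" "T g = X g" "T f = X f" "T \<noteq> V'"
    "p \<notin> S" "corank M 2 S" "T \<in> van M S" "V' \<in> van M S" "diff M g T V' U" "U f = Z f"
    "\<And>Q. Q \<in> van M (insert g F) \<Longrightarrow> Q f = c * Q l" "Z l \<noteq> 0"
    using detour[OF V0 V'(1) Xa] by metis
  have "potential g f \<rho> X = \<rho> T"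
    using potential_line[OF Xc new_X[OF Xa] V0 Xg(2) gp \<rho> D(1-3)] .
  moreover have "potential g f \<rho> Y = \<rho> V'" using V' by (simp add: potential_def)
  moreover have "T g = V' g" "T g \<noteq> 0" using D(3) Vg' V' Xg by auto
  ultimately show "sgn (potential g f \<rho> Y - potential g f \<rho> X) = Z f * X g"
    using old_heightD[OF \<rho> D(6,7,2) LY(3) D(8,9) _ D(5) _ _ D(10)] D(3,11) by simp
  assume "Z f = 0" "Q \<in> van M (insert g F)"
  moreover have "Z \<in> van M (insert g F)" using ZF Zg by (simp add: van_insert)
  ultimately have "c = 0" using D(12)[of Z] D(13) by simp
  then show "Q f = 0" using D(12) \<open>Q \<in> _\<close> by simp
qed

text \<open>The line of \<open>X\<close> is now the one spanned by \<open>F\<close> and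
  \<open>a\<close>, so \<open>V'\<close> lies on it and represents the potential of
  \<open>X\<close>.\<close>

lemma potential_on:
  assumes \<rho>: "old_height {} g f \<rho>" and V0: "V g = 0" "V f = 0" and V': "V' g \<noteq> 0" "V' f \<noteq> 0" and Xa: "X a = 0"
    and new: "\<not> old X"
  shows "potential g f \<rho> Y = potential g f \<rho> X"
proof -
  have "X \<in> van M (insert a F)" using XF Xa by (simp add: van_insert)
  then have "V' \<in> van M (zero_set M X - {p})" using mem_line_X[OF new corank_a _ VA VA'] by blast
  then have "potential g f \<rho> X = \<rho> V'"
    using potential_line[OF Xc new V0 Xg(2) gp \<rho> _ LY(3)] Vg' V' by simp
  then show ?thesis using V' by (simp add: potential_def)
qed

text \<open>Both \<open>f\<close> and \<open>g\<close> contain the line through the two limits, so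
  \<open>f\<close>, \<open>g\<close> and \<open>a\<close> coincide in the plane. The lines of
  \<open>X\<close> and \<open>Y\<close> meet in an old cocircuit \<open>T\<close>, which represents
  both potentials.\<close>

lemma potential_parallel:
  assumes \<rho>: "old_height {} g f \<rho>" and V0: "V g = 0" "V f = 0" "V' g = 0" "V' f = 0" and ne: "V \<noteq> V'" "V \<noteq> - V'"
  shows "potential g f \<rho> Y = potential g f \<rho> X" "Z f = 0"
proof -
  interpret s: plane_edge M p e k F j a g f Y X "- Z" by (rule sym)
  have Xa: "X a \<noteq> 0" using X_off_a[OF V0(2,4) ne] .
  have Ya: "Y a \<noteq> 0" using s.X_off_a[OF V0(4,2) V_swap[OF ne]] .
  note newX = new_X[OF Xa] and newY = new_Y[OF Ya]
  obtain l where l: "l \<noteq> p" "X l = 0" "V l = 0" "Y l \<noteq> 0" using sep_X[OF newX] .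
  obtain l' where l': "l' \<noteq> p" "Y l' = 0" "V' l' = 0" "X l' \<noteq> 0" using s.sep_X[OF newY] .
  have Vl': "V l' \<noteq> 0" using s.V'_l[OF Ya l'(2-4) V_swap[OF ne]] .
  have cl: "corank M 2 (insert l F)" using corank_insert3[OF F(1) YF l(4)] .
  have cl': "corank M 2 (insert l' F)" using corank_insert3[OF F(1) XF l'(4)] .
  have Xl: "X \<in> van M (insert l F)" and Vl: "V \<in> van M (insert l F)" using XF VX l by (auto simp: van_insert)
  have Yl': "Y \<in> van M (insert l' F)" and V'l': "V' \<in> van M (insert l' F)" using YF VY l' by (auto simp: van_insert)
  have cll: "corank M 1 (insert l' (insert l F))" using corank_insert2[OF cl Vl Vl'] .
  obtain T0 where T0: "T0 \<in> van M (insert l' (insert l F))" "nz T0" using point_exists[OF cll] .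
  have T0g: "T0 g \<noteq> 0"
    using point_nz[OF corank_insert2[OF cl Xl Xg(2)], of T0 V l'] T0 Vl V0 Vl' LX(2) by (auto simp: van_insert)
  obtain T where T: "T \<in> van M (insert l' (insert l F))" "T g = X g"
    using van_align[OF T0(1) T0g XF Xg(2)] by metis
  have Tl: "T \<in> van M (insert l F)" "T \<in> van M (insert l' F)" using T by (auto simp: van_insert)
  have Tg: "T g \<noteq> 0" using T Xg by simp
  have oT: "old T" by (rule oldI[OF cll _ T(1)]) (use F l l' Tg in auto)
  have "potential g f \<rho> X = \<rho> T"
    using potential_line[OF Xc newX V0(1,2) Xg(2) gp \<rho> mem_line_X[OF newX cl Xl Vl Tl(1)] oT T(2)] .
  moreover have "potential g f \<rho> Y = \<rho> T"
    using potential_line[OF Yc newY V0(3,4) _ gp \<rho> s.mem_line_X[OF newY cl' Yl' V'l' Tl(2)] oT] T(2) Xg by simp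
  ultimately show "potential g f \<rho> Y = potential g f \<rho> X" by simp
  have "Z a = 0"
  proof (rule ccontr)
    assume "Z a \<noteq> 0"
    then obtain Q where "Q \<in> van M F" "Q a = 0" "Q g \<noteq> 0" using van_exchange[OF ZF Zg _ XF Xg(2)] by blast
    then show False using common_zero_line[OF V0(1,3) ne, of Q] by (simp add: van_insert)
  qed
  then show "Z f = 0" using common_zero_line[OF V0(2,4) ne, of Z] ZF by (simp add: van_insert)
qed

text \<open>The lines of \<open>X\<close> and \<open>Y\<close> meet in the common limit. An element
  \<open>d\<close> avoiding it cuts them in old representatives \<open>T\<close> and
  \<open>T'\<close>. At \<open>l\<close> the differences of \<open>T\<close>, \<open>T'\<close> and
  of \<open>X\<close>, \<open>Y\<close> agree, and \<open>f\<close> is a multiple of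
  \<open>l\<close> on the line spanned by \<open>F\<close> and \<open>g\<close>.\<close>

lemma potential_same:
  assumes \<rho>: "old_height {} g f \<rho>" and V0: "V g = 0" "V f = 0" and eq: "V = V' \<or> V = - V'"
    and new: "\<not> old X" "\<not> old Y"
  shows "sgn (potential g f \<rho> Y - potential g f \<rho> X) = Z f * X g"
proof -
  interpret s: plane_edge M p e k F j a g f Y X "- Z" by (rule sym)
  have V'0: "V' g = 0" "V' f = 0" using V0 eq by auto
  obtain l where l: "l \<noteq> p" "X l = 0" "V l = 0" "Y l \<noteq> 0" using sep_X[OF new(1)] .
  obtain l' where l': "l' \<noteq> p" "Y l' = 0" "V' l' = 0" "X l' \<noteq> 0" using s.sep_X[OF new(2)] .
  have V'l: "V' l = 0" using l eq by auto
  have cl: "corank M 2 (insert l F)" using corank_insert3[OF F(1) YF l(4)] .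
  have cl': "corank M 2 (insert l' F)" using corank_insert3[OF F(1) XF l'(4)] .
  have Xl: "X \<in> van M (insert l F)" and Vl: "V \<in> van M (insert l F)" using XF VX l by (auto simp: van_insert)
  have Yl': "Y \<in> van M (insert l' F)" and V'l': "V' \<in> van M (insert l' F)" using YF VY l' by (auto simp: van_insert)
  obtain d where d: "d \<noteq> p" "V d \<noteq> 0" using not_coloop[OF van_cov[OF VX(1)]] LX(2) by metis
  have V'd: "V' d \<noteq> 0" using d eq by auto
  have cd: "corank M 2 (insert d F)" using corank_insert3[OF F(1) VX(1) d(2)] .
  have pick: "\<exists>T. T \<in> van M (insert d (insert m F)) \<and> old T \<and> T g = X g"
    if m: "m \<noteq> p" "corank M 2 (insert m F)" "B \<in> van M (insert m F)" "B g = 0" "B d \<noteq> 0" "nz B"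
      "C \<in> van M (insert m F)" "C g \<noteq> 0" for m B C
  proof -
    note c1 = corank_insert2[OF m(2,3,5)]
    obtain T0 where T0: "T0 \<in> van M (insert d (insert m F))" "nz T0" using point_exists[OF c1] .
    have T0g: "T0 g \<noteq> 0"
      using point_nz[OF corank_insert2[OF m(2,7,8)], of T0 B d] T0 m by (auto simp: van_insert)
    have oT0: "old T0" by (rule oldI[OF c1 _ T0]) (use F m d in auto)
    show ?thesis using van_align[OF T0(1) T0g XF Xg(2)] oT0 old_uminus[OF oT0] by metis
  qed
  obtain T where T: "T \<in> van M (insert d (insert l F))" "old T" "T g = X g"
    using pick[OF l(1) cl Vl V0(1) d(2) LX(2) Xl Xg(2)] by blast
  have Yg: "Y g \<noteq> 0" using Xg by simp
  obtain T' where T': "T' \<in> van M (insert d (insert l' F))" "old T'" "T' g = X g"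
    using pick[OF l'(1) cl' V'l' V'0(1) V'd LY(2) Yl' Yg] by blast
  have Tm: "T \<in> van M (insert l F)" "T' \<in> van M (insert l' F)" "T \<in> van M (insert d F)" "T' \<in> van M (insert d F)"
    "T \<in> van M F" "T' \<in> van M F" "T l = 0"
    using T T' by (auto simp: van_insert)
  have uX: "potential g f \<rho> X = \<rho> T"
    using potential_line[OF Xc new(1) V0 Xg(2) gp \<rho> mem_line_X[OF new(1) cl Xl Vl Tm(1)] T(2,3)] .
  have uY: "potential g f \<rho> Y = \<rho> T'"
    using potential_line[OF Yc new(2) V'0 Yg gp \<rho> s.mem_line_X[OF new(2) cl' Yl' V'l' Tm(2)] T'(2)] T'(3) Xg by simp
  obtain c1 where c1: "\<And>Q. Q \<in> van M (insert l' F) \<Longrightarrow> Q l = c1 * Q g"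
    using line_parallel[OF cl' V'l' LY(2) V'0(1) V'l Yl' Yg] by blast
  have T'l: "T' l = Y l" using c1[OF Tm(2)] c1[OF Yl'] T'(3) Xg by simp
  have TT': "T \<noteq> T'" using Tm T'l l by auto
  have gg: "T g = T' g" "T g \<noteq> 0" using T T' Xg by auto
  obtain U where U: "diff M g T T' U" using diff_exists[OF van_cov[OF T(1)] van_cov[OF T'(1)] gg] .
  have UF: "U \<in> van M (insert g F)" "Z \<in> van M (insert g F)"
    using diff_van[OF U Tm(5,6)] diff_g[OF U] ZF Zg by (auto simp: van_insert)
  have Ul: "U l = Z l" "Z l \<noteq> 0" using diff_left[OF U Tm(7)] diff_left[OF Z l(2)] T'l l by auto
  have "V \<in> van M (insert g F)" using VX V0 by (simp add: van_insert)
  then obtain c where c: "\<And>Q. Q \<in> van M (insert g F) \<Longrightarrow> Q f = c * Q l"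
    using line_parallel[OF corank_g _ LX(2) l(3) V0(2) UF(2) Ul(2)] by blast
  have "U f = Z f" using c[OF UF(1)] c[OF UF(2)] Ul by simp
  moreover have "p \<notin> insert d F" using d F by auto
  ultimately show ?thesis
    using old_heightD[OF \<rho> _ cd T(2) T'(2) Tm(3,4) _ TT' gg U] uX uY T(3) by simp
qed

text \<open>On the line spanned by \<open>F\<close> and \<open>g\<close>, the elements \<open>f\<close> and \<open>a\<close> are parallel if the limits \<open>V\<close>, \<open>V'\<close> have
  the same height; all slopes can then be read off at \<open>a\<close>.\<close>

lemma slope_parallel:
  assumes W: "W \<in> van M F" "nz W" "W a = 0" "W g = 0" "W f = 0" and U: "U \<in> van M F" "U a = 0" "U g \<noteq> 0"
  obtains c where "c \<in> {-1, 0, 1}" "\<And>Q. Q \<in> van M (insert g F) \<Longrightarrow> Q f = c * Q a"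
proof -
  obtain T where T: "T \<in> van M F" "T g = 0" "T a \<noteq> 0"
    using a0 van_exchange[OF U XF] van_exchange[OF U YF] by metis
  have WS: "W \<in> van M (insert g F)" and TS: "T \<in> van M (insert g F)" using W T by (auto simp: van_insert)
  show ?thesis using line_parallel[OF corank_g WS W(2,3,5) TS T(3)] that by metis
qed

lemma direction_plane:
  assumes new: "\<not> old X" and Vg: "V g \<noteq> 0"
  shows "direction g X \<in> van M (insert g F)" "direction g X a = X a"
proof -
  note D = direction_props[OF Xc new gp Vg]
  show "direction g X \<in> van M (insert g F)" using diff_van[OF D(1) VX(1) XF] D(3) by (simp add: van_insert)
  show "direction g X a = X a" using diff_left[OF D(1) VX(2)] .
qed

lemma slope_eq:
  assumes c: "\<And>Q. Q \<in> van M (insert g F) \<Longrightarrow> Q f = c * Q a" and V: "V g = 0 \<Longrightarrow> X a = 0"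
  shows "slope g f X = c * X a * X g"
proof (cases "old X \<or> V g = 0")
  case True
  then have "X a = 0" using new_X V by blast
  then show ?thesis using True by (simp add: slope_def)
next
  case False
  then show ?thesis using direction_plane c[of "direction g X"] by (simp add: slope_def)
qed

end

section \<open>Comparison of potentials and slopes across an edge on the new element\<close>

context plane_edge
begin

lemma new_of_limit: "V g = 0 \<Longrightarrow> \<not> old X"
  using Xg limit_old by auto

lemma potential_edge:
  assumes \<rho>: "old_height {} g f \<rho>" and adm: "admissible g f X Y" and ne: "potential g f \<rho> X \<noteq> potential g f \<rho> Y"
  shows "sgn (potential g f \<rho> Y - potential g f \<rho> X) = Z f * X g"
proof -
  interpret s: plane_edge M p e k F j a g f Y X "- Z" by (rule sym)
  have A: "V g = 0 \<Longrightarrow> V f = 0" "V' g = 0 \<Longrightarrow> V' f = 0" "(V f = 0 \<and> V g \<noteq> 0) \<longleftrightarrow> (V' f = 0 \<and> V' g \<noteq> 0)"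
    using adm by (auto simp: admissible_def)
  consider "V g \<noteq> 0" "V' g \<noteq> 0" | "V g = 0" "V' g \<noteq> 0" | "V g \<noteq> 0" "V' g = 0" | "V g = 0" "V' g = 0" by blast
  then show ?thesis
  proof cases
    case 1
    then have f: "V f \<noteq> 0" "V' f \<noteq> 0" using A ne by (auto simp: potential_def)
    then have u: "potential g f \<rho> X = \<rho> V" "potential g f \<rho> Y = \<rho> V'" using 1 by (simp_all add: potential_def)
    then have VV': "V \<noteq> V'" using ne by auto
    obtain W where W: "diff M g V V' W" "\<And>x. x \<noteq> p \<Longrightarrow> W x \<noteq> 0 \<Longrightarrow> Z x = W x"
      using limit_edge[OF 1 VV'] by metis
    have gg: "V g = V' g" using Vg Vg' 1 by simp
    have pA: "p \<notin> insert a F" using F ap by auto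
    have "sgn (\<rho> V' - \<rho> V) = W f * V g"
      using old_heightD[OF \<rho> pA corank_a LX(3) LY(3) VA VA' _ VV' gg 1(1) W(1)] by simp
    moreover from this have "W f \<noteq> 0" using ne u by (auto simp: sgn_if split: if_splits)
    ultimately show ?thesis using u W(2)[OF fp] Vg 1 by simp
  next
    case 2
    then have f: "V f = 0" "V' f \<noteq> 0" using A by auto
    show ?thesis
    proof (cases "X a = 0")
      case True
      then show ?thesis using potential_on[OF \<rho> 2(1) f(1) 2(2) f(2) True new_of_limit[OF 2(1)]] ne by simp
    next
      case False
      then show ?thesis using potential_off(1)[OF \<rho> 2(1) f(1) 2(2) f(2)] by simp
    qed
  next
    case 3
    then have f: "V' f = 0" "V f \<noteq> 0" using A by auto
    have "sgn (potential g f \<rho> X - potential g f \<rho> Y) = (- Z) f * Y g"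
    proof (cases "Y a = 0")
      case True
      then show ?thesis using s.potential_on[OF \<rho> 3(2) f(1) 3(1) f(2) True s.new_of_limit[OF 3(2)]] ne by simp
    next
      case False
      then show ?thesis using s.potential_off(1)[OF \<rho> 3(2) f(1) 3(1) f(2)] by simp
    qed
    then show ?thesis using Xg sgn_minus[of "potential g f \<rho> X - potential g f \<rho> Y"] by simp
  next
    case 4
    then have f: "V' f = 0" "V f = 0" using A by auto
    show ?thesis
    proof (cases "V = V' \<or> V = - V'")
      case True
      then show ?thesis using potential_same[OF \<rho> 4(1) f(2) True new_of_limit[OF 4(1)] s.new_of_limit[OF 4(2)]] by simp
    next
      case False
      then show ?thesis using potential_parallel(1)[OF \<rho> 4(1) f(2) 4(2) f(1)] ne by simp
    qed
  qed
qed

text \<open>Both directions subtract the same limit, so they differ by the difference of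
  \<open>X\<close> and \<open>Y\<close>. They agree at \<open>p\<close>, where each is the negative
  of that limit.\<close>

lemma direction_edge:
  assumes new: "\<not> old X" "\<not> old Y" and g: "V g \<noteq> 0" and eq: "V = V'"
  shows "diff M p (direction g X) (direction g Y) Z" "direction g X \<noteq> direction g Y"
proof -
  interpret s: plane_edge M p e k F j a g f Y X "- Z" by (rule sym)
  have g': "V' g \<noteq> 0" using g eq by simp
  note D = direction_props[OF Xc new(1) gp g] and D' = direction_props[OF Yc new(2) gp g']
  have DF: "direction g X \<in> van M (insert g F)" "direction g Y \<in> van M (insert g F)"
    using direction_plane[OF new(1) g] s.direction_plane[OF new(2) g'] by auto
  have pp: "direction g X p = direction g Y p" "direction g X p \<noteq> 0"
    using D(5) D'(5) eq limit_new_props(4)[OF Xc new(1)] by auto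
  obtain l where l: "l \<noteq> p" "X l = 0" "V l = 0" "Y l \<noteq> 0" using sep_X[OF new(1)] .
  have Dl: "direction g X l = 0" "direction g Y l = Y l"
    using diff_left[OF D(1) l(3)] diff_left[OF D'(1), of l] l eq by auto
  then show "direction g X \<noteq> direction g Y" using l by auto
  obtain R where R: "diff M p (direction g X) (direction g Y) R"
    using diff_exists[OF van_cov[OF DF(1)] van_cov[OF DF(2)] pp] .
  have "R \<in> van M (insert p (insert g F))" "Z \<in> van M (insert p (insert g F))"
    using diff_van[OF R DF] diff_g[OF R] ZF Zg Zp by (auto simp: van_insert)
  moreover have "R l = Z l" "R l \<noteq> 0" using diff_left[OF R Dl(1)] Dl diff_left[OF Z l(2)] l by auto
  ultimately have "R = Z" using point_eq[OF corank_insert2[OF corank_g DF(1) pp(2)]] by blast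
  then show "diff M p (direction g X) (direction g Y) Z" using R by simp
qed

lemma limits_undirected:
  assumes \<rho>: "old_height {} g f \<rho>" and adm: "admissible g f X Y" and eq: "potential g f \<rho> X = potential g f \<rho> Y"
    and g: "V g \<noteq> 0" "V' g \<noteq> 0" and W: "diff M g V V' W" and ne: "V \<noteq> V'"
  shows "W f = 0"
proof -
  consider "V f = 0" "V' f = 0" | "V f \<noteq> 0" "V' f \<noteq> 0" using adm g by (auto simp: admissible_def)
  then show ?thesis
  proof cases
    case 1
    then show ?thesis using diff_left[OF W 1(1)] by simp
  next
    case 2
    have gg: "V g = V' g" using Vg Vg' g by simp
    have pA: "p \<notin> insert a F" using F ap by auto
    have "sgn (\<rho> V' - \<rho> V) = W f * V g"
      using old_heightD[OF \<rho> pA corank_a LX(3) LY(3) VA VA' _ ne gg g(1) W] by simp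
    moreover have "\<rho> V' = \<rho> V" using eq g 2 by (simp add: potential_def)
    ultimately show ?thesis using g by simp
  qed
qed

lemma slope_edge_parallel:
  assumes c: "c \<in> {-1, 0, 1}" "\<And>Q. Q \<in> van M (insert g F) \<Longrightarrow> Q f = c * Q a"
    and X0: "V g = 0 \<Longrightarrow> X a = 0" and Y0: "V' g = 0 \<Longrightarrow> Y a = 0"
  shows "slope g f X \<noteq> slope g f Y \<Longrightarrow> sgn (slope g f Y - slope g f X) = Z f * X g"
    and "slope g f X = 0 \<Longrightarrow> slope g f Y = 0 \<Longrightarrow> Z f = 0"
proof -
  interpret s: plane_edge M p e k F j a g f Y X "- Z" by (rule sym)
  have sl: "slope g f X = c * X a * X g" "slope g f Y = c * Y a * X g"
    using slope_eq[OF c(2) X0] s.slope_eq[OF c(2) Y0] Xg by auto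
  have Zf: "Z f = c * Z a" using c(2)[of Z] ZF Zg by (simp add: van_insert)
  have cov: "X \<in> covectors M" "Y \<in> covectors M" using XF YF van_cov by auto
  have Xgs: "X g = 1 \<or> X g = -1" using Xg covector_range[OF cov(1), of g] by auto
  show "sgn (slope g f Y - slope g f X) = Z f * X g" if ne: "slope g f X \<noteq> slope g f Y"
  proof -
    have "X a \<noteq> Y a" using ne sl by auto
    then have Za: "Z a = sgn (Y a - X a)" using sgn_diff[OF Z cov] by simp
    have "slope g f Y - slope g f X = c * X g * (Y a - X a)" using sl by (simp add: algebra_simps)
    then have "sgn (slope g f Y - slope g f X) = sgn c * sgn (X g) * sgn (Y a - X a)" by (simp add: sgn_mult)
    moreover have "sgn c = c" "sgn (X g) = X g" using c(1) Xgs by auto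
    ultimately show ?thesis using Za Zf by simp
  qed
  show "Z f = 0" if "slope g f X = 0" "slope g f Y = 0"
  proof -
    have "c = 0" using that sl a0 Xg by auto
    then show ?thesis using Zf by simp
  qed
qed

lemma slope_edge:
  assumes \<rho>: "old_height {} g f \<rho>" and adm: "admissible g f X Y" and eq: "potential g f \<rho> X = potential g f \<rho> Y"
  shows "(slope g f X \<noteq> slope g f Y \<longrightarrow> sgn (slope g f Y - slope g f X) = Z f * X g) \<and>
    (slope g f X = 0 \<and> slope g f Y = 0 \<longrightarrow> Z f = 0)"
proof -
  interpret s: plane_edge M p e k F j a g f Y X "- Z" by (rule sym)
  have A: "V g = 0 \<Longrightarrow> V f = 0" "V' g = 0 \<Longrightarrow> V' f = 0" "(V f = 0 \<and> V g \<noteq> 0) \<longleftrightarrow> (V' f = 0 \<and> V' g \<noteq> 0)"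
    using adm by (auto simp: admissible_def)
  consider "V g \<noteq> 0" "V' g \<noteq> 0" "V = V'" | "V g \<noteq> 0" "V' g \<noteq> 0" "V \<noteq> V'" |
    "V g = 0" "V' g \<noteq> 0" | "V g \<noteq> 0" "V' g = 0" | "V g = 0" "V' g = 0" by blast
  then show ?thesis
  proof cases
    case 1
    \<comment> \<open>One vertex is off \<open>a\<close>, hence new, and its limit is off
      \<open>p\<close>; an old vertex here would be its own limit and lie on
      \<open>p\<close>.\<close>
    have new: "\<not> old X" "\<not> old Y"
      using a0 new_X new_Y limit_new_props(4)[OF Xc] limit_new_props(4)[OF Yc] limit_old[of X] limit_old[of Y] 1(3) Xp Yp by metis+
    note D = direction_edge[OF new 1(1,3)]
    have cov: "direction g X \<in> covectors M" "direction g Y \<in> covectors M"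
      using direction_props(2)[OF Xc new(1) gp 1(1)] direction_props(2)[OF Yc new(2) gp 1(2)] van_cov by auto
    have sl: "slope g f X = direction g X f * X g" "slope g f Y = direction g Y f * X g"
      using new 1 Xg by (auto simp: slope_def)
    have Xgs: "X g = 1 \<or> X g = -1" using Xg covector_range[OF van_cov[OF XF], of g] by auto
    show ?thesis
    proof (intro conjI impI)
      assume "slope g f X \<noteq> slope g f Y"
      then have "Z f = sgn (direction g Y f - direction g X f)" using sgn_diff[OF D(1) cov] sl by auto
      moreover have "slope g f Y - slope g f X = X g * (direction g Y f - direction g X f)" using sl by (simp add: algebra_simps)
      ultimately show "sgn (slope g f Y - slope g f X) = Z f * X g" using Xgs by (auto simp: sgn_mult)
    next
      assume "slope g f X = 0 \<and> slope g f Y = 0"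
      then have "direction g X f = 0" "direction g Y f = 0" using sl Xg by auto
      then show "Z f = 0" using diff_left[OF D(1)] by simp
    qed
  next
    case 2
    obtain W where W: "diff M g V V' W" "W \<in> van M (insert g (insert a F))" "nz W" using limit_edge[OF 2] by metis
    have Wf: "W f = 0" using limits_undirected[OF \<rho> adm eq 2(1,2) W(1) 2(3)] .
    have "W \<in> van M F" "W a = 0" "W g = 0" using W(2) by (auto simp: van_insert)
    then obtain c where "c \<in> {-1, 0, 1}" "\<And>Q. Q \<in> van M (insert g F) \<Longrightarrow> Q f = c * Q a"
      using slope_parallel[OF _ W(3) _ _ Wf VX(1,2) 2(1)] by blast
    then show ?thesis using slope_edge_parallel[of c] 2 by blast
  next
    case 3
    then have f: "V f = 0" "V' f \<noteq> 0" using A by auto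
    show ?thesis
    proof (cases "X a = 0")
      case True
      obtain c where "c \<in> {-1, 0, 1}" "\<And>Q. Q \<in> van M (insert g F) \<Longrightarrow> Q f = c * Q a"
        using slope_parallel[OF VX(1) LX(2) VX(2) 3(1) f(1) VY(1,2) 3(2)] by blast
      then show ?thesis using slope_edge_parallel[of c] 3 True by blast
    next
      case False
      note off = potential_off[OF \<rho> 3(1) f(1) 3(2) f(2) False]
      \<comment> \<open>This makes \<open>f\<close> contain the line spanned by \<open>F\<close> and
        \<open>g\<close>, on which the direction of \<open>Y\<close> lies.\<close>
      have Zf: "Z f = 0" using off(1) eq Xg by simp
      have "slope g f Y = 0"
        using off(2)[OF Zf] s.direction_plane(1) by (simp add: slope_def)
      moreover have "slope g f X = 0" using 3 by (simp add: slope_def)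
      ultimately show ?thesis using Zf by simp
    qed
  next
    case 4
    then have f: "V' f = 0" "V f \<noteq> 0" using A by auto
    show ?thesis
    proof (cases "Y a = 0")
      case True
      obtain c where "c \<in> {-1, 0, 1}" "\<And>Q. Q \<in> van M (insert g F) \<Longrightarrow> Q f = c * Q a"
        using slope_parallel[OF VY(1) LY(2) VY(2) 4(2) f(1) VX(1,2) 4(1)] by blast
      then show ?thesis using slope_edge_parallel[of c] 4 True by blast
    next
      case False
      note off = s.potential_off[OF \<rho> 4(2) f(1) 4(1) f(2) False]
      have Zf: "Z f = 0" using off(1) eq Xg by simp
      have "slope g f X = 0"
        using off(2) Zf direction_plane(1) by (simp add: slope_def)
      moreover have "slope g f Y = 0" using 4 by (simp add: slope_def)
      ultimately show ?thesis using Zf by simp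
    qed
  next
    case 5
    then have f: "V' f = 0" "V f = 0" using A by auto
    have "slope g f X = 0" "slope g f Y = 0" using 5 by (simp_all add: slope_def)
    moreover have "Z f = 0"
    proof (cases "V = V' \<or> V = - V'")
      case True
      then show ?thesis
        using potential_same[OF \<rho> 5(1) f(2) True new_of_limit[OF 5(1)] s.new_of_limit[OF 5(2)]] eq Xg by simp
    next
      case False
      then show ?thesis using potential_parallel(2)[OF \<rho> 5(1) f(2) 5(2) f(1)] by blast
    qed
    ultimately show ?thesis by simp
  qed
qed

text \<open>\<open>r\<close> is the change of \<open>g/p\<close> between the limits. If they agree,
  only \<open>f/p\<close> at the direction can move, and \<open>Z\<close> is its change. If they
  differ, \<open>f\<close> is a multiple of \<open>a\<close> on the line spanned by \<open>F\<close>
  and \<open>g\<close>; equal slopes give \<open>X a = Y a\<close>, so the limits agree at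
  \<open>p\<close>, and \<open>diff_swap\<close> turns the comparison at \<open>g\<close> into one
  at \<open>p\<close>.\<close>

lemma steep_edge:
  assumes \<rho>: "old_height {} g f \<rho>" and adm: "admissible g f X Y" and eq: "potential g f \<rho> X = potential g f \<rho> Y"
    and h: "slope g f X = slope g f Y" "slope g f X \<noteq> 0"
  shows "\<exists>r. oriented_step g V V' r \<and> (V = V' \<longrightarrow> oriented_step f (direction g X) (direction g Y) (Z f)) \<and>
    (V \<noteq> V' \<longrightarrow> Z f * X g = - (slope g f X * X g * r)) \<and> (V \<noteq> V' \<longrightarrow> r = 0 \<longrightarrow> oriented_step f (direction g X) (direction g Y) 0)"
proof -
  interpret s: plane_edge M p e k F j a g f Y X "- Z" by (rule sym)
  have new: "\<not> old X" "\<not> old Y" and g: "V g \<noteq> 0" "V' g \<noteq> 0" using h by (auto simp: slope_def)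
  note D = direction_props[OF Xc new(1) gp g(1)] and D' = direction_props[OF Yc new(2) gp g(2)]
  have sl: "slope g f X = direction g X f * X g" "slope g f Y = direction g Y f * X g" using new g Xg by (auto simp: slope_def)
  have Df: "direction g X f = direction g Y f" using h sl Xg by simp
  have DF: "direction g X \<in> van M (insert g F)" "direction g Y \<in> van M (insert g F)"
    using direction_plane[OF new(1) g(1)] s.direction_plane[OF new(2) g(2)] by auto
  have pS: "p \<notin> insert g F" using F gp by auto
  have gg: "V g = V' g" using Vg Vg' g by simp
  show ?thesis
  proof (cases "V = V'")
    case True
    have "oriented_step g V V' 0" using True by (simp add: oriented_step_def)
    moreover have "oriented_step f (direction g X) (direction g Y) (Z f)"
      using direction_edge[OF new g(1) True] DF pS corank_g D(5) D'(5) True Df unfolding oriented_step_def by auto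
    ultimately show ?thesis using True by blast
  next
    case False
    obtain W where W: "diff M g V V' W" "W \<in> van M (insert g (insert a F))" "nz W" "W p = - Z a"
      using limit_edge[OF g False] by metis
    have Wf: "W f = 0" using limits_undirected[OF \<rho> adm eq g W(1) False] .
    have "W \<in> van M F" "W a = 0" "W g = 0" using W(2) by (auto simp: van_insert)
    then obtain c where c: "c \<in> {-1, 0, 1}" "\<And>Q. Q \<in> van M (insert g F) \<Longrightarrow> Q f = c * Q a"
      using slope_parallel[OF _ W(3) _ _ Wf VX(1,2) g(1)] by blast
    have Zf: "Z f = c * Z a" using c(2)[of Z] ZF Zg by (simp add: van_insert)
    have DX: "direction g X f = c * X a" "direction g Y f = c * Y a"
      using c(2)[OF DF(1)] c(2)[OF DF(2)] direction_plane(2)[OF new(1) g(1)] s.direction_plane(2)[OF new(2) g(2)] by auto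
    have nzs: "X a \<noteq> 0" "c \<noteq> 0" using h sl DX by auto
    have XY: "X a = Y a" using Df DX nzs by simp
    have Vp: "V p = - X a" "V' p = - X a" using VX(3) VY(3) nzs XY by auto
    have pp: "V p = V' p" "V p \<noteq> 0" using Vp nzs by auto
    have sq: "X a * X a = 1" "V g * V g = 1"
      using nzs g covector_range[OF van_cov[OF XF], of a] covector_range[OF van_cov[OF VX(1)], of g] by auto
    obtain R where R: "diff M p V V' R" using diff_exists[OF van_cov[OF VX(1)] van_cov[OF VY(1)] pp] .
    have sw: "W p * V p = - (R g * V g)"
      using diff_swap[OF corank_a old_cocircuit[OF LX(3)] VA old_cocircuit[OF LY(3)] VA' False gg g(1) pp W(1) R] .
    have step: "oriented_step g V V' (R g)"
      using F ap corank_a VA VA' R pp gg False unfolding oriented_step_def by auto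
    have ZaR: "Z a * X a = - (R g * X g)" using sw W(4) Vp Vg g by simp
    have "Z f = c * Z a * (X a * X a)" using Zf sq by simp
    also have "\<dots> = (c * X a) * (Z a * X a)" by (simp add: algebra_simps)
    finally have "Z f = - (direction g X f * (R g * X g))" using ZaR DX by simp
    then have main: "Z f * X g = - (slope g f X * X g * R g)" using sl by (simp add: algebra_simps)
    have "oriented_step f (direction g X) (direction g Y) 0" if R0: "R g = 0"
    proof (cases "direction g X = direction g Y")
      case True
      then show ?thesis by (simp add: oriented_step_def)
    next
      case DD: False
      have dp: "direction g X p = direction g Y p" "direction g X p \<noteq> 0" using D(5) D'(5) pp by auto
      obtain Q where Q: "diff M p (direction g X) (direction g Y) Q"
        using diff_exists[OF van_cov[OF DF(1)] van_cov[OF DF(2)] dp] .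
      have dn: "direction g X \<noteq> - direction g Y" using dp by auto
      have Qn: "nz Q" using diff_nz[OF old_cocircuit[OF D(6)] old_cocircuit[OF D'(6)] DD dn Q] .
      have "Q \<in> van M (insert p (insert g F))" "Z \<in> van M (insert p (insert g F))"
        using diff_van[OF Q DF] diff_g[OF Q] ZF Zg Zp by (auto simp: van_insert)
      moreover have "Z f = 0" using main R0 Xg by simp
      ultimately have "Q f = 0"
        using point_nz[OF corank_insert2[OF corank_g DF(1) dp(2)], of Q Z f] Qn Zn by simp
      then show ?thesis using DF pS corank_g dp Df Q DD unfolding oriented_step_def by auto
    qed
    then show ?thesis using step main False by blast
  qed
qed

end

section \<open>Cycles in the extension\<close>

context lex_extended
begin

text \<open>For a fixed sign of \<open>f\<close>, cocircuits with the same nonzero sign at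
  \<open>g\<close> are ordered by \<open>- \<rho>\<close>, by \<open>diff_swap\<close>; those with
  different signs at \<open>g\<close> are ordered by the sign of \<open>g/f\<close>.\<close>

lemma old_height_swap:
  assumes \<rho>: "old_height A g f \<rho>"
  obtains \<rho>' where "old_height A f g \<rho>'"
proof -
  define B where "B = (\<Sum>X \<in> covectors M. \<bar>\<rho> X\<bar>)"
  have B: "\<bar>\<rho> X\<bar> \<le> B" if "X \<in> covectors M" for X
    unfolding B_def by (rule member_le_sum[OF that]) (use finite_covectors in auto)
  \<comment> \<open>\<open>B\<close> bounds \<open>\<bar>\<rho>\<bar>\<close>, so with weight
    \<open>2 * B + 1\<close> the sign of \<open>g/f\<close> outweighs every value of
    \<open>\<rho>\<close>.\<close>
  define \<rho>' where "\<rho>' X = (if X g = 0 then 0 else (2 * B + 1) * (X g * X f) - \<rho> X)" for X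
  have "old_height A f g \<rho>'"
    unfolding old_height_def
  proof (intro allI impI)
    fix S X Y Z assume S: "p \<notin> S" "corank M 2 S" and o: "old X" "old Y" and XS: "X \<in> van M S" "Y \<in> van M S"
      and A: "\<forall>a \<in> A. X a = 0 \<and> Y a = 0" and ne: "X \<noteq> Y" and f: "X f = Y f" "X f \<noteq> 0" and Z: "diff M f X Y Z"
    have cov: "X \<in> covectors M" "Y \<in> covectors M" using o old_cov by auto
    have Xf: "X f = 1 \<or> X f = -1" using f covector_range[OF cov(1), of f] by auto
    have b: "- B \<le> \<rho> X" "\<rho> X \<le> B" "- B \<le> \<rho> Y" "\<rho> Y \<le> B" using B[OF cov(1)] B[OF cov(2)] by auto
    show "sgn (\<rho>' Y - \<rho>' X) = Z g * X f"
    proof (cases "X g = Y g")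
      case True
      show ?thesis
      proof (cases "X g = 0")
        case True
        then show ?thesis using \<open>X g = Y g\<close> diff_left[OF Z True] by (simp add: \<rho>'_def)
      next
        case g0: False
        obtain Z' where Z': "diff M g X Y Z'" using diff_exists[OF cov True g0] .
        have "sgn (\<rho> Y - \<rho> X) = Z' f * X g" using old_heightD[OF \<rho> S o XS _ ne True g0 Z'] A by blast
        moreover have "Z' f * X f = - (Z g * X g)"
          using diff_swap[OF S(2) old_cocircuit[OF o(1)] XS(1) old_cocircuit[OF o(2)] XS(2) ne True g0 f Z' Z] .
        moreover have Xg: "X g = 1 \<or> X g = -1" using g0 covector_range[OF cov(1), of g] by auto
        ultimately have "sgn (\<rho> Y - \<rho> X) = - (Z g * X f)" using Xf by auto
        moreover have "\<rho>' Y - \<rho>' X = - (\<rho> Y - \<rho> X)" using True g0 f by (simp add: \<rho>'_def)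
        ultimately show ?thesis using sgn_minus[of "\<rho> Y - \<rho> X"] by simp
      qed
    next
      case False
      then have "Z g = sgn (Y g - X g)" using sgn_diff[OF Z cov] by simp
      then show ?thesis
        using Xf f(1) b False
        by (cases rule: sign_cases[OF cov(1), of g]; cases rule: sign_cases[OF cov(2), of g]) (auto simp: \<rho>'_def sgn_if)
    qed
  qed
  then show ?thesis by (rule that)
qed

text \<open>What matters is whether \<open>p\<close> is needed to span the common line. If not, the
  edge lies on an original line. If so, the line lies on \<open>p\<close> and the other common zeros
  \<open>F\<close> span only a plane; the first element not containing this plane is not in
  \<open>F\<close>, so it does not vanish at both vertices.\<close>

lemma edge_type:
  assumes E: "edge g f X Y Z" and gp: "g \<noteq> p" and fp: "f \<noteq> p"
  obtains (both) S where "old X" "old Y" "p \<notin> S" "corank M 2 S" "X \<in> van M S" "Y \<in> van M S"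
  | (left) "old X" "\<not> old Y" "X \<in> van M (zero_set M Y - {p})"
  | (right) "\<not> old X" "old Y" "Y \<in> van M (zero_set M X - {p})"
  | (plane) F j where "plane_edge M p e k F j (e j) g f X Y Z"
proof -
  have com: "comodular M X Y" using E by (simp add: edge_def)
  note C = comodularD[OF com]
  let ?P = "zero_set M X \<inter> zero_set M Y"
  have Pg: "?P \<subseteq> ground M" by (auto simp: zero_set_def)
  \<comment> \<open>For a new \<open>B\<close> the set \<open>zero_set M B - {p}\<close> has corank
    2, as \<open>S\<close> has, so both define the same line.\<close>
  have extend: "A \<in> van M (zero_set M B - {p})"
    if A: "A \<in> cocircuits M" and B: "B \<in> cocircuits M" "\<not> old B" and S: "corank M 2 S" "S \<subseteq> zero_set M B - {p}" "A \<in> van M S" for A B S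
  proof -
    have "A x = 0" if x: "x \<in> zero_set M B - {p}" for x
    proof (rule ccontr)
      assume "A x \<noteq> 0"
      then have "corank M 1 (insert x S)" using corank_insert2[OF S(1,3)] by blast
      moreover have "rank_of M (insert x S) \<le> rank_of M (zero_set M B - {p})"
        by (rule rank_mono) (use x S in \<open>auto simp: zero_set_def\<close>)
      ultimately show False using new_line(2)[OF B] by (simp add: corank_def)
    qed
    then show ?thesis using cocircuit_cov[OF A] by (auto simp: van_def)
  qed
  show ?thesis
  proof (cases "p \<in> ?P")
    case False
    consider "old X" "old Y" | "old X" "\<not> old Y" | "\<not> old X" "old Y" | "\<not> old X" "\<not> old Y" by blast
    then show ?thesis
    proof cases
      case 1 then show ?thesis using both False C by blast
    next
      case 2
      then show ?thesis using left extend[OF C(1,2) 2(2) C(5) _ C(6)] False by blast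
    next
      case 3
      then show ?thesis using right extend[OF C(2,1) 3(1) C(5) _ C(7)] False by blast
    next
      case 4
      then have "X p = 0" "Y p = 0" using old_p0 C by blast+
      then show ?thesis using False p_ground by (auto simp: zero_set_def)
    qed
  next
    case True
    then have Xp: "X p = 0" "Y p = 0" by (auto simp: zero_set_def)
    define F where "F = ?P - {p}"
    have Fg: "F \<subseteq> ground M" and pF: "p \<notin> F" and P: "?P = insert p F" using Pg True by (auto simp: F_def)
    have XF: "X \<in> van M F" "Y \<in> van M F" using C(6,7) by (auto simp: F_def van_def)
    show ?thesis
    proof (cases "p \<in> cl M F")
      case pcl: True
      then have cF: "corank M 2 F" using rank_insert[OF Fg p_ground] C(5) Fg P by (simp add: corank_def)
      have oldA: "old A" if A: "A \<in> cocircuits M" "F \<subseteq> zero_set M A - {p}" "A p = 0" for A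
      proof -
        have g: "zero_set M A - {p} \<subseteq> ground M" by (auto simp: zero_set_def)
        have z: "zero_set M A = insert p (zero_set M A - {p})" using A p_ground by (auto simp: zero_set_def)
        have "p \<in> cl M (zero_set M A - {p})"
          using cl_subset_cl[OF g, of F] cl_extensive[OF g] A(2) pcl by blast
        then show ?thesis using rank_insert[OF g p_ground] z cocircuit_corank[OF A(1)] A(1) g by (simp add: old_def corank_def)
      qed
      have "old X" "old Y" using oldA[OF C(1)] oldA[OF C(2)] Xp by (auto simp: F_def)
      then show ?thesis using both[of F] cF pF XF by blast
    next
      case pcl: False
      then have cF: "corank M 3 F" using rank_insert[OF Fg p_ground] C(5) Fg P by (simp add: corank_def)
      obtain T where "T \<in> van M F" "T p \<noteq> 0" using not_clE[OF Fg p_ground pcl] .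
      then have ex: "\<exists>j. j \<in> {1..k} \<and> (\<exists>T \<in> van M F. T (e j) \<noteq> 0)" using p_not_spanned by metis
      define j where "j = (LEAST j. j \<in> {1..k} \<and> (\<exists>T \<in> van M F. T (e j) \<noteq> 0))"
      have j: "j \<in> {1..k} \<and> (\<exists>T \<in> van M F. T (e j) \<noteq> 0)" unfolding j_def by (rule LeastI_ex[OF ex])
      have less: "\<forall>i \<in> {1..k}. i < j \<longrightarrow> (\<forall>T \<in> van M F. T (e i) = 0)"
        using not_less_Least[of _ "\<lambda>j. j \<in> {1..k} \<and> (\<exists>T \<in> van M F. T (e j) \<noteq> 0)"] unfolding j_def by blast
      have "e j \<notin> F" using j by (auto simp: van_def)
      then have "X (e j) \<noteq> 0 \<or> Y (e j) \<noteq> 0" using e_ground[of j] j by (auto simp: F_def zero_set_def)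
      then have "plane_edge M p e k F j (e j) g f X Y Z"
        using cF pF j less gp fp E XF Xp by unfold_locales auto
      then show ?thesis by (rule plane)
    qed
  qed
qed

lemma line_edge_limit:
  assumes E: "edge g f X Y Z" and o: "old X" "\<not> old Y" and XS: "X \<in> van M (zero_set M Y - {p})" and gp: "g \<noteq> p"
    and g: "limit Y g \<noteq> 0" and ne: "limit Y \<noteq> X"
  shows "diff M g X (limit Y) Z"
proof -
  let ?S = "zero_set M Y - {p}"
  have E': "comodular M X Y" "X g = Y g" "X g \<noteq> 0" "diff M g X Y Z" using E by (auto simp: edge_def)
  have Y: "Y \<in> cocircuits M" using comodularD[OF E'(1)] by blast
  note N = new_line[OF Y o(2)] and L = limit_props[OF Y]
  have gg: "X g = limit Y g" using E' L(4)[OF gp g] by simp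
  have ne': "X \<noteq> limit Y" "X \<noteq> - limit Y" using ne gg E' by auto
  obtain W where W: "diff M g X (limit Y) W" using diff_exists[OF van_cov[OF XS] van_cov[OF L(1)] gg E'(3)] .
  obtain x where x: "x \<noteq> p" "X x = 0" "limit Y x \<noteq> 0" using old_sep[OF o(1) van_cov[OF L(1)] L(2) ne'] .
  have "W x = Z x" "W x \<noteq> 0" using diff_left[OF W x(2)] diff_left[OF E'(4) x(2)] L(4)[OF x(1,3)] x by auto
  moreover have "W \<in> van M (insert g ?S)" "Z \<in> van M (insert g ?S)"
    using diff_van[OF W XS L(1)] diff_g[OF W] diff_van[OF E'(4) XS N(4)] diff_g[OF E'(4)] unfolding van_insert by auto
  ultimately have "W = Z" using point_eq[OF corank_insert2[OF N(2) XS E'(3)]] by blast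
  then show ?thesis using W by simp
qed

text \<open>All points involved lie on one original line. If the limit of \<open>Y\<close> is
  \<open>X\<close>, the potential stays and \<open>Z\<close> is the direction of \<open>Y\<close>,
  so the slope records it. Otherwise the potential records \<open>Z f\<close>, and
  \<open>Z f = 0\<close> makes \<open>f/g\<close> constant on the line.\<close>

lemma line_edge:
  assumes E: "edge g f X Y Z" and o: "old X" "\<not> old Y" and XS: "X \<in> van M (zero_set M Y - {p})" and gp: "g \<noteq> p"
    and \<rho>: "old_height {} g f \<rho>" and adm: "admissible g f X Y"
  shows "potential g f \<rho> X \<noteq> potential g f \<rho> Y \<Longrightarrow> sgn (potential g f \<rho> Y - potential g f \<rho> X) = Z f * X g"
    and "potential g f \<rho> X = potential g f \<rho> Y \<Longrightarrow> sgn (slope g f Y - slope g f X) = Z f * X g"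
proof -
  let ?S = "zero_set M Y - {p}"
  have E': "comodular M X Y" "X g = Y g" "X g \<noteq> 0" "X f = Y f" "X f \<noteq> 0" "diff M g X Y Z" using E by (auto simp: edge_def)
  note C = comodularD[OF E'(1)]
  note N = new_line[OF C(2) o(2)] and L = limit_props[OF C(2)]
  have lX: "limit X = X" using limit_old[OF o(1)] .
  have pS: "p \<notin> ?S" by simp
  have uX: "potential g f \<rho> X = \<rho> X" using E' lX by (simp add: potential_def)
  have hX: "slope g f X = 0" using o by (simp add: slope_def)
  have Zn: "nz Z" using diff_nz[OF C(1-4) E'(6)] .
  have Zc: "Z \<in> covectors M" using diff_cov[OF E'(6)] .
  have ZS: "Z \<in> van M (insert g ?S)"
    using diff_van[OF E'(6) XS N(4)] diff_g[OF E'(6)] unfolding van_insert by auto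
  note pt = corank_insert2[OF N(2) XS E'(3)]
  have "(potential g f \<rho> X \<noteq> potential g f \<rho> Y \<longrightarrow> sgn (potential g f \<rho> Y - potential g f \<rho> X) = Z f * X g) \<and>
    (potential g f \<rho> X = potential g f \<rho> Y \<longrightarrow> sgn (slope g f Y - slope g f X) = Z f * X g)"
  proof (cases "limit Y g = 0")
    case True
    then have f: "limit Y f = 0" using adm by (simp add: admissible_def)
    have "potential g f \<rho> Y = \<rho> X"
      using potential_line[OF C(2) o(2) True f _ gp \<rho> XS o(1)] E' by simp
    moreover have "slope g f Y = 0" using True by (simp add: slope_def)
    moreover have "limit Y \<in> van M (insert g ?S)" using L(1) True unfolding van_insert by simp
    then have "Z f = 0" using point_nz[OF pt ZS Zn _ L(2), of f] f by simp
    ultimately show ?thesis using uX hX by simp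
  next
    case g: False
    have f: "limit Y f \<noteq> 0" using adm g lX E' by (auto simp: admissible_def)
    have uY: "potential g f \<rho> Y = \<rho> (limit Y)" using g f by (simp add: potential_def)
    note D = direction_props[OF C(2) o(2) gp g]
    have hY: "slope g f Y = direction g Y f * Y g" using o g by (simp add: slope_def)
    show ?thesis
    proof (cases "limit Y = X")
      case True
      then have "direction g Y = Z" using diff_unique[OF E'(1-3) _ E'(6)] D(1) by simp
      moreover have "Z f * X g \<in> {-1, 0, 1}"
        using covector_range[OF Zc, of f] covector_range[OF cocircuit_cov[OF C(1)], of g] by auto
      ultimately show ?thesis using uX uY True hX hY E' by auto
    next
      case False
      have W: "diff M g X (limit Y) Z" using line_edge_limit[OF E o XS gp g False] .
      have gg: "X g = limit Y g" using E' L(4)[OF gp g] by simp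
      have s: "sgn (\<rho> (limit Y) - \<rho> X) = Z f * X g"
        using old_heightD[OF \<rho> pS N(2) o(1) L(3) XS L(1) _ _ gg E'(3) W] False by auto
      have "slope g f Y = 0" if "Z f = 0"
      proof -
        have "direction g Y \<in> van M (insert g ?S)" using D(2,3) unfolding van_insert by simp
        then have "direction g Y f = 0" using point_nz[OF pt ZS Zn _ D(4), of f] that by simp
        then show ?thesis using hY by simp
      qed
      then show ?thesis using s uX uY hX E' by auto
    qed
  qed
  then show "potential g f \<rho> X \<noteq> potential g f \<rho> Y \<Longrightarrow> sgn (potential g f \<rho> Y - potential g f \<rho> X) = Z f * X g"
    and "potential g f \<rho> X = potential g f \<rho> Y \<Longrightarrow> sgn (slope g f Y - slope g f X) = Z f * X g" by blast+
qed

lemma edge_into_zero: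
  assumes E: "edge g f X Y Z" and gp: "g \<noteq> p" and fp: "f \<noteq> p"
    and Y: "limit Y f = 0" "limit Y g \<noteq> 0" and X: "\<not> (limit X f = 0 \<and> limit X g \<noteq> 0)"
  shows "Z f = - X f"
  using E gp fp
proof (cases rule: edge_type)
  case both
  then show ?thesis using Y limit_old[of Y] E by (auto simp: edge_def)
next
  case left
  have "limit Y \<noteq> X" using Y E by (auto simp: edge_def)
  then show ?thesis using diff_right[OF line_edge_limit[OF E left gp Y(2)]] Y by blast
next
  case right
  then show ?thesis using Y limit_old[of Y] E by (auto simp: edge_def)
next
  case (plane F j)
  then show ?thesis using plane_edge.into_zero[OF _ Y X] by blast
qed

lemma edge_potential:
  assumes E: "edge g f X Y Z" and gp: "g \<noteq> p" and fp: "f \<noteq> p" and \<rho>: "old_height {} g f \<rho>" and adm: "admissible g f X Y"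
  shows "(potential g f \<rho> X \<noteq> potential g f \<rho> Y \<longrightarrow> sgn (potential g f \<rho> Y - potential g f \<rho> X) = Z f * X g) \<and>
    (potential g f \<rho> X = potential g f \<rho> Y \<longrightarrow> slope g f X \<noteq> slope g f Y \<longrightarrow> sgn (slope g f Y - slope g f X) = Z f * X g) \<and>
    (potential g f \<rho> X = potential g f \<rho> Y \<longrightarrow> slope g f X = 0 \<longrightarrow> slope g f Y = 0 \<longrightarrow> Z f = 0)"
  using E gp fp
proof (cases rule: edge_type)
  case (both S)
  have E': "X g = Y g" "X g \<noteq> 0" "X f = Y f" "X f \<noteq> 0" "diff M g X Y Z" "X \<noteq> Y"
    using E comodularD[of X Y] by (auto simp: edge_def)
  have "potential g f \<rho> X = \<rho> X" "potential g f \<rho> Y = \<rho> Y" "slope g f X = 0" "slope g f Y = 0"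
    using both limit_old[of X] limit_old[of Y] E' by (auto simp: potential_def slope_def)
  then show ?thesis using old_heightD[OF \<rho> both(3,4,1,2,5,6) _ E'(6,1,2,5)] E' by auto
next
  case left
  have "X g \<noteq> 0" using E by (simp add: edge_def)
  then show ?thesis using line_edge[OF E left gp \<rho> adm] by auto
next
  case right
  have Xg: "X g = Y g" "X g \<noteq> 0" using E by (auto simp: edge_def)
  have adm': "admissible g f Y X" using adm by (auto simp: admissible_def)
  note R = line_edge[OF edge_sym[OF E] right(2,1,3) gp \<rho> adm']
  have flip: "sgn (a - b) = - sgn (b - a)" for a b :: int using sgn_minus[of "b - a"] by simp
  show ?thesis
    using R Xg flip[of "potential g f \<rho> Y" "potential g f \<rho> X"] flip[of "slope g f Y" "slope g f X"] by auto
next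
  case (plane F j)
  interpret plane_edge M p e k F j "e j" g f X Y Z by (rule plane)
  show ?thesis using potential_edge[OF \<rho> adm] slope_edge[OF \<rho> adm] by blast
qed

lemma edge_steep:
  assumes E: "edge g f X Y Z" and gp: "g \<noteq> p" and fp: "f \<noteq> p" and \<rho>: "old_height {} g f \<rho>" and adm: "admissible g f X Y"
    and eq: "potential g f \<rho> X = potential g f \<rho> Y" and h: "slope g f X = slope g f Y" "slope g f X \<noteq> 0"
  shows "\<exists>r. oriented_step g (limit X) (limit Y) r \<and>
    (limit X = limit Y \<longrightarrow> oriented_step f (direction g X) (direction g Y) (Z f)) \<and>
    (limit X \<noteq> limit Y \<longrightarrow> Z f * X g = - (slope g f X * X g * r)) \<and>
    (limit X \<noteq> limit Y \<longrightarrow> r = 0 \<longrightarrow> oriented_step f (direction g X) (direction g Y) 0)"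
  using E gp fp
proof (cases rule: edge_type)
  case (plane F j)
  interpret plane_edge M p e k F j "e j" g f X Y Z by (rule plane)
  show ?thesis using steep_edge[OF \<rho> adm eq h] by blast
qed (use h in \<open>auto simp: slope_def\<close>)

section \<open>Exclusion of directed cycles by successive potentials\<close>

definition perturbable :: "'a \<Rightarrow> bool" where
  "perturbable x \<longleftrightarrow> x \<noteq> p \<and> (\<forall>i \<in> {1..k}. \<exists>\<rho>. old_height {} (e i) x \<rho>) \<and>
     (\<forall>i t. 1 \<le> i \<longrightarrow> i < t \<longrightarrow> t \<le> k \<longrightarrow> tie_break x i t)"

lemma mult_mono_sgn:
  fixes s a b d :: int
  assumes "s * d \<ge> 0" and "a \<noteq> b \<Longrightarrow> sgn (b - a) = d"
  shows "s * a \<le> s * b"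
proof (cases "a = b")
  case False
  have "0 \<le> s * d * \<bar>b - a\<bar>" using assms(1) by simp
  also have "\<dots> = s * (sgn (b - a) * \<bar>b - a\<bar>)" using assms(2)[OF False] by simp
  also have "\<dots> = s * (b - a)" by (simp add: sgn_mult_abs)
  finally show ?thesis by (simp add: algebra_simps)
qed simp

text \<open>The sign of \<open>s\<close> is the sense in which the cycle is traversed; both are
  needed because exchanging \<open>f\<close> and \<open>g\<close> reverses it.\<close>

lemma admissible_cycle:
  assumes N: "N > 0" and per: "\<And>i. X (i + N) = X i" and E: "\<And>i. edge g f (X i) (X (Suc i)) (Z i)"
    and mono: "\<And>i. s * (Z i f * X i g) \<ge> 0" and s: "s \<noteq> 0"
    and adm: "\<And>i. admissible g f (X i) (X (Suc i))"
    and \<rho>: "old_height {} g f \<rho>" and pg: "perturbable g" and pf: "perturbable f"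
  shows "Z i f = 0"
proof -
  have gp: "g \<noteq> p" and fp: "f \<noteq> p" using pg pf by (auto simp: perturbable_def)
  let ?u = "\<lambda>i. potential g f \<rho> (X i)" and ?h = "\<lambda>i. slope g f (X i)"
  note P = edge_potential[OF E gp fp \<rho> adm]
  have "s * ?u i = s * ?u j" for i j
    by (rule periodic_mono_const[of "\<lambda>i. s * ?u i", OF _ N]) (use mult_mono_sgn[OF mono] P per in auto)
  then have u: "?u i = ?u j" for i j using s by simp
  have "s * ?h i = s * ?h j" for i j
    by (rule periodic_mono_const[of "\<lambda>i. s * ?h i", OF _ N]) (use mult_mono_sgn[OF mono] P u per in auto)
  then have h: "?h i = ?h j" for i j using s by simp
  show ?thesis
  proof (cases "?h 0 = 0")
    case True
    then show ?thesis using P[of i] u h by metis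
  next
    case False
    have hi: "?h i \<noteq> 0" for i using False h[of i 0] by simp
    have new: "\<not> old (X i)" and lg: "limit (X i) g \<noteq> 0" for i using hi[of i] by (auto simp: slope_def)
    have Xc: "X i \<in> cocircuits M" for i using E[of i] comodularD by (auto simp: edge_def)
    have "X (Suc i) g = X i g" for i using E[of i] by (simp add: edge_def)
    then have Xg: "X i g = X 0 g" for i by (induction i) auto
    have Xg0: "X 0 g \<noteq> 0" using E[of 0] by (simp add: edge_def)
    note L = limit_new_props[OF Xc new]
    note D = direction_props[OF Xc new gp lg]
    have Df: "direction g (X i) f \<noteq> 0" for i using hi[of i] by (auto simp: slope_def split: if_splits)
    have "\<forall>i. \<exists>r. oriented_step g (limit (X i)) (limit (X (Suc i))) r \<and>
      (limit (X i) = limit (X (Suc i)) \<longrightarrow> oriented_step f (direction g (X i)) (direction g (X (Suc i))) (Z i f)) \<and>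
      (limit (X i) \<noteq> limit (X (Suc i)) \<longrightarrow> Z i f * X i g = - (?h i * X i g * r)) \<and>
      (limit (X i) \<noteq> limit (X (Suc i)) \<longrightarrow> r = 0 \<longrightarrow> oriented_step f (direction g (X i)) (direction g (X (Suc i))) 0)"
      using edge_steep[OF E gp fp \<rho> adm u h hi] by blast
    then obtain r where r: "\<And>i. oriented_step g (limit (X i)) (limit (X (Suc i))) (r i)"
      "\<And>i. limit (X i) = limit (X (Suc i)) \<Longrightarrow> oriented_step f (direction g (X i)) (direction g (X (Suc i))) (Z i f)"
      "\<And>i. limit (X i) \<noteq> limit (X (Suc i)) \<Longrightarrow> Z i f * X i g = - (?h i * X i g * r i)"
      "\<And>i. limit (X i) \<noteq> limit (X (Suc i)) \<Longrightarrow> r i = 0 \<Longrightarrow> oriented_step f (direction g (X i)) (direction g (X (Suc i))) 0"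
      by metis
    \<comment> \<open>The orientation passed on is dictated by
      \<open>Z i f * X i g = - (?h i * X i g * r i)\<close>, with slope and sign at \<open>g\<close>
      constant along the cycle.\<close>
    have r0: "r i = 0" for i
    proof (rule no_oriented_cycle[of N "\<lambda>i. limit (X i)" g r "- s * ?h 0 * X 0 g", OF N])
      show "(- s * ?h 0 * X 0 g) * r i \<ge> 0" for i
      proof (cases "limit (X i) = limit (X (Suc i))")
        case True
        then show ?thesis using r(1)[of i] by (simp add: oriented_step_def)
      next
        case False
        then show ?thesis using mono[of i] r(3)[of i] h[of i 0] Xg[of i] by (simp add: algebra_simps)
      qed
      show "- s * ?h 0 * X 0 g \<noteq> 0" using s False Xg0 by simp
      show "\<exists>\<rho>. old_height {} (e i) g \<rho>" if "i \<in> {1..k}" for i using pg that by (auto simp: perturbable_def)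
      show "tie_break g i t" if "1 \<le> i" "i < t" "t \<le> k" for i t using pg that by (auto simp: perturbable_def)
    qed (use per L lg gp r in auto)
    \<comment> \<open>Where the limits differ, \<open>r i = 0\<close> makes the step of the
      directions neutral; elsewhere this step is \<open>Z i f\<close> itself.\<close>
    let ?D = "\<lambda>i. if limit (X i) = limit (X (Suc i)) then Z i f else 0"
    have D0: "?D i = 0" for i
    proof (rule no_oriented_cycle[of N "\<lambda>i. direction g (X i)" f ?D "s * X 0 g", OF N])
      show "(s * X 0 g) * ?D i \<ge> 0" for i using mono[of i] Xg[of i] by (simp add: algebra_simps)
      show "s * X 0 g \<noteq> 0" using s Xg0 by simp
      show "\<exists>\<rho>. old_height {} (e i) f \<rho>" if "i \<in> {1..k}" for i using pf that by (auto simp: perturbable_def)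
      show "tie_break f i t" if "1 \<le> i" "i < t" "t \<le> k" for i t using pf that by (auto simp: perturbable_def)
      show "oriented_step f (direction g (X i)) (direction g (X (Suc i))) (?D i)" for i
        using r(2)[of i] r(4)[OF _ r0, of i] by simp
      show "direction g (X i) p \<noteq> 0" for i using D(5)[of i] L(4)[of i] by simp
    qed (use per D Df fp in auto)
    show ?thesis
    proof (cases "limit (X i) = limit (X (Suc i))")
      case True
      then show ?thesis using D0[of i] by simp
    next
      case False
      then show ?thesis using r(3)[OF False] r0[of i] Xg[of i] Xg0 by simp
    qed
  qed
qed

text \<open>By \<open>edge_into_zero\<close>, entering the condition needs
  \<open>Z f = - X f\<close> and leaving it \<open>Z f = X f\<close>; the sense of the cycle permits
  only one of these.\<close>

lemma indicator_cycle:
  assumes N: "N > 0" and per: "\<And>i. X (i + N) = X i" and E: "\<And>i. edge g f (X i) (X (Suc i)) (Z i)"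
    and mono: "\<And>i. s * (Z i f * X i g) \<ge> 0" and s: "s \<noteq> 0" and gp: "g \<noteq> p" and fp: "f \<noteq> p"
  shows "(limit (X i) f = 0 \<and> limit (X i) g \<noteq> 0) \<longleftrightarrow> (limit (X j) f = 0 \<and> limit (X j) g \<noteq> 0)"
proof -
  define b where "b i \<longleftrightarrow> limit (X i) f = 0 \<and> limit (X i) g \<noteq> 0" for i
  have "X (Suc i) g = X i g" "X (Suc i) f = X i f" for i using E[of i] by (auto simp: edge_def)
  then have Xg: "X i g = X 0 g" "X i f = X 0 f" for i by (induction i) auto
  have X0: "X 0 g \<noteq> 0" "X 0 f \<noteq> 0" using E[of 0] by (auto simp: edge_def)
  let ?c = "- (s * (X 0 f * X 0 g))"
  have "?c * of_bool (b i) = ?c * of_bool (b j)" for i j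
  proof (rule periodic_mono_const[of "\<lambda>i. ?c * of_bool (b i)", OF _ N])
    show "?c * of_bool (b i) \<le> ?c * of_bool (b (Suc i))" for i
    proof -
      have "?c \<ge> 0" if "\<not> b i" "b (Suc i)"
        using edge_into_zero[OF E gp fp, of i] that mono[of i] Xg[of i] by (simp add: b_def)
      moreover have "?c \<le> 0" if "b i" "\<not> b (Suc i)"
        using edge_into_zero[OF edge_sym[OF E] gp fp, of i] that mono[of i] Xg[of i] Xg[of "Suc i"] by (simp add: b_def)
      ultimately show ?thesis by (cases "b i"; cases "b (Suc i)") simp_all
    qed
    show "?c * of_bool (b (i + N)) = ?c * of_bool (b i)" for i by (simp add: b_def per)
  qed
  moreover have "?c \<noteq> 0" using s X0 by simp
  ultimately have "(of_bool (b i) :: int) = of_bool (b j)" by (metis mult_cancel_left)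
  then show ?thesis unfolding b_def[symmetric] by (metis of_bool_eq_iff)
qed

text \<open>If the limits lie on \<open>g\<close> but not on \<open>f\<close>, then
  \<open>f/g\<close> is infinite at all of them. Exchanging \<open>f\<close> and \<open>g\<close>
  makes the ratio zero there and replaces \<open>s\<close> by \<open>- s\<close>.\<close>

lemma no_directed_cycle:
  assumes N: "N > 0" and per: "\<And>i. X (i + N) = X i" and E: "\<And>i. edge g f (X i) (X (Suc i)) (Z i)"
    and mono: "\<And>i. s * (Z i f * X i g) \<ge> 0" and s: "s \<noteq> 0"
    and \<rho>: "old_height {} g f \<rho>" and pg: "perturbable g" and pf: "perturbable f"
  shows "Z i f = 0"
proof -
  have gp: "g \<noteq> p" and fp: "f \<noteq> p" using pg pf by (auto simp: perturbable_def)
  have Xs: "X i g = 1 \<or> X i g = -1" "X i f = 1 \<or> X i f = -1" for i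
  proof -
    have "X i \<in> covectors M" using E[of i] comodularD[of "X i" "X (Suc i)"] cocircuit_cov by (auto simp: edge_def)
    then show "X i g = 1 \<or> X i g = -1" "X i f = 1 \<or> X i f = -1"
      using E[of i] covector_range[of "X i" g] covector_range[of "X i" f] by (auto simp: edge_def)
  qed
  have "\<exists>Z'. edge f g (X i) (X (Suc i)) Z' \<and> Z i f * X i f = - (Z' g * X i g)" for i
    using edge_swap[OF E[of i]] by blast
  then obtain Z' where E': "\<And>i. edge f g (X i) (X (Suc i)) (Z' i)" and sw: "\<And>i. Z i f * X i f = - (Z' i g * X i g)"
    by metis
  have sw': "Z i f * X i g = - (Z' i g * X i f)" for i using sw[of i] Xs[of i] by auto
  have mono': "- s * (Z' i g * X i f) \<ge> 0" for i using mono[of i] sw'[of i] by simp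
  have s': "- s \<noteq> 0" using s by simp
  note zero = indicator_cycle[OF N per E mono s gp fp]
  note inf = indicator_cycle[OF N per E' mono' s' fp gp]
  show ?thesis
  proof (cases "limit (X 0) g = 0 \<and> limit (X 0) f \<noteq> 0")
    case True
    obtain \<rho>' where \<rho>': "old_height {} f g \<rho>'" using old_height_swap[OF \<rho>] .
    have "limit (X i) g = 0 \<and> limit (X i) f \<noteq> 0" for i using True inf[of i 0] by blast
    then have "admissible f g (X i) (X (Suc i))" for i by (simp add: admissible_def)
    then have "Z' i g = 0" using admissible_cycle[OF N per E' mono' s' _ \<rho>' pf pg] by blast
    then show ?thesis using sw[of i] Xs[of i] by auto
  next
    case False
    then have "\<not> (limit (X i) g = 0 \<and> limit (X i) f \<noteq> 0)" for i using inf[of i 0] by blast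
    then have "admissible g f (X i) (X (Suc i))" for i using zero[of i "Suc i"] by (auto simp: admissible_def)
    then show ?thesis using admissible_cycle[OF N per E mono s _ \<rho> pg pf] by blast
  qed
qed

end

section \<open>Transfer along the extension\<close>

definition restrict_sv :: "'a \<Rightarrow> 'a signvec \<Rightarrow> 'a signvec" where
  "restrict_sv p X = (\<lambda>x. if x = p then 0 else X x)"

lemma restrict_sv_apply: "x \<noteq> p \<Longrightarrow> restrict_sv p X x = X x"
  by (simp add: restrict_sv_def)

context oriented_matroid
begin

text \<open>Allows comodularity in a contraction to be shown without computing ranks there: it
  suffices to recognise points on the common line as cocircuits.\<close>

lemma comodular_of_line:
  assumes X: "X \<in> cocircuits M" and Y: "Y \<in> cocircuits M" and ne: "X \<noteq> Y" "X \<noteq> - Y"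
    and line: "\<And>T x. T \<in> van M (zero_set M X \<inter> zero_set M Y) \<Longrightarrow> nz T \<Longrightarrow> T x = 0 \<Longrightarrow> Y x \<noteq> 0 \<Longrightarrow> T \<in> cocircuits M"
  shows "comodular M X Y"
proof -
  let ?F = "zero_set M X \<inter> zero_set M Y"
  have Fg: "?F \<subseteq> ground M" by (auto simp: zero_set_def)
  have XF: "X \<in> van M ?F" and YF: "Y \<in> van M ?F" using X Y cocircuit_cov by (auto simp: van_def zero_set_def)
  obtain y where y: "X y = 0" "Y y \<noteq> 0" "y \<in> ground M" using cocircuit_sep[OF X Y ne] .
  obtain x where x: "X x \<noteq> 0" using cocircuit_nz[OF X] by blast
  have xg: "x \<in> ground M" using cov_ground[OF cocircuit_cov[OF X] x] .
  have XyF: "X \<in> van M (insert y ?F)" using XF y unfolding van_insert by simp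
  have r1: "rank_of M (insert y ?F) = rank_of M ?F + 1" using rank_cert[OF Fg YF y(2)] .
  have yFg: "insert y ?F \<subseteq> ground M" using Fg y by blast
  have r2: "rank_of M (insert x (insert y ?F)) = rank_of M (insert y ?F) + 1" using rank_cert[OF yFg XyF x] .
  have "rank_of M (insert x (insert y ?F)) = om_rank M"
  proof (rule full_rank_iff)
    show "insert x (insert y ?F) \<subseteq> ground M" using yFg xg by simp
    fix T assume T: "T \<in> van M (insert x (insert y ?F))"
    have TF: "T \<in> van M ?F" "T x = 0" "T y = 0" using T unfolding van_insert by auto
    show "T = (\<lambda>_. 0)"
    proof (rule ccontr)
      assume "T \<noteq> (\<lambda>_. 0)"
      then have Tn: "nz T" by (auto simp: fun_eq_iff)
      then have Tc: "T \<in> cocircuits M" using line[OF TF(1) Tn TF(3) y(2)] by blast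
      \<comment> \<open>The composition vanishes at \<open>y\<close> too, so it is a cocircuit whose
        support contains that of \<open>T\<close>; but it is nonzero at \<open>x\<close>, where
        \<open>T\<close> vanishes.\<close>
      have "T \<odot> X \<in> van M ?F" using TF XF scomp_covector by (auto simp: van_def scomp_def)
      moreover have "(T \<odot> X) y = 0" "nz (T \<odot> X)" using TF y x by (auto simp: scomp_def)
      ultimately have TX: "T \<odot> X \<in> cocircuits M" using line y by blast
      have "supp T \<subseteq> supp (T \<odot> X)" "supp T \<noteq> {}" "T \<in> covectors M"
        using Tn cocircuit_cov[OF Tc] by (auto simp: supp_def scomp_def)
      then have "supp T = supp (T \<odot> X)" using TX by (auto simp: cocircuits_def)
      moreover have "x \<in> supp (T \<odot> X)" using x by (auto simp: supp_def scomp_def)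
      ultimately have "x \<in> supp T" by blast
      then show False using TF(2) by (simp add: supp_def)
    qed
  qed
  then have "corank M 2 ?F" using r1 r2 Fg by (simp add: corank_def)
  then show ?thesis using comodularI X Y XF YF ne by blast
qed

end

locale lex_extension_of = lex_extended M' p e k for M' :: "'a signed_system" and p e k +
  fixes M :: "'a signed_system"
  assumes ground_M: "ground M = ground M' - {p}"
    and covectors_M: "covectors M = restrict_sv p ` covectors M'"
begin

lemma restrict_cov: "X \<in> covectors M' \<Longrightarrow> restrict_sv p X \<in> covectors M"
  using covectors_M by blast

lemma lift_cov:
  assumes "T \<in> covectors M"
  obtains T' where "T' \<in> covectors M'" "T = restrict_sv p T'"
  using assms covectors_M by blast

lemma covectors_contract: "T \<in> covectors (contract M A) \<longleftrightarrow> T \<in> covectors M \<and> (\<forall>a \<in> A. T a = 0)"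
  by (simp add: contract_def)

lemma restrict_cocircuit:
  assumes X: "old X" and A: "\<forall>a \<in> A. X a = 0"
  shows "restrict_sv p X \<in> cocircuits (contract M A)"
proof -
  let ?S = "zero_set M' X - {p}"
  have XS: "X \<in> van M' ?S" using old_cov[OF X] by (auto simp: van_def zero_set_def)
  have cov: "restrict_sv p X \<in> covectors (contract M A)"
    using restrict_cov[OF old_cov[OF X]] A by (auto simp: covectors_contract restrict_sv_def)
  have ne: "supp (restrict_sv p X) \<noteq> {}"
  proof
    assume "supp (restrict_sv p X) = {}"
    then have "restrict_sv p X x = 0" for x by (auto simp: supp_def)
    then have "X x = 0" if "x \<noteq> p" for x using restrict_sv_apply[OF that, of X] by simp
    moreover from this have "X p = 0" using not_coloop[OF old_cov[OF X]] by blast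
    ultimately show False using old_nz[OF X] by metis
  qed
  have "\<not> supp T \<subset> supp (restrict_sv p X)" if T: "T \<in> covectors (contract M A)" "supp T \<noteq> {}" for T
  proof
    assume sub: "supp T \<subset> supp (restrict_sv p X)"
    obtain T' where T': "T' \<in> covectors M'" "T = restrict_sv p T'" using T lift_cov covectors_contract by metis
    have "T' x = 0" if x: "x \<in> ?S" for x
    proof -
      have "x \<notin> supp T" using sub x by (auto simp: supp_def restrict_sv_def zero_set_def)
      then show ?thesis using T'(2) x by (auto simp: supp_def restrict_sv_def)
    qed
    then have "T' \<in> van M' ?S" using T' by (simp add: van_def)
    moreover have "nz T'" using T(2) T'(2) by (auto simp: supp_def restrict_sv_def split: if_splits)
    ultimately have "T' = X \<or> T' = - X" using point_unique[OF old_corank[OF X] _ _ XS old_nz[OF X]] by blast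
    then have "supp T = supp (restrict_sv p X)" using T'(2) by (auto simp: supp_def restrict_sv_def)
    then show False using sub by blast
  qed
  then show ?thesis using cov ne by (simp add: cocircuits_def)
qed

text \<open>Old cocircuits vanishing on \<open>A\<close> restrict to cocircuits of the contraction,
  and two of them on a line spanned without \<open>p\<close> remain comodular there, so a height
  function can be pulled back.\<close>

lemma height_transfer:
  assumes eu: "euclidean_program (contract M A) g f" and gp: "g \<noteq> p" and fp: "f \<noteq> p"
  obtains \<rho> where "old_height A g f \<rho>"
proof -
  let ?N = "contract M A"
  interpret N: oriented_matroid ?N using eu by (auto simp: euclidean_program_def om_program_def)
  obtain \<rho>0 where \<rho>0: "height ?N g f \<rho>0" using N.euclidean_height[OF eu] .
  have "old_height A g f (\<lambda>X. \<rho>0 (restrict_sv p X))"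
    unfolding old_height_def
  proof (intro allI impI)
    fix S X Y Z assume S: "p \<notin> S" "corank M' 2 S" and o: "old X" "old Y" and XS: "X \<in> van M' S" "Y \<in> van M' S"
      and A: "\<forall>a \<in> A. X a = 0 \<and> Y a = 0" and ne: "X \<noteq> Y" and g: "X g = Y g" "X g \<noteq> 0" and Z: "diff M' g X Y Z"
    let ?X = "restrict_sv p X" and ?Y = "restrict_sv p Y"
    have c: "?X \<in> cocircuits ?N" "?Y \<in> cocircuits ?N" using restrict_cocircuit o A by blast+
    have ne': "X \<noteq> - Y" using g by auto
    obtain x where x: "x \<noteq> p" "X x = 0" "Y x \<noteq> 0" using old_sep[OF o(1) old_cov[OF o(2)] old_nz[OF o(2)] ne ne'] .
    have neq: "?X \<noteq> ?Y" "?X \<noteq> - ?Y"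
      using x restrict_sv_apply[OF x(1), of X] restrict_sv_apply[OF x(1), of Y] by (metis, metis neg_equal_0_iff_equal uminus_apply)
    have com: "comodular ?N ?X ?Y"
    proof (rule N.comodular_of_line[OF c neq])
      fix T y assume T: "T \<in> van ?N (zero_set ?N ?X \<inter> zero_set ?N ?Y)" "nz T" "T y = 0" "?Y y \<noteq> 0"
      obtain T' where T': "T' \<in> covectors M'" "T = restrict_sv p T'"
        using T(1) lift_cov covectors_contract van_cov by metis
      have yp: "y \<noteq> p" using T(4) by (auto simp: restrict_sv_def)
      have TA: "\<forall>a \<in> A. T a = 0" using T(1) van_cov covectors_contract by metis
      have "T' s = 0" if s: "s \<in> S" for s
      proof -
        have sp: "s \<noteq> p" using s S by auto
        have sg: "s \<in> ground M" using s corank_ground[OF S(2)] sp ground_M by auto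
        have "T s = 0"
        proof (cases "s \<in> A")
          case True then show ?thesis using TA by blast
        next
          case False
          then have "s \<in> zero_set ?N ?X \<inter> zero_set ?N ?Y"
            using sg van_zero[OF XS(1) s] van_zero[OF XS(2) s] by (auto simp: zero_set_def contract_def restrict_sv_def)
          then show ?thesis using van_zero[OF T(1)] by blast
        qed
        then show ?thesis using T'(2) sp by (simp add: restrict_sv_def)
      qed
      then have TS: "T' \<in> van M' S" using T' by (simp add: van_def)
      have "nz T'" "T' y = 0" "Y y \<noteq> 0" using T T'(2) yp by (auto simp: restrict_sv_def split: if_splits)
      then have oT: "old T'" using line_old[OF S(2,1) TS _ _ XS(2) _ yp] by blast
      have "T' a = 0" if aA: "a \<in> A" for a
      proof (cases "a = p")
        case True
        have "X a = 0" "Y a = 0" using A aA by auto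
        then show ?thesis
          using line_common_zero[OF S(2) XS(1) old_nz[OF o(1)] XS(2) old_nz[OF o(2)] ne ne' _ _ TS] by blast
      next
        case False
        then show ?thesis using TA aA T'(2) restrict_sv_apply[OF False, of T'] by simp
      qed
      then show "T \<in> cocircuits ?N" using restrict_cocircuit[OF oT] T'(2) by blast
    qed
    have "diff ?N g ?X ?Y (restrict_sv p Z)"
      unfolding diff_def
    proof (intro conjI allI impI)
      have "\<forall>a \<in> A. Z a = 0" using A diff_left[OF Z] by simp
      then show "restrict_sv p Z \<in> covectors ?N"
        using restrict_cov[OF diff_cov[OF Z]] by (auto simp: covectors_contract restrict_sv_def)
      show "restrict_sv p Z g = 0" using diff_g[OF Z] by (simp add: restrict_sv_def)
      fix d
      show "restrict_sv p Z d = ?Y d" if "?X d = 0"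
        using diff_left[OF Z, of d] that by (auto simp: restrict_sv_def)
      show "restrict_sv p Z d = - ?X d" if "?Y d = 0"
        using diff_right[OF Z, of d] that by (auto simp: restrict_sv_def)
      show "restrict_sv p Z d = ?Y d" if "?X d = - ?Y d"
        using diff_opp[OF Z, of d] that by (auto simp: restrict_sv_def)
    qed
    moreover have "?X g = ?Y g" "?X g \<noteq> 0" using g gp by (auto simp: restrict_sv_def)
    ultimately have "sgn (\<rho>0 ?Y - \<rho>0 ?X) = restrict_sv p Z f * ?X g"
      using \<rho>0 com unfolding height_def by blast
    then show "sgn (\<rho>0 ?Y - \<rho>0 ?X) = Z f * X g" using gp fp by (simp add: restrict_sv_def)
  qed
  then show ?thesis by (rule that)
qed

text \<open>In general position, a tie would put \<open>x\<close> into the closure of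
  \<open>insert (e i) S\<close>, which has less than full rank. Otherwise leading indices up to
  \<open>q\<close> are served by the contractions; they are at most \<open>k - 1\<close> since
  \<open>i < t\<close>.\<close>

lemma perturbableI:
  assumes om: "oriented_matroid M" and xM: "x \<in> ground M"
    and H: "\<And>i. i \<in> {1..k} \<Longrightarrow> euclidean_program M (e i) x"
    and n: "span_index M e k x \<le> q"
    and alt: "general_position M x \<or> (\<forall>i j. 1 \<le> i \<and> i \<le> min q (k - 1) \<and> i < j \<and> j \<le> k \<longrightarrow>
         euclidean_program (contract M (e ` {1..<i})) (e i) (e j))"
  shows "perturbable x"
proof -
  interpret O: oriented_matroid M by (rule om)
  have xp: "x \<noteq> p" using xM ground_M by auto
  have ep: "e i \<noteq> p" if "i \<in> {1..k}" for i using e_ground[OF that] by auto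
  have c0: "contract M {} = M" by (simp add: contract_def)
  have h: "\<exists>\<rho>. old_height {} (e i) x \<rho>" if "i \<in> {1..k}" for i
    using height_transfer[of "{}" "e i" x] H[OF that] ep[OF that] xp c0 by metis
  have tb: "tie_break x i t" if it: "1 \<le> i" "i < t" "t \<le> k" for i t
  proof (cases "general_position M x")
    case True
    have "Z x \<noteq> 0"
      if S: "p \<notin> S" "corank M' 2 S" and U: "old U" "old U'" "U \<in> van M' S" "U' \<in> van M' S" "U \<noteq> U'"
        and ui: "U (e i) = U' (e i)" "U (e i) \<noteq> 0" "U x = U' x" "U x \<noteq> 0" and Z: "diff M' (e i) U U' Z" for S U U' Z
    proof -
      have ii: "i \<in> {1..k}" using it by simp
      have ex: "e i \<noteq> x" using H[OF ii] by (auto simp: euclidean_program_def om_program_def)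
      let ?T = "insert (e i) S"
      have pt: "corank M' 1 ?T" using corank_insert2[OF S(2) U(3) ui(2)] .
      have Tg: "?T \<subseteq> ground M - {x}"
        using corank_ground[OF S(2)] S(1) U(3) ui ground_M e_ground[OF ii] ex by (auto simp: van_def)
      have ZT: "Z \<in> van M' ?T" using diff_van[OF Z U(3,4)] diff_g[OF Z] by (simp add: van_insert)
      have "U \<noteq> - U'" using ui by auto
      then have Zn: "nz Z" using diff_nz[OF old_cocircuit[OF U(1)] old_cocircuit[OF U(2)] U(5) _ Z] by blast
      obtain y where y: "y \<noteq> p" "Z y \<noteq> 0" using not_coloop[OF van_cov[OF ZT]] Zn by metis
      have pT: "p \<notin> ?T" using S ep[OF ii] by auto
      have rv: "restrict_sv p V \<in> van M ?T" if "V \<in> van M' ?T" for V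
        using that restrict_cov[of V] pT by (auto simp: van_def restrict_sv_def)
      have Tg': "?T \<subseteq> ground M" using Tg by blast
      have rZ: "restrict_sv p Z \<in> van M ?T" "restrict_sv p Z y \<noteq> 0" using rv[OF ZT] y by (auto simp: restrict_sv_def)
      have yM: "y \<in> ground M" using O.cov_ground[OF van_cov[OF rZ(1)] rZ(2)] .
      have "rank_of M (insert y ?T) = rank_of M ?T + 1" using O.rank_cert[OF Tg' rZ] .
      moreover have "rank_of M (insert y ?T) \<le> om_rank M" by (rule O.rank_le) (use Tg' yM in auto)
      ultimately have "rank_of M ?T < om_rank M" by simp
      then have "x \<notin> cl M ?T" using True Tg by (simp add: general_position_def)
      then obtain V where V: "V \<in> van M ?T" "V x \<noteq> 0" using O.not_clE[OF Tg' xM] by blast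
      obtain V' where V': "V' \<in> covectors M'" "V = restrict_sv p V'" using lift_cov[OF van_cov[OF V(1)]] .
      have "V' s = 0" if "s \<in> ?T" for s
        using van_zero[OF V(1) that] V'(2) that pT by (auto simp: restrict_sv_def split: if_splits)
      then have "V' \<in> van M' ?T" using V' by (simp add: van_def)
      moreover have "V' x \<noteq> 0" using V V' xp by (simp add: restrict_sv_def)
      ultimately show "Z x \<noteq> 0" using point_nz[OF pt ZT Zn, of V' x] by blast
    qed
    then show ?thesis unfolding tie_break_def untied_def by blast
  next
    case False
    then have eu: "euclidean_program (contract M (e ` {1..<i})) (e i) (e j)" if "i \<le> min q (k - 1)" "i < j" "j \<le> k" for j
      using alt it that by blast
    show ?thesis
    proof (cases "i \<le> q")
      case True
      then have "i \<le> min q (k - 1)" using it by simp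
      then show ?thesis
        using height_transfer[OF eu[of t]] ep[of i] ep[of t] it unfolding tie_break_def by fastforce
    next
      case nq: False
      then have si: "span_index M e k x < i" using n by simp
      have ex: "\<exists>i \<in> {1..k}. x \<in> cl M (e ` {1..i})"
        using si it by (auto simp: span_index_def split: if_splits)
      let ?P = "\<lambda>i. i \<in> {1..k} \<and> x \<in> cl M (e ` {1..i})"
      have "?P (LEAST i. ?P i)" by (rule LeastI_ex) (use ex in blast)
      moreover have "span_index M e k x = (LEAST i. ?P i)" using ex unfolding span_index_def by simp
      ultimately have L: "span_index M e k x \<in> {1..k}" "x \<in> cl M (e ` {1..span_index M e k x})" by auto
      have sub: "e ` {1..span_index M e k x} \<subseteq> ground M"
      proof (rule image_subsetI)
        fix b assume "b \<in> {1..span_index M e k x}"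
        then show "e b \<in> ground M" using L(1) e_ground[of b] ground_M by auto
      qed
      \<comment> \<open>Here \<open>x\<close> is in the closure of elements with index below
        \<open>i\<close>, so \<open>untied\<close> holds vacuously.\<close>
      have "U x = 0" if U: "old U" "\<forall>a \<in> e ` {1..<i}. U a = 0" for U
      proof -
        have "U (e b) = 0" "e b \<noteq> p" if "b \<in> {1..span_index M e k x}" for b using U(2) that si it ep[of b] by auto
        then have "restrict_sv p U \<in> van M (e ` {1..span_index M e k x})"
          using restrict_cov[OF old_cov[OF U(1)]] by (auto simp: van_def restrict_sv_def)
        then have "restrict_sv p U x = 0" using O.van_cl[OF sub _ L(2)] by blast
        then show ?thesis using restrict_sv_apply[OF xp, of U] by simp
      qed
      then show ?thesis unfolding tie_break_def untied_def by blast
    qed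
  qed
  show ?thesis using xp h tb by (simp add: perturbable_def)
qed

end

lemma lex_extension_locale:
  assumes om: "oriented_matroid M" and ind: "independent M (e ` {1..k})" and ext: "lex_extension M e k p M'"
  shows "lex_extension_of M' p e k M"
proof -
  have E: "oriented_matroid M'" "p \<notin> ground M" "ground M' = insert p (ground M)" "delete M' {p} = M" "\<not> coloop M' p"
    "\<And>Y. Y \<in> cocircuits M \<Longrightarrow> Y(p := lex_localization e k Y) \<in> cocircuits M'"
    using ext by (auto simp: lex_extension_def extension_with_localization_def)
  interpret M': oriented_matroid M' by (rule E(1))
  have gM: "ground M = ground M' - {p}" using E(2,3) by auto
  have "(\<lambda>X x. if x \<in> {p} then 0 else X x) ` covectors M' = restrict_sv p ` covectors M'"
    by (rule image_cong) (simp_all add: restrict_sv_def fun_eq_iff)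
  moreover have "covectors M = (\<lambda>X x. if x \<in> {p} then 0 else X x) ` covectors M'"
    by (subst E(4)[symmetric]) (simp add: delete_def)
  ultimately have cM: "covectors M = restrict_sv p ` covectors M'" by simp
  have pg: "p \<in> ground M'" using E(3) by simp
  have eg: "e i \<in> ground M' - {p}" if "i \<in> {1..k}" for i
    using ind imageI[OF that, of e] gM unfolding independent_def by blast
  have nc: "T p = 0" if T: "T \<in> covectors M'" "\<And>x. x \<noteq> p \<Longrightarrow> T x = 0" for T
  proof -
    have "p \<in> cl M' (ground M' - {p})" using E(5) pg by (simp add: coloop_def)
    moreover have "T \<in> van M' (ground M' - {p})" using T by (simp add: van_def)
    ultimately show ?thesis using M'.van_cl[of "ground M' - {p}" T p] by blast
  qed
  have lex: "X p = lex_localization e k X" if X: "X \<in> cocircuits M'" "corank M' 1 (zero_set M' X - {p})" for X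
  proof -
    let ?S = "zero_set M' X - {p}" and ?Y = "restrict_sv p X"
    have Xc: "X \<in> covectors M'" using M'.cocircuit_cov[OF X(1)] .
    have XS: "X \<in> van M' ?S" using Xc by (auto simp: van_def zero_set_def)
    obtain y where y: "y \<noteq> p" "X y \<noteq> 0" using nc[OF Xc] M'.cocircuit_nz[OF X(1)] by metis
    have "\<not> supp T \<subset> supp ?Y" if T: "T \<in> covectors M" "supp T \<noteq> {}" for T
    proof
      assume sub: "supp T \<subset> supp ?Y"
      obtain T' where T': "T' \<in> covectors M'" "T = restrict_sv p T'" using T cM by auto
      have "T' x = 0" if x: "x \<in> ?S" for x
      proof -
        have "x \<notin> supp T" using sub x by (auto simp: supp_def restrict_sv_def zero_set_def)
        then show ?thesis using T'(2) x by (auto simp: supp_def restrict_sv_def)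
      qed
      then have "T' \<in> van M' ?S" using T' by (simp add: van_def)
      moreover have "nz T'" using T(2) T'(2) by (auto simp: supp_def restrict_sv_def split: if_splits)
      ultimately have "T' = X \<or> T' = - X"
        using M'.point_unique[OF X(2) _ _ XS M'.cocircuit_nz[OF X(1)]] by blast
      then have "supp T = supp ?Y" using T'(2) by (auto simp: supp_def restrict_sv_def)
      then show False using sub by blast
    qed
    moreover have "?Y \<in> covectors M" "supp ?Y \<noteq> {}" using Xc cM y by (auto simp: supp_def restrict_sv_def)
    ultimately have "?Y \<in> cocircuits M" by (simp add: cocircuits_def)
    \<comment> \<open>This cocircuit belongs to the same point as \<open>X\<close> and agrees with
      it at \<open>y\<close>, so it is \<open>X\<close>.\<close>
    then have Y': "?Y(p := lex_localization e k ?Y) \<in> cocircuits M'" using E(6) by blast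
    then have "?Y(p := lex_localization e k ?Y) \<in> van M' ?S"
      using M'.cocircuit_cov by (auto simp: van_def zero_set_def restrict_sv_def)
    then have "X = ?Y(p := lex_localization e k ?Y)"
      using M'.point_eq[OF X(2) XS, of _ y] y by (simp add: restrict_sv_def)
    then have "X p = lex_localization e k ?Y" by (metis fun_upd_same)
    moreover have "i \<in> {1..k} \<and> ?Y (e i) \<noteq> 0 \<longleftrightarrow> i \<in> {1..k} \<and> X (e i) \<noteq> 0" for i
      using eg[of i] by (auto simp: restrict_sv_def)
    then have "lex_localization e k ?Y = lex_localization e k X"
    proof -
      assume eqv: "\<And>i. i \<in> {1..k} \<and> ?Y (e i) \<noteq> 0 \<longleftrightarrow> i \<in> {1..k} \<and> X (e i) \<noteq> 0"
      show ?thesis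
      proof (cases "\<exists>i \<in> {1..k}. X (e i) \<noteq> 0")
        case True
        then have "\<exists>i. i \<in> {1..k} \<and> X (e i) \<noteq> 0" by blast
        then have "(LEAST i. i \<in> {1..k} \<and> X (e i) \<noteq> 0) \<in> {1..k}" by (metis (mono_tags, lifting) LeastI_ex)
        then have "e (LEAST i. i \<in> {1..k} \<and> X (e i) \<noteq> 0) \<noteq> p" using eg by blast
        moreover have "\<exists>i \<in> {1..k}. ?Y (e i) \<noteq> 0" using True eqv by blast
        ultimately show ?thesis using True unfolding lex_localization_def eqv by (simp add: restrict_sv_def)
      next
        case False
        then have "\<not> (\<exists>i \<in> {1..k}. ?Y (e i) \<noteq> 0)" using eqv by blast
        then show ?thesis using False unfolding lex_localization_def by simp
      qed
    qed
    ultimately show ?thesis by simp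
  qed
  show ?thesis by unfold_locales (use pg eg nc lex gM cM in auto)
qed

theorem theorem4p42:
  fixes M M' :: "'a signed_system" and e :: "nat \<Rightarrow> 'a" and f g p :: 'a and r k l m n :: nat
  assumes "oriented_matroid M" and "om_rank M = r"
    and "f \<in> ground M" and "g \<in> ground M" and "f \<noteq> g"
    and "k \<le> r" and "inj_on e {1..k}" and "independent M (e ` {1..k})"
    and "l = span_index M e k f" and "m = span_index M e k g"
    and "n = min (max l m) (k - 1)"
    and "euclidean_program M g f"
    and "\<And>i. i \<in> {1..k} \<Longrightarrow> euclidean_program M (e i) f"
    and "\<And>i. i \<in> {1..k} \<Longrightarrow> euclidean_program M (e i) g"
    and "min l m < k + 1 \<or> \<not> general_position M f \<or> \<not> general_position M g \<Longrightarrow>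
      (\<forall>i j. 1 \<le> i \<and> i \<le> n \<and> i < j \<and> j \<le> k \<longrightarrow>
         euclidean_program (contract M (e ` {1..<i})) (e i) (e j))"
    and "lex_extension M e k p M'"
  shows "euclidean_program M' g f"
proof -
  interpret lex_extension_of M' p e k M using lex_extension_locale[OF assms(1,8,16)] .
  interpret O: oriented_matroid M by (rule assms(1))
  have gp: "g \<noteq> p" and fp: "f \<noteq> p" using assms(3,4) ground_M by auto
  have alt: "general_position M x \<or> (\<forall>i j. 1 \<le> i \<and> i \<le> min (max l m) (k - 1) \<and> i < j \<and> j \<le> k \<longrightarrow>
         euclidean_program (contract M (e ` {1..<i})) (e i) (e j))" if "x = f \<or> x = g" for x
    using assms(15) that unfolding assms(11) by blast
  have pf: "perturbable f"
    by (rule perturbableI[OF assms(1,3,13), of "max l m"]) (use alt[of f] assms(9) in auto)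
  have pg: "perturbable g"
    by (rule perturbableI[OF assms(1,4,14), of "max l m"]) (use alt[of g] assms(10) in auto)
  have "contract M {} = M" by (simp add: contract_def)
  then obtain \<rho> where \<rho>: "old_height {} g f \<rho>" using height_transfer[of "{}" g f] assms(12) gp fp by metis
  have om: "om_program M g f" using assms(12) by (simp add: euclidean_program_def)
  have "om_program M' g f"
  proof -
    have "\<exists>T \<in> covectors M. T g \<noteq> 0" using om cl_iff[of "{}" M g] assms(4) by (auto simp: om_program_def loop_def van_def)
    then obtain T where "T \<in> covectors M'" "T g \<noteq> 0" using lift_cov gp restrict_sv_apply by metis
    then have "\<not> loop M' g" using not_clI[of "{}" T g] by (simp add: loop_def van_empty)
    moreover have "f \<in> cl M' (ground M' - {f})"
    proof -
      have "T f = 0" if T: "T \<in> van M' (ground M' - {f})" for T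
      proof -
        have "restrict_sv p T \<in> van M (ground M - {f})"
          using T restrict_cov[OF van_cov[OF T]] ground_M by (auto simp: van_def restrict_sv_def)
        moreover have "f \<in> cl M (ground M - {f})" using om assms(3) by (simp add: om_program_def coloop_def)
        ultimately have "restrict_sv p T f = 0" using O.van_cl[of "ground M - {f}"] by blast
        then show ?thesis using fp by (simp add: restrict_sv_def)
      qed
      then show ?thesis using assms(3) ground_M by (subst cl_iff) auto
    qed
    ultimately show ?thesis
      using assms(3-5) ground_M oriented_matroid_axioms by (auto simp: om_program_def coloop_def)
  qed
  moreover have False if cyc: "directed_cycle M' g f Xs" for Xs
  proof -
    let ?N = "length Xs"
    define X where "X i = Xs ! (i mod ?N)" for i
    have N: "?N > 0" using cyc by (simp add: directed_cycle_def)
    have per: "X (i + ?N) = X i" for i by (simp add: X_def)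
    have step: "graph_edge M' g (X i) (X (Suc i)) \<and> (forward M' g f (X i) (X (Suc i)) \<or> undirected M' g f (X i) (X (Suc i)))" for i
    proof -
      have "i mod ?N < ?N" using N by simp
      moreover have "Suc (i mod ?N) mod ?N = Suc i mod ?N" by (simp add: mod_Suc_eq)
      ultimately show ?thesis using cyc unfolding directed_cycle_def Let_def X_def by metis
    qed
    obtain i0 where i0: "forward M' g f (X i0) (X (Suc i0))"
      using cyc unfolding directed_cycle_def X_def by (metis mod_less)
    have X: "comodular M' (X i) (X (Suc i))" "X i g = 1" for i
      using step[of i] by (auto simp: graph_edge_def graph_vertices_def)
    have gg: "X i g = X (Suc i) g" "X i g \<noteq> 0" for i using X(2) by simp_all
    have "\<exists>Z. diff M' g (X i) (X (Suc i)) Z \<and> (Z f = 0 \<or> Z f = 1)" for i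
      using step[of i] elimination_iff_diff[OF X(1) gg] unfolding forward_def undirected_def by blast
    then obtain Z where Z: "\<And>i. diff M' g (X i) (X (Suc i)) (Z i)" "\<And>i. Z i f = 0 \<or> Z i f = 1" by metis
    have "\<exists>Z'. diff M' g (X i0) (X (Suc i0)) Z' \<and> Z' f = 1"
      using i0 elimination_iff_diff[OF X(1) gg] unfolding forward_def by blast
    then have Z0: "Z i0 f = 1" using diff_unique[OF X(1) gg Z(1)] by metis
    have cov: "X i \<in> covectors M'" for i using comodularD(1)[OF X(1)] cocircuit_cov by blast
    \<comment> \<open>Where the signs at \<open>f\<close> differ, \<open>Z i f\<close> is the sign
      of their increase, and it is never negative; so the sign at \<open>f\<close> cannot drop and
      is constant around the cycle.\<close>
    have "X i f \<le> X (Suc i) f" for i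
    proof (cases "X i f = X (Suc i) f")
      case False
      then have "sgn (X (Suc i) f - X i f) \<ge> 0" using sgn_diff[OF Z(1) cov cov False] Z(2)[of i] by auto
      then show ?thesis by (simp add: sgn_if split: if_splits)
    qed simp
    then have Xf: "X i f = X j f" for i j
      using periodic_mono_const[of "\<lambda>i. X i f", OF _ N] per by simp
    \<comment> \<open>If \<open>f\<close> vanished at all vertices, it would vanish at all
      differences, against the forward edge.\<close>
    have "X 0 f \<noteq> 0"
    proof
      assume "X 0 f = 0"
      then have "X i0 f = 0" "X (Suc i0) f = 0" using Xf by metis+
      then show False using diff_left[OF Z(1)] Z0 by fastforce
    qed
    then have E: "edge g f (X i) (X (Suc i)) (Z i)" for i
      using X(1)[of i] gg[of i] Xf[of i "Suc i"] Xf[of i 0] Z(1)[of i] by (simp add: edge_def)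
    have "Z i0 f = 0"
      by (rule no_directed_cycle[OF N per E _ _ \<rho> pg pf, of 1]) (use Z(2) X(2) in \<open>auto, metis zero_le_one order_refl\<close>)
    then show False using Z0 by simp
  qed
  ultimately show ?thesis by (auto simp: euclidean_program_def)
qed

end
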